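(* Let $m\in\mathbb{N}$ and $1\le p\le\infty$, let $A_0,A_1$ be complex $m\times m$ matrices with $A_1\neq 0$, and suppose that there is a rational function $\phi$ (the characteristic function) such that $A_1R(\lambda,A_0)A_1=\phi(\lambda)A_1$ for all $\lambda\in\rho(A_0)$. Let $A$ be the bounded operator on $X=\ell^p(\mathbb{N},\mathbb{C}^m)$ given by $Ax=(A_0x_1,\,A_0x_2+A_1x_1,\,A_0x_3+A_1x_2,\dots)$ for $x=(x_k)_{k\ge1}\in X$, let $(T(t))_{t\ge0}$ be the $C_0$-semigroup generated by $A$, and for $x_0\in X$ write $x(t)=T(t)x_0$, $t\ge0$. Suppose that $\sigma(A_0)\subseteq\mathbb{C}_-$, that $0\in\Omega_\phi^+\subseteq\mathbb{C}_-\cup\{0\}$, where $\Omega_\phi^+=\{\lambda\in\rho(A_0):|\phi(\lambda)|\ge1\}$, and that $\phi$ is completely monotonic. Let $S\in\mathcal{B}(X)$ be the right shift $Sx=(0,x_1,x_2,\dots)$, let $M\in\mathcal{B}(X)$ be given by $Mx=(A_1A_0^{-1}x_k)_{k\ge1}$, and let $Y=\{x_0\in X:\lim_{t\to\infty}x(t)\text{ exists}\}$. Then $$Y=\Big\{x_0\in X:\Big\|\frac1n\sum_{k=1}^n\phi(0)^kS^kMx_0\Big\|\to0\text{ as }n\to\infty\Big\},$$ and $Y=X$ if and only if $1<p<\infty$. Moreover, $\|x(t)\|\to0$ as $t\to\infty$ whenever $x_0\in Y$. If $x_0\in Y$ is such that $$\Big\|\frac1n\sum_{k=1}^n\phi(0)^kS^kMx_0\Big\|=O(n^{-1}),\quad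 n\to\infty,$$ then $$\|x(t)\|=O\left(\frac{\log(t)^{|1/2-1/p|}}{t^{1/2}}\right),\quad t\to\infty.$$ Finally, for $1\le p\le\infty$ and all $x_0\in X$, $$\|\dot{x}(t)\|=O\left(\frac{\log(t)^{|1/2-1/p|}}{t^{1/2}}\right),\quad t\to\infty.$$
   Context: $\mathbb{C}_-=\{\lambda\in\mathbb{C}:\operatorname{Re}\lambda<0\}$. $\sigma$ and $\rho$ denote spectrum and resolvent set, $R(\lambda,A_0)=(\lambda-A_0)^{-1}$, and $\mathcal{B}(X)$ is the set of bounded linear operators on $X$. The space $\ell^p(\mathbb{N},\mathbb{C}^m)$ carries its natural norm, with the Euclidean norm on $\mathbb{C}^m$; for $p=\infty$ one sets $1/p=0$. A smooth function $f\colon(0,\infty)\to\mathbb{R}$ is completely monotonic if $(-1)^nf^{(n)}(s)\ge0$ for all $s>0$ and all integers $n\ge0$. The characteristic function $\phi$ is said to be completely monotonic if $(0,\infty)\subseteq\rho(A_0)$ and the restriction of $\phi$ to $(0,\infty)$ is real-valued and completely monotonic. *)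

theory Defs
  imports "HOL-Analysis.Analysis" "HOL-Library.Landau_Symbols"
begin

section \<open>Spectrum of a matrix and the characteristic function\<close>

definition resolvent_set :: "complex^'m^'m \<Rightarrow> complex set" where
  "resolvent_set B = {z. invertible (mat z - B)}"

definition spectrum :: "complex^'m^'m \<Rightarrow> complex set" where
  "spectrum B = - resolvent_set B"

definition resolvent :: "complex \<Rightarrow> complex^'m^'m \<Rightarrow> complex^'m^'m" where
  "resolvent z B = matrix_inv (mat z - B)"

text \<open>A rational function is a quotient in lowest terms; it takes the junk value 0 at its poles.\<close>

definition rational_function :: "(complex \<Rightarrow> complex) \<Rightarrow> bool" where
  "rational_function f \<longleftrightarrow>
     (\<exists>p q. q \<noteq> 0 \<and> coprime p q \<and> (\<forall>z. f z = poly p z / poly q z))"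

definition Omega_plus :: "complex^'m^'m \<Rightarrow> (complex \<Rightarrow> complex) \<Rightarrow> complex set" where
  "Omega_plus A0 \<phi> = {z \<in> resolvent_set A0. cmod (\<phi> z) \<ge> 1}"

text \<open>Only the values of the function on the open half-line \<open>{0<..}\<close> matter.\<close>

definition completely_monotonic :: "(real \<Rightarrow> real) \<Rightarrow> bool" where
  "completely_monotonic f \<longleftrightarrow>
     (\<forall>n. (deriv ^^ n) f differentiable_on {0<..}) \<and>
     (\<forall>n. \<forall>s>0. (-1) ^ n * (deriv ^^ n) f s \<ge> 0)"

definition char_completely_monotonic ::
    "complex^'m^'m \<Rightarrow> (complex \<Rightarrow> complex) \<Rightarrow> bool" where
  "char_completely_monotonic A0 \<phi> \<longleftrightarrow>
     (\<forall>s::real>0. complex_of_real s \<in> resolvent_set A0) \<and>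
     (\<forall>s::real>0. \<phi> (complex_of_real s) \<in> \<real>) \<and>
     completely_monotonic (\<lambda>s. Re (\<phi> (complex_of_real s)))"

section \<open>The sequence spaces\<close>

text \<open>Sequences are indexed from 0, so that the entry \<open>x k\<close> is $x_{k+1}$.
  Every notion below is meant for \<open>1 \<le> p\<close>.\<close>

type_synonym 'm cseq = "nat \<Rightarrow> complex^'m"

definition lp_space :: "ennreal \<Rightarrow> 'm::finite cseq set" where
  "lp_space p = (if p = \<infinity> then {x. bounded (range x)}
                 else {x. summable (\<lambda>k. norm (x k) powr enn2real p)})"

definition lp_norm :: "ennreal \<Rightarrow> 'm::finite cseq \<Rightarrow> real" where
  "lp_norm p x = (if p = \<infinity> then (SUP k. norm (x k))
                  else (\<Sum>k. norm (x k) powr enn2real p) powr (1 / enn2real p))"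

definition lp_tendsto ::
    "ennreal \<Rightarrow> ('b \<Rightarrow> 'm::finite cseq) \<Rightarrow> 'm cseq \<Rightarrow> 'b filter \<Rightarrow> bool" where
  "lp_tendsto p f y F \<longleftrightarrow> ((\<lambda>b. lp_norm p (\<lambda>k. f b k - y k)) \<longlongrightarrow> 0) F"

definition lp_bounded_linear :: "ennreal \<Rightarrow> ('m::finite cseq \<Rightarrow> 'm cseq) \<Rightarrow> bool" where
  "lp_bounded_linear p B \<longleftrightarrow>
     (\<forall>x\<in>lp_space p. B x \<in> lp_space p) \<and>
     (\<forall>x\<in>lp_space p. \<forall>y\<in>lp_space p. B (\<lambda>k. x k + y k) = (\<lambda>k. B x k + B y k)) \<and>
     (\<forall>c. \<forall>x\<in>lp_space p. B (\<lambda>k. c *s x k) = (\<lambda>k. c *s B x k)) \<and>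
     (\<exists>C. \<forall>x\<in>lp_space p. lp_norm p (B x) \<le> C * lp_norm p x)"

text \<open>Differentiability in the norm, for functions on the half-line \<open>{0..}\<close>
  (hence one-sided at 0).\<close>

definition lp_has_derivative_at ::
    "ennreal \<Rightarrow> (real \<Rightarrow> 'm::finite cseq) \<Rightarrow> 'm cseq \<Rightarrow> real \<Rightarrow> bool" where
  "lp_has_derivative_at p x y t \<longleftrightarrow>
     y \<in> lp_space p \<and>
     lp_tendsto p (\<lambda>s k. (x s k - x t k) /\<^sub>R (s - t)) y (at t within {0..})"

definition lp_C0_semigroup :: "ennreal \<Rightarrow> (real \<Rightarrow> 'm::finite cseq \<Rightarrow> 'm cseq) \<Rightarrow> bool" where
  "lp_C0_semigroup p T \<longleftrightarrow>
     (\<forall>t\<ge>0. lp_bounded_linear p (T t)) \<and>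
     (\<forall>x\<in>lp_space p. T 0 x = x) \<and>
     (\<forall>s\<ge>0. \<forall>t\<ge>0. \<forall>x\<in>lp_space p. T (s + t) x = T s (T t x)) \<and>
     (\<forall>x\<in>lp_space p. lp_tendsto p (\<lambda>t. T t x) x (at_right 0))"

text \<open>The generator of \<open>T\<close> is defined on the whole space and equals \<open>B\<close> there: the graph of
  the generator consists of all pairs \<open>(x, y)\<close> such that $h^{-1}(T(h)x - x) \to y$ as
  $h \to 0^+$.\<close>

definition lp_generates ::
    "ennreal \<Rightarrow> ('m::finite cseq \<Rightarrow> 'm cseq) \<Rightarrow> (real \<Rightarrow> 'm cseq \<Rightarrow> 'm cseq) \<Rightarrow> bool" where
  "lp_generates p B T \<longleftrightarrow>
     lp_C0_semigroup p T \<and>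
     (\<forall>x\<in>lp_space p. \<forall>y\<in>lp_space p.
        lp_tendsto p (\<lambda>h k. (T h x k - x k) /\<^sub>R h) y (at_right 0) \<longleftrightarrow> y = B x)"

section \<open>The operators of the system\<close>

definition sys_op :: "complex^'m^'m \<Rightarrow> complex^'m^'m \<Rightarrow> 'm::finite cseq \<Rightarrow> 'm cseq" where
  "sys_op A0 A1 x = (\<lambda>k. case k of 0 \<Rightarrow> A0 *v x 0 | Suc j \<Rightarrow> A0 *v x (Suc j) + A1 *v x j)"

definition right_shift :: "'m::finite cseq \<Rightarrow> 'm cseq" where
  "right_shift x = (\<lambda>k. case k of 0 \<Rightarrow> 0 | Suc j \<Rightarrow> x j)"

definition M_op :: "complex^'m^'m \<Rightarrow> complex^'m^'m \<Rightarrow> 'm::finite cseq \<Rightarrow> 'm cseq" where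
  "M_op A0 A1 x = (\<lambda>k. (A1 ** matrix_inv A0) *v x k)"

text \<open>The means $\frac1n \sum_{k=1}^n c^k S^k y$; only \<open>n \<ge> 1\<close> is relevant.\<close>

definition shift_mean :: "complex \<Rightarrow> 'm::finite cseq \<Rightarrow> nat \<Rightarrow> 'm cseq" where
  "shift_mean c y n =
     (\<lambda>j. (1 / real n) *\<^sub>R (\<Sum>k=1..n. c ^ k *s (right_shift ^^ k) y j))"

definition convergence_set ::
    "ennreal \<Rightarrow> (real \<Rightarrow> 'm::finite cseq \<Rightarrow> 'm cseq) \<Rightarrow> 'm cseq set" where
  "convergence_set p T =
     {x \<in> lp_space p. \<exists>y\<in>lp_space p. lp_tendsto p (\<lambda>t. T t x) y at_top}"

text \<open>In \<^typ>\<open>ennreal\<close>, \<open>1 / \<infinity> = 0\<close>, as the convention for \<open>p = \<infinity>\<close> requires.\<close>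

definition log_rate :: "ennreal \<Rightarrow> real \<Rightarrow> real" where
  "log_rate p t = ln t powr \<bar>1/2 - enn2real (1 / p)\<bar> / t powr (1/2)"

end

theory Submission
  imports Defs "HOL-Complex_Analysis.Complex_Analysis"
begin

text \<open>
  Solving \<open>(\<lambda> - A) y = x\<close> coordinate by coordinate and using \<open>A1 R(\<lambda>, A0) A1 = \<phi>(\<lambda>) A1\<close> shows that the
  coefficient of the \<open>j\<close>-fold shift in \<open>R(\<lambda>, A)\<close> is \<open>\<phi>(\<lambda>)\<^sup>j\<^sup>-\<^sup>1 R(\<lambda>, A0) A1 R(\<lambda>, A0)\<close>. So the system behaves like
  a renewal process that climbs through the coordinates, with waiting times of Laplace transform \<open>\<phi>\<close>.
  Complete monotonicity and the hypotheses on \<open>\<Omega>\<^sub>+\<close> give \<open>\<phi>(0) = 1\<close>, and the waiting time has positive mean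
  and, since \<open>\<phi>\<close> is rational, positive variance (\<open>cm_rational_moments\<close>).

  The core is the bound \<open>\<parallel>A T(t)\<parallel> = O(t\<^bsup>-1/2\<^esup>)\<close>, valid for every \<open>p\<close> and at least as good as the rate with the logarithm.
  It follows from power boundedness of \<open>Q = I + A / c\<close> for some large \<open>c\<close>: then \<open>T(t)\<close> is the average of
  the powers of \<open>Q\<close> with Poisson weights of mean \<open>c t\<close>, and in \<open>A T(t) = c (Q - I) T(t)\<close> the weights are
  replaced by their differences, of total variation at most \<open>(c t)\<^bsup>-1/2\<^esup>\<close> (\<open>semigroup_bounds\<close>). Since the abstract
  semigroup must first be identified with this average, its orbits are shown to be differentiable, by the uniform
  boundedness principle, and compared coordinatewise with the solution of the differential equation
  (\<open>semigroup_eq_poisson\<close>).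

  Power boundedness holds on all the spaces at once because the powers of \<open>Q\<close> are convolutions with summable
  kernels. By the characteristic equation the kernels are governed by the powers of one scalar power series, the
  expansion of \<open>G(w) = \<phi>(c (1/w - 1))\<close> at \<open>0\<close>, and what must be bounded is \<open>\<Sum>j. \<bar>[w\<^sup>n] G(w)\<^sup>j\<bar>\<close>, uniformly in \<open>n\<close>.
  This is a local limit estimate: the coefficient is at most of order \<open>j\<^bsup>-1/2\<^esup>\<close> and, away from the mean \<open>j M\<close>, of
  order \<open>j\<^bsup>1/2\<^esup> / (n - j M)\<^sup>2\<close> (\<open>fps_power_coeffs_bounded\<close>). It requires \<open>\<bar>G(w)\<bar>\<^sup>2 \<le> 1 - \<kappa> \<bar>w - 1\<bar>\<^sup>2\<close> on the unit
  circle, that is, quadratic decay of \<open>\<bar>\<phi>\<bar>\<close> on the circle \<open>\<bar>\<lambda> + c\<bar> = c\<close>. That circle touches the imaginary axis, on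
  which \<open>\<bar>\<phi>\<bar> < 1\<close> except at \<open>0\<close>; near \<open>0\<close> the positive variance, and elsewhere compactness, tolerate the slight
  bend to the left (\<open>circle_bound\<close>).

  With the decay at hand the rest is mean ergodic theory. The operator \<open>A\<close> is injective, so a convergent orbit tends to
  \<open>0\<close>, and this happens exactly on the closure of the range of \<open>A\<close>. Evaluating the characteristic equation at \<open>0\<close>
  gives \<open>M A = (I - S) A1\<close> and \<open>M\<^sup>2 = - M\<close>, by which \<open>x\<close> lies in the range of \<open>A\<close>, or in its closure, if and only
  if \<open>M x\<close> does so for \<open>I - S\<close> (\<open>range_decomposition\<close>). The closure of the range of \<open>I - S\<close> consists of the sequences
  whose means under \<open>S\<close> tend to \<open>0\<close>, and means of order \<open>1 / n\<close> put \<open>M x\<close> into the range itself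
  (\<open>bounded_means_range\<close>), so that \<open>T(t) x = A T(t) g\<close> for some \<open>g\<close>.
\<close>

text \<open>The symbol \<open>$\<close> is reserved for the components of vectors.\<close>

no_notation fps_nth (infixl "$" 75)

section \<open>Norm bounds in the sequence spaces\<close>

text \<open>A bound on the norm that includes membership in the space. Both cases are conditions on finite
  sections, so the bounds pass to coordinatewise limits and are easily added up.\<close>

definition lp_le :: "ennreal \<Rightarrow> 'm::finite cseq \<Rightarrow> real \<Rightarrow> bool" where
  "lp_le p x C \<longleftrightarrow> 0 \<le> C \<and>
     (if p = \<infinity> then \<forall>k. norm (x k) \<le> C
      else \<forall>N. (\<Sum>k<N. norm (x k) powr enn2real p) \<le> C powr enn2real p)"

lemma one_le_enn2real:
  assumes "1 \<le> p" "p \<noteq> \<infinity>"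
  shows "1 \<le> enn2real p"
  using assms by (metis enn2real_1 enn2real_mono infinity_ennreal_def top.not_eq_extremum)

lemma lp_le_iff:
  assumes "1 \<le> p"
  shows "lp_le p x C \<longleftrightarrow> x \<in> lp_space p \<and> lp_norm p x \<le> C"
proof (cases "p = \<infinity>")
  case True
  have 1: "bdd_above (range (\<lambda>k. norm (x k)))" if "bounded (range x)"
    using that by (auto simp: bounded_iff bdd_above_def)
  have "norm (x k) \<le> C" if "bounded (range x)" "(SUP k. norm (x k)) \<le> C" for k
    using cSUP_upper[OF _ 1[OF that(1)], of k] that(2) by auto
  moreover have "0 \<le> C" if "\<And>k. norm (x k) \<le> C"
    using that[of 0] norm_ge_zero[of "x 0"] by linarith
  ultimately show ?thesis
    using True by (auto simp: lp_le_def lp_space_def lp_norm_def bounded_iff intro!: cSUP_least)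
next
  case False
  define r where "r = enn2real p"
  have r: "1 \<le> r" using one_le_enn2real[OF assms False] by (simp add: r_def)
  show ?thesis
  proof
    assume L: "lp_le p x C"
    then have C: "0 \<le> C" and b: "\<And>N. (\<Sum>k<N. norm (x k) powr r) \<le> C powr r"
      using False by (auto simp: lp_le_def r_def)
    have s: "summable (\<lambda>k. norm (x k) powr r)"
      by (rule summableI_nonneg_bounded[OF _ b]) auto
    have "(\<Sum>k. norm (x k) powr r) \<le> C powr r"
      by (rule suminf_le_const[OF s b])
    then have "(\<Sum>k. norm (x k) powr r) powr (1/r) \<le> (C powr r) powr (1/r)"
      using r by (intro powr_mono2) (auto intro: suminf_nonneg[OF s])
    also have "\<dots> = C" using C r by (simp add: powr_powr)
    finally show "x \<in> lp_space p \<and> lp_norm p x \<le> C"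
      using s False by (simp add: lp_space_def lp_norm_def r_def)
  next
    assume R: "x \<in> lp_space p \<and> lp_norm p x \<le> C"
    then have s: "summable (\<lambda>k. norm (x k) powr r)" 
      and n: "(\<Sum>k. norm (x k) powr r) powr (1/r) \<le> C"
      using False by (simp_all add: lp_space_def lp_norm_def r_def)
    have C: "0 \<le> C" using n powr_ge_zero order_trans by blast
    have nn: "0 \<le> (\<Sum>k. norm (x k) powr r)" by (intro suminf_nonneg[OF s]) auto
    have "(\<Sum>k<N. norm (x k) powr r) \<le> C powr r" for N
    proof -
      have "(\<Sum>k<N. norm (x k) powr r) \<le> (\<Sum>k. norm (x k) powr r)"
        by (rule sum_le_suminf[OF s]) auto
      also have "\<dots> = ((\<Sum>k. norm (x k) powr r) powr (1/r)) powr r"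
        using nn r by (simp add: powr_powr)
      also have "\<dots> \<le> C powr r"
        using n r by (intro powr_mono2) auto
      finally show ?thesis .
    qed
    then show "lp_le p x C" using C False by (simp add: lp_le_def r_def)
  qed
qed

lemma lp_le_nonneg: "lp_le p x C \<Longrightarrow> 0 \<le> C"
  by (simp add: lp_le_def)

lemma lp_space_iff_lp_le:
  "1 \<le> p \<Longrightarrow> x \<in> lp_space p \<longleftrightarrow> lp_le p x (lp_norm p x)"
  by (simp add: lp_le_iff)

lemma lp_norm_nonneg: "1 \<le> p \<Longrightarrow> x \<in> lp_space p \<Longrightarrow> 0 \<le> lp_norm p x"
  using lp_space_iff_lp_le lp_le_nonneg by blast

lemma lp_le_mono: "lp_le p x C \<Longrightarrow> C \<le> D \<Longrightarrow> 1 \<le> p \<Longrightarrow> lp_le p x D"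
  by (simp add: lp_le_iff)

lemma lp_le_zero: "lp_le p (\<lambda>k. 0) 0"
  by (simp add: lp_le_def)

lemma lp_le_coord:
  assumes "1 \<le> p" "lp_le p x C"
  shows "norm (x k) \<le> C"
proof (cases "p = \<infinity>")
  case False
  define r where "r = enn2real p"
  have r: "1 \<le> r" using one_le_enn2real[OF assms(1) False] by (simp add: r_def)
  have "norm (x k) powr r \<le> (\<Sum>j<Suc k. norm (x j) powr r)"
    by (rule member_le_sum) auto
  also have "\<dots> \<le> C powr r" using assms False by (simp add: lp_le_def r_def del: sum.lessThan_Suc)
  finally have "norm (x k) powr r \<le> C powr r" .
  then show ?thesis using r lp_le_nonneg[OF assms(2)] 
    by (meson linorder_not_less norm_ge_zero powr_less_mono2 order_less_le_trans zero_less_one not_le)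
qed (use assms in \<open>auto simp: lp_le_def\<close>)

lemma lp_le_dominated:
  assumes "lp_le p x C" "\<And>k. norm (y k) \<le> a * norm (x k)" "0 \<le> a" "1 \<le> p"
  shows "lp_le p y (a * C)"
proof (cases "p = \<infinity>")
  case True
  then show ?thesis using assms unfolding lp_le_def
    by (auto intro: order_trans[OF assms(2)] mult_left_mono)
next
  case False
  define r where "r = enn2real p"
  have r: "1 \<le> r" using one_le_enn2real[OF assms(4) False] by (simp add: r_def)
  have C: "0 \<le> C" using assms lp_le_nonneg by blast
  have "(\<Sum>k<N. norm (y k) powr r) \<le> (a * C) powr r" for N
  proof -
    have "(\<Sum>k<N. norm (y k) powr r) \<le> (\<Sum>k<N. (a * norm (x k)) powr r)"
      using r assms by (intro sum_mono powr_mono2) auto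
    also have "\<dots> = a powr r * (\<Sum>k<N. norm (x k) powr r)"
      using assms by (simp add: powr_mult sum_distrib_left)
    also have "\<dots> \<le> a powr r * C powr r"
      using assms False by (intro mult_left_mono) (auto simp: lp_le_def r_def)
    also have "\<dots> = (a * C) powr r" using assms C by (simp add: powr_mult)
    finally show ?thesis .
  qed
  then show ?thesis using assms C False by (auto simp: lp_le_def r_def)
qed

lemma powr_convex_nonneg:
  fixes r :: real
  assumes "1 \<le> r" "0 \<le> a" "0 \<le> b" "0 \<le> l" "l \<le> 1"
  shows "(l * a + (1 - l) * b) powr r \<le> l * a powr r + (1 - l) * b powr r"
proof -
  have scale: "(u * c) powr r \<le> u * c powr r" if "0 \<le> u" "u \<le> 1" "0 \<le> c" for u c :: real
  proof -
    have "u powr r \<le> u"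
    proof (cases "u = 0")
      case False
      then show ?thesis using powr_mono'[of 1 r u] that assms by simp
    qed simp
    then have "u powr r * c powr r \<le> u * c powr r"
      by (intro mult_right_mono) auto
    then show ?thesis using that by (simp add: powr_mult)
  qed
  consider "a = 0" | "b = 0" | "0 < a" "0 < b" using assms by linarith
  then show ?thesis
  proof cases
    case 1 then show ?thesis using scale[of "1-l" b] assms by simp
  next
    case 2 then show ?thesis using scale[of "l" a] assms by simp
  next
    case 3
    then show ?thesis using convex_onD[OF powr_convex[OF assms(1)], of "1-l" a b] assms
      by (simp add: algebra_simps)
  qed
qed

text \<open>Minkowski's inequality: after normalising \<open>x\<close> and \<open>y\<close> by their bounds, the sum is a convex
  combination with weight \<open>C / (C + D)\<close>, and \<open>t \<mapsto> t\<^sup>p\<close> is convex.\<close>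

lemma lp_le_add:
  assumes p: "1 \<le> p" and x: "lp_le p x C" and y: "lp_le p y D"
  shows "lp_le p (\<lambda>k. x k + y k) (C + D)"
proof -
  have C: "0 \<le> C" and D: "0 \<le> D" using x y lp_le_nonneg by auto
  consider "p = \<infinity>" | "C = 0" | "D = 0" | "p \<noteq> \<infinity>" "0 < C" "0 < D"
    using C D by linarith
  then show ?thesis
  proof cases
    case 1 then show ?thesis using x y unfolding lp_le_def
      by (auto intro: order_trans[OF norm_triangle_ineq] add_mono)
  next
    case 2
    then have "x k = 0" for k using lp_le_coord[OF p x, of k] by simp
    then show ?thesis using 2 y by simp
  next
    case 3
    then have "y k = 0" for k using lp_le_coord[OF p y, of k] by simp
    then show ?thesis using 3 x by simp
  next
    case 4
    define r where "r = enn2real p"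
    have r: "1 \<le> r" using one_le_enn2real[OF p 4(1)] by (simp add: r_def)
    define l where "l = C / (C + D)"
    have l: "0 \<le> l" "l \<le> 1" and l': "1 - l = D / (C + D)" using 4 by (auto simp: l_def field_simps)
    have b: "(\<Sum>k<N. norm (x k) powr r) \<le> C powr r" "(\<Sum>k<N. norm (y k) powr r) \<le> D powr r" for N
      using x y 4 by (auto simp: lp_le_def r_def)
    have pt: "norm (x k + y k) powr r \<le>
        (C + D) powr r * (l * (norm (x k) powr r / C powr r) + (1 - l) * (norm (y k) powr r / D powr r))" for k
    proof -
      have "norm (x k + y k) \<le> (C + D) * (l * (norm (x k) / C) + (1 - l) * (norm (y k) / D))"
      proof -
        have "(C + D) * (l * (norm (x k) / C)) = norm (x k)"
          using 4 by (simp add: l_def)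
        moreover have "(C + D) * ((1 - l) * (norm (y k) / D)) = norm (y k)"
          unfolding l' using 4 by simp
        ultimately show ?thesis
          using norm_triangle_ineq[of "x k" "y k"] by (simp add: distrib_left)
      qed
      then have "norm (x k + y k) powr r \<le> ((C + D) * (l * (norm (x k) / C) + (1 - l) * (norm (y k) / D))) powr r"
        using r by (intro powr_mono2) auto
      also have "\<dots> = (C + D) powr r * (l * (norm (x k) / C) + (1 - l) * (norm (y k) / D)) powr r"
        using 4 l by (subst powr_mult) auto
      also have "\<dots> \<le> (C + D) powr r * (l * (norm (x k) / C) powr r + (1 - l) * (norm (y k) / D) powr r)"
        using 4 l r by (intro mult_left_mono powr_convex_nonneg) auto
      also have "\<dots> = (C + D) powr r * (l * (norm (x k) powr r / C powr r) + (1 - l) * (norm (y k) powr r / D powr r))"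
        using 4 by (simp add: powr_divide)
      finally show ?thesis .
    qed
    have "(\<Sum>k<N. norm (x k + y k) powr r) \<le> (C + D) powr r" for N
    proof -
      have "(\<Sum>k<N. norm (x k + y k) powr r) \<le> (\<Sum>k<N. (C + D) powr r * (l * (norm (x k) powr r / C powr r) + (1 - l) * (norm (y k) powr r / D powr r)))"
        by (rule sum_mono[OF pt])
      also have "\<dots> = (C + D) powr r * (l * ((\<Sum>k<N. norm (x k) powr r) / C powr r) + (1 - l) * ((\<Sum>k<N. norm (y k) powr r) / D powr r))"
        by (simp only: sum_distrib_left[symmetric] sum.distrib sum_divide_distrib[symmetric])
      also have "\<dots> \<le> (C + D) powr r * (l * 1 + (1 - l) * 1)"
        using b 4 l by (intro mult_left_mono add_mono) (auto simp: divide_le_eq)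
      finally show ?thesis by simp
    qed
    then show ?thesis using C D 4 by (auto simp: lp_le_def r_def)
  qed
qed

lemma lp_le_scaleR: "1 \<le> p \<Longrightarrow> lp_le p x C \<Longrightarrow> lp_le p (\<lambda>k. a *\<^sub>R x k) (\<bar>a\<bar> * C)"
  by (rule lp_le_dominated) auto

lemma lp_le_diff:
  assumes "1 \<le> p" "lp_le p x C" "lp_le p y D"
  shows "lp_le p (\<lambda>k. x k - y k) (C + D)"
  using lp_le_add[OF assms(1,2) lp_le_scaleR[OF assms(1,3), of "-1"]] by simp

lemma lp_le_sum:
  assumes "1 \<le> p" "finite I" "\<And>i. i \<in> I \<Longrightarrow> lp_le p (x i) (C i)"
  shows "lp_le p (\<lambda>k. \<Sum>i\<in>I. x i k) (\<Sum>i\<in>I. C i)"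
  using assms(2,3)
  by (induction I rule: finite_induct) (auto simp: lp_le_zero intro!: lp_le_add[OF assms(1)])

text \<open>Lower semicontinuity of the norm (Fatou), in which finite sections commute with limits. It stands in for
  completeness: limits are first formed in each coordinate.\<close>

lemma lp_le_limit:
  assumes "1 \<le> p" and lim: "\<And>k. ((\<lambda>b. X b k) \<longlongrightarrow> x k) F"
    and "eventually (\<lambda>b. lp_le p (X b) C) F" and F: "F \<noteq> bot"
  shows "lp_le p x C"
proof -
  have C: "0 \<le> C" using assms(3) F eventually_happens lp_le_nonneg by blast
  show ?thesis
  proof (cases "p = \<infinity>")
    case True
    have "norm (x k) \<le> C" for k
      by (rule tendsto_upperbound[OF tendsto_norm[OF lim] _ F])
         (use assms(3) True in \<open>auto simp: lp_le_def elim: eventually_mono\<close>)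
    then show ?thesis using C True by (simp add: lp_le_def)
  next
    case False
    define r where "r = enn2real p"
    have r: "1 \<le> r" using one_le_enn2real[OF assms(1) False] by (simp add: r_def)
    have "(\<Sum>k<N. norm (x k) powr r) \<le> C powr r" for N
    proof (rule tendsto_upperbound[OF _ _ F])
      show "((\<lambda>b. \<Sum>k<N. norm (X b k) powr r) \<longlongrightarrow> (\<Sum>k<N. norm (x k) powr r)) F"
        using r by (intro tendsto_sum tendsto_powr' tendsto_norm lim tendsto_const) auto
      show "\<forall>\<^sub>F b in F. (\<Sum>k<N. norm (X b k) powr r) \<le> C powr r"
        using assms(3) False by (auto simp: lp_le_def r_def elim: eventually_mono)
    qed
    then show ?thesis using C False by (simp add: lp_le_def r_def)
  qed
qed

lemma right_shift_simps [simp]: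
  "right_shift x 0 = 0" "right_shift x (Suc k) = x k"
  by (simp_all add: right_shift_def)

lemma right_shift_funpow: "(right_shift ^^ j) x k = (if j \<le> k then x (k - j) else 0)"
proof (induction j arbitrary: k)
  case (Suc j)
  show ?case by (cases k) (auto simp: Suc)
qed simp

lemma lp_le_right_shift:
  assumes "1 \<le> p" "lp_le p x C"
  shows "lp_le p (right_shift x) C"
proof -
  have "(\<Sum>k<N. norm (right_shift x k) powr r) \<le> (\<Sum>k<N. norm (x k) powr r)" for N and r :: real
  proof (cases N)
    case (Suc M)
    have "(\<Sum>k<N. norm (right_shift x k) powr r) = (\<Sum>k<M. norm (x k) powr r)"
      unfolding Suc by (subst sum.lessThan_Suc_shift) simp
    also have "\<dots> \<le> (\<Sum>k<N. norm (x k) powr r)" unfolding Suc by simp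
    finally show ?thesis .
  qed simp
  moreover have "norm (right_shift x k) \<le> C" if "\<And>k. norm (x k) \<le> C" for k
    using that lp_le_nonneg[OF assms(2)] by (cases k) auto
  ultimately show ?thesis using assms unfolding lp_le_def by (auto, meson order_trans)
qed

lemma lp_le_shift_funpow:
  assumes "1 \<le> p" "lp_le p x C"
  shows "lp_le p ((right_shift ^^ j) x) C"
  by (induction j) (use assms in \<open>auto intro: lp_le_right_shift\<close>)

section \<open>Matrices depending on a complex parameter\<close>

lemma norm_matrix_vector_mult_le:
  fixes A :: "complex^'n^'m"
  shows "norm (A *v x) \<le> norm A * norm x"
proof -
  have row: "norm ((A *v x) $ i) \<le> norm (A $ i) * norm x" for i
  proof -
    have "norm ((A *v x) $ i) \<le> (\<Sum>j\<in>UNIV. \<bar>norm (A $ i $ j)\<bar> * \<bar>norm (x $ j)\<bar>)"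
      unfolding matrix_vector_mult_def by (simp add: norm_mult sum_norm_le)
    also have "\<dots> \<le> norm (A $ i) * norm x"
      unfolding norm_vec_def by (rule L2_set_mult_ineq)
    finally show ?thesis .
  qed
  have "norm (A *v x) \<le> L2_set (\<lambda>i. norm x * norm (A $ i)) UNIV"
    unfolding norm_vec_def[of "A *v x"]
    by (intro L2_set_mono) (use row in \<open>auto simp: mult.commute\<close>)
  also have "\<dots> = norm x * norm A"
    unfolding norm_vec_def[of A] by (subst L2_set_right_distrib) auto
  finally show ?thesis by (simp add: mult.commute)
qed

lemma norm_matrix_matrix_mult_le:
  fixes A :: "complex^'n^'m" and B :: "complex^'k^'n"
  shows "norm (A ** B) \<le> norm A * norm B"
proof -
  have row: "norm ((A ** B) $ i) \<le> norm (A $ i) * norm B" for i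
  proof -
    have "(A ** B) $ i = (\<Sum>j\<in>UNIV. A $ i $ j *s B $ j)"
      by (simp add: vec_eq_iff matrix_matrix_mult_def)
    then have "norm ((A ** B) $ i) \<le> (\<Sum>j\<in>UNIV. norm (A $ i $ j *s B $ j))"
      by (simp add: sum_norm_le)
    also have "\<dots> = (\<Sum>j\<in>UNIV. \<bar>norm (A $ i $ j)\<bar> * \<bar>norm (B $ j)\<bar>)"
    proof (rule sum.cong)
      fix j
      show "norm (A $ i $ j *s B $ j) = \<bar>norm (A $ i $ j)\<bar> * \<bar>norm (B $ j)\<bar>"
        unfolding norm_vec_def by (simp add: norm_mult L2_set_right_distrib)
    qed simp
    also have "\<dots> \<le> norm (A $ i) * norm B"
      unfolding norm_vec_def[of "A $ i"] norm_vec_def[of B] by (rule L2_set_mult_ineq)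
    finally show ?thesis .
  qed
  have "norm (A ** B) \<le> L2_set (\<lambda>i. norm B * norm (A $ i)) UNIV"
    unfolding norm_vec_def[of "A ** B"]
    by (intro L2_set_mono) (use row in \<open>auto simp: mult.commute\<close>)
  also have "\<dots> = norm B * norm A"
    unfolding norm_vec_def[of A] by (subst L2_set_right_distrib) auto
  finally show ?thesis by (simp add: mult.commute)
qed

lemma norm_mult_entry_le: "norm (A $ i $ j) \<le> norm (A :: complex^'n^'m)"
  by (meson Finite_Cartesian_Product.norm_nth_le order_trans)

lemma matrix_inv_works:
  fixes M :: "complex^'n^'n"
  assumes "invertible M"
  shows "M ** matrix_inv M = mat 1" "matrix_inv M ** M = mat 1"
  using assms unfolding invertible_def matrix_inv_def by (metis (mono_tags, lifting) someI_ex)+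

lemma matrix_inv_eqI:
  fixes M :: "complex^'n^'n"
  assumes "M ** N = mat 1"
  shows "matrix_inv M = N"
proof -
  have "invertible M" using assms by (metis invertible_right_inverse)
  then have "matrix_inv M ** (M ** N) = N"
    using matrix_inv_works(2)[OF \<open>invertible M\<close>] by (simp add: matrix_mul_assoc)
  then show ?thesis by (simp add: assms)
qed

lemma mat_mult_nth [simp]: "(mat z ** B) $ i $ j = z * B $ i $ j"
  for B :: "complex^'n^'m"
  by (simp add: matrix_matrix_mult_def mat_def if_distrib if_distribR sum.delta' cong: if_cong)

lemma matrix_eqI: "(A::complex^'n^'m) = B" if "(\<And>i j. A $ i $ j = B $ i $ j)"
  using that by (simp add: vec_eq_iff)

lemma matrix_diff_rdistrib: "(A - B) ** C = A ** C - B ** (C :: complex^'k^'n)"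
  by (rule matrix_eqI) (simp add: matrix_matrix_mult_def algebra_simps sum_subtractf)

lemma det_holomorphic_on:
  fixes M :: "complex \<Rightarrow> complex^'n^'n"
  assumes "\<And>i j. (\<lambda>z. M z $ i $ j) holomorphic_on S"
  shows "(\<lambda>z. det (M z)) holomorphic_on S"
  unfolding det_def by (intro holomorphic_intros assms)

text \<open>By Cramer's rule every entry of the inverse is a quotient of two determinants.\<close>

lemma matrix_inv_holomorphic_on:
  fixes M :: "complex \<Rightarrow> complex^'n^'n"
  assumes "\<And>i j. (\<lambda>z. M z $ i $ j) holomorphic_on S" "\<And>z. z \<in> S \<Longrightarrow> invertible (M z)"
  shows "(\<lambda>z. matrix_inv (M z) $ i $ j) holomorphic_on S"
proof -
  let ?D = "\<lambda>z. (\<chi> k l. if l = i then axis j 1 $ k else M z $ k $ l) :: complex^'n^'n"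
  have eq: "matrix_inv (M z) $ i $ j = det (?D z) / det (M z)" if "z \<in> S" for z
  proof -
    have d: "det (M z) \<noteq> 0" using assms(2)[OF that] invertible_det_nz by blast
    have "M z *v (matrix_inv (M z) *v axis j 1) = axis j 1"
      using matrix_inv_works[OF assms(2)[OF that]] by (simp add: matrix_vector_mul_assoc)
    then have "matrix_inv (M z) *v axis j 1
        = (\<chi> i. det (\<chi> k l. if l = i then axis j 1 $ k else M z $ k $ l) / det (M z))"
      using cramer[OF d] by blast
    then have "(matrix_inv (M z) *v axis j 1) $ i = det (?D z) / det (M z)"
      by simp
    moreover have "(matrix_inv (M z) *v axis j 1) $ i = matrix_inv (M z) $ i $ j"
      by (simp add: matrix_vector_mult_def axis_def if_distrib cong: if_cong)
    ultimately show ?thesis by simp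
  qed
  have "(\<lambda>z. det (?D z) / det (M z)) holomorphic_on S"
  proof (intro holomorphic_on_divide det_holomorphic_on)
    show "(\<lambda>z. ?D z $ i' $ j') holomorphic_on S" for i' j'
      using assms(1) by (cases "j' = i") (auto simp: axis_def)
  qed (use assms invertible_det_nz in blast)+
  then show ?thesis by (subst holomorphic_cong[OF refl eq])
qed

text \<open>Powers for the matrix product; the multiplication of the class instance for vectors is
  componentwise.\<close>

primrec mat_pow :: "complex^'m^'m \<Rightarrow> nat \<Rightarrow> complex^'m^'m" where
  "mat_pow B 0 = mat 1"
| "mat_pow B (Suc n) = B ** mat_pow B n"

text \<open>The Neumann series: \<open>N = (1 - z B)\<^sup>-\<^sup>1\<close> is holomorphic, and comparing coefficients in \<open>N = 1 + z B N\<close>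
  identifies its Taylor coefficients recursively as the powers of \<open>B\<close>.\<close>

lemma neumann_has_fps_expansion:
  fixes B :: "complex^'m^'m"
  assumes "0 < r" and inv: "\<And>z. cmod z < r \<Longrightarrow> invertible (mat 1 - mat z ** B)"
  shows "(\<lambda>z. matrix_inv (mat 1 - mat z ** B) $ i $ j) has_fps_expansion
           Abs_fps (\<lambda>n. mat_pow B n $ i $ j)"
    and "(\<lambda>z. matrix_inv (mat 1 - mat z ** B) $ i $ j) holomorphic_on ball 0 r"
proof -
  define f where "f i j z = matrix_inv (mat 1 - mat z ** B) $ i $ j" for i j z
  have hol: "f i j holomorphic_on ball 0 r" for i j
    unfolding f_def
    by (intro matrix_inv_holomorphic_on inv) (auto intro!: holomorphic_intros)
  then show "(\<lambda>z. matrix_inv (mat 1 - mat z ** B) $ i $ j) holomorphic_on ball 0 r"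
    unfolding f_def .
  define F where "F i j = fps_expansion (f i j) 0" for i j
  have F: "f i j has_fps_expansion F i j" for i j
    unfolding F_def using hol[of i j] \<open>0 < r\<close>
    by (intro has_fps_expansion_fps_expansion[of "ball 0 r"]) auto
  have rec: "F i j = fps_const (mat 1 $ i $ j) + fps_X * (\<Sum>k\<in>UNIV. fps_const (B $ i $ k) * F k j)" for i j
  proof (rule fps_expansion_unique_complex[OF F])
    have "\<forall>\<^sub>F z in nhds 0. z \<in> ball 0 r"
      using \<open>0 < r\<close> by (intro eventually_nhds_in_open) auto
    then have ev: "\<forall>\<^sub>F z in nhds 0. mat 1 $ i $ j + z * (\<Sum>k\<in>UNIV. B $ i $ k * f k j z) = f i j z"
    proof eventually_elim
      case (elim z)
      define N where "N = matrix_inv (mat 1 - mat z ** B)"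
      have "(mat 1 - mat z ** B) ** N = mat 1"
        unfolding N_def using elim by (intro matrix_inv_works inv) simp
      then have "N = mat 1 + mat z ** (B ** N)"
        by (simp add: matrix_mul_assoc algebra_simps matrix_diff_rdistrib)
      then have "N $ i $ j = mat 1 $ i $ j + z * (B ** N) $ i $ j"
        by (metis mat_mult_nth vector_add_component)
      then show ?case by (simp add: N_def f_def matrix_matrix_mult_def)
    qed
    have "(\<lambda>z. mat 1 $ i $ j + z * (\<Sum>k\<in>UNIV. B $ i $ k * f k j z)) has_fps_expansion
       fps_const (mat 1 $ i $ j) + fps_X * (\<Sum>k\<in>UNIV. fps_const (B $ i $ k) * F k j)"
      by (intro fps_expansion_intros F) 
    then show "f i j has_fps_expansion fps_const (mat 1 $ i $ j) + fps_X * (\<Sum>k\<in>UNIV. fps_const (B $ i $ k) * F k j)"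
      using has_fps_expansion_cong[OF ev refl] by blast
  qed
  have "fps_nth (F i j) n = mat_pow B n $ i $ j" for n i j
  proof (induction n arbitrary: i j)
    case 0
    show ?case by (subst rec) simp
  next
    case (Suc n)
    show ?case by (subst rec) (simp add: fps_sum_nth Suc matrix_matrix_mult_def)
  qed
  then have "F i j = Abs_fps (\<lambda>n. mat_pow B n $ i $ j)"
    by (simp add: fps_eq_iff)
  then show "(\<lambda>z. matrix_inv (mat 1 - mat z ** B) $ i $ j) has_fps_expansion Abs_fps (\<lambda>n. mat_pow B n $ i $ j)"
    using F[of i j] unfolding f_def by simp
qed

lemma fps_coeff_Cauchy_bound:
  assumes "f has_fps_expansion F" "f holomorphic_on ball 0 r" "0 < s" "s < r"
  shows "\<exists>K. \<forall>n. norm (fps_nth F n) \<le> K / s ^ n"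
proof -
  have sub: "cball 0 s \<subseteq> ball (0::complex) r" using assms by auto
  have cont: "continuous_on (cball 0 s) f"
    using holomorphic_on_imp_continuous_on[OF assms(2)] sub continuous_on_subset by blast
  have "bounded (f ` cball 0 s)"
    by (intro compact_imp_bounded compact_continuous_image cont compact_cball)
  then obtain K where K: "\<And>x. x \<in> cball 0 s \<Longrightarrow> norm (f x) \<le> K"
    unfolding bounded_iff by blast
  have "norm (fps_nth F n) \<le> K / s ^ n" for n
  proof -
    have "norm ((deriv ^^ n) f 0) \<le> fact n * K / s ^ n"
      using assms sub by (intro Cauchy_inequality cont K holomorphic_on_subset[OF assms(2)]) auto
    then show ?thesis
      unfolding fps_nth_fps_expansion[OF assms(1)] by (simp add: norm_divide field_simps)
  qed
  then show ?thesis by blast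
qed

text \<open>If \<open>1 - z B\<close> is invertible beyond the closed unit disc, then the Neumann series converges on a
  circle of radius greater than \<open>1\<close>, and Cauchy's bounds on that circle decay geometrically.\<close>

lemma mat_pow_decay:
  fixes B :: "complex^'m^'m"
  assumes "1 < r" and inv: "\<And>z. cmod z < r \<Longrightarrow> invertible (mat 1 - mat z ** B)"
  shows "\<exists>K q. 0 < q \<and> q < 1 \<and> (\<forall>n. norm (mat_pow B n) \<le> K * q ^ n)"
proof -
  define s where "s = (1 + r) / 2"
  have s: "1 < s" "s < r" using assms by (auto simp: s_def)
  have "\<exists>K. \<forall>n. norm (mat_pow B n $ i $ j) \<le> K / s ^ n" for i j
  proof -
    have "0 < r" using assms by simp
    note nh = neumann_has_fps_expansion[OF this inv, where i = i and j = j]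
    show ?thesis using fps_coeff_Cauchy_bound[OF nh(1) nh(2)] s by auto
  qed
  then obtain K where K: "\<And>i j n. norm (mat_pow B n $ i $ j) \<le> K i j / s ^ n" by metis
  have "norm (mat_pow B n) \<le> (\<Sum>i\<in>UNIV. \<Sum>j\<in>UNIV. K i j) * (1/s) ^ n" for n
  proof -
    have "norm (mat_pow B n) \<le> (\<Sum>i\<in>UNIV. norm (mat_pow B n $ i))"
      unfolding norm_vec_def by (rule L2_set_le_sum) simp
    also have "\<dots> \<le> (\<Sum>i\<in>UNIV. \<Sum>j\<in>UNIV. norm (mat_pow B n $ i $ j))"
      unfolding norm_vec_def by (intro sum_mono L2_set_le_sum) simp
    also have "\<dots> \<le> (\<Sum>i\<in>UNIV. \<Sum>j\<in>UNIV. K i j / s ^ n)"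
      by (intro sum_mono K)
    also have "\<dots> = (\<Sum>i\<in>UNIV. \<Sum>j\<in>UNIV. K i j) * (1/s) ^ n"
      by (simp add: sum_distrib_right power_one_over divide_inverse power_inverse)
    finally show ?thesis .
  qed
  then show ?thesis using s by (intro exI[of _ "\<Sum>i\<in>UNIV. \<Sum>j\<in>UNIV. K i j"] exI[of _ "1/s"]) auto
qed

section \<open>A local limit estimate for powers of a power series\<close>

text \<open>Cauchy's formula on the unit circle. The integral of \<open>h\<close>, rather than its supremum, is what later
  produces the powers \<open>j\<^bsup>-1/2\<^esup>\<close>, since \<open>h\<close> will be concentrated near \<open>t = 0\<close> and \<open>t = 1\<close>.\<close>

lemma fps_coeff_integral_bound:
  assumes "f has_fps_expansion F" and hol: "f holomorphic_on ball 0 r" and "1 < r"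
    and h: "(h has_integral I) {0..1}"
    and le: "\<And>t. t \<in> {0..1} \<Longrightarrow> cmod (f (exp (2 * of_real pi * \<i> * of_real t))) \<le> h t"
  shows "cmod (fps_nth F n) \<le> I"
proof -
  let ?e = "\<lambda>t::real. exp (2 * of_real pi * \<i> * of_real t)"
  have sub: "cball 0 1 \<subseteq> ball (0::complex) r" using assms by auto
  have cont: "continuous_on (cball 0 1) f"
    using holomorphic_on_imp_continuous_on[OF hol] sub continuous_on_subset by blast
  have "((\<lambda>u. f u / (u - 0) ^ Suc n) has_contour_integral
          (2 * pi * \<i>) / fact n * (deriv ^^ n) f 0) (circlepath 0 1)"
    by (rule Cauchy_has_contour_integral_higher_derivative_circlepath[OF cont])
       (use holomorphic_on_subset[OF hol order_trans[OF ball_subset_cball sub]] in auto)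
  then have "((\<lambda>t. f (?e t) / (?e t) ^ Suc n * vector_derivative (circlepath 0 1) (at t within {0..1}))
        has_integral (2 * pi * \<i>) / fact n * (deriv ^^ n) f 0) {0..1}"
    unfolding has_contour_integral_def by (simp add: circlepath)
  then have *: "((\<lambda>t. f (?e t) / (?e t) ^ Suc n * (2 * pi * \<i> * ?e t))
        has_integral (2 * pi * \<i>) / fact n * (deriv ^^ n) f 0) {0..1}"
    by (rule has_integral_eq[rotated]) (simp add: vector_derivative_circlepath01)
  have [simp]: "cmod (?e t) = 1" for t by (simp add: norm_exp_eq_Re)
  have h2: "((\<lambda>t. 2 * pi * h t) has_integral 2 * pi * I) {0..1}"
    by (intro has_integral_mult_right h)
  have "cmod (2 * pi * \<i> / fact n * (deriv ^^ n) f 0) \<le> 2 * pi * I"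
    unfolding integral_unique[OF *, symmetric] integral_unique[OF h2, symmetric]
  proof (rule Henstock_Kurzweil_Integration.integral_norm_bound_integral)
    fix t :: real assume "t \<in> {0..1}"
    then show "cmod (f (?e t) / (?e t) ^ Suc n * (2 * pi * \<i> * ?e t)) \<le> 2 * pi * h t"
      using le[of t] by (simp add: norm_mult norm_divide norm_power del: power_Suc)
  qed (use * h2 in auto)
  then have "2 * pi * cmod (fps_nth F n) \<le> 2 * pi * I"
    unfolding fps_nth_fps_expansion[OF assms(1)] by (simp add: norm_mult norm_divide)
  then show ?thesis by simp
qed

lemma sin_ge_half:
  fixes x :: real
  assumes "0 \<le> x" "x \<le> pi / 2"
  shows "x / 2 \<le> sin x"
proof (cases "x \<le> pi / 3")
  case True
  have "sin 0 - 0 / 2 \<le> sin x - x / 2"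
  proof (rule DERIV_nonneg_imp_nondecreasing[OF assms(1)])
    fix y assume y: "0 \<le> y" "y \<le> x"
    have "cos (pi / 3) \<le> cos y"
      using y True by (intro cos_monotone_0_pi_le) auto
    then have "0 \<le> cos y - 1/2" by (simp add: cos_60)
    moreover have "((\<lambda>x. sin x - x / 2) has_real_derivative cos y - 1/2) (at y)"
      by (auto intro!: derivative_eq_intros)
    ultimately show "\<exists>d. ((\<lambda>x. sin x - x / 2) has_real_derivative d) (at y) \<and> 0 \<le> d" by blast
  qed
  then show ?thesis by simp
next
  case False
  have "sin (pi / 3) \<le> sin x"
    using False assms by (intro sin_monotone_2pi_le) auto
  moreover have "sqrt 3 \<ge> 1.7" by (rule real_le_rsqrt) (simp add: power2_eq_square)
  moreover have "x / 2 \<le> 0.8" using assms pi_approx(2) by (simp add: field_simps)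
  ultimately show ?thesis unfolding sin_60 by linarith
qed

lemma norm_exp_minus_one_ge:
  fixes t :: real
  assumes "0 \<le> t" "t \<le> 1"
  shows "cmod (exp (2 * of_real pi * \<i> * of_real t) - 1) \<ge> 3 * min t (1 - t)"
proof -
  have main: "3 * s \<le> 2 * \<bar>sin (pi * s)\<bar>" if "0 \<le> s" "s \<le> 1/2" for s
  proof -
    have "pi * s / 2 \<le> sin (pi * s)" using that by (intro sin_ge_half) auto
    moreover have "3 * s \<le> pi * s" using that pi_gt3 by (intro mult_right_mono) auto
    ultimately show ?thesis by linarith
  qed
  have e: "cmod (exp (2 * of_real pi * \<i> * of_real t) - 1) = 2 * \<bar>sin (pi * t)\<bar>"
    using dist_exp_i_1[of "2 * pi * t"] by (simp add: mult_ac)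
  show ?thesis
  proof (cases "t \<le> 1/2")
    case True
    then show ?thesis using main[of t] assms e by auto
  next
    case False
    have "\<bar>sin (pi * t)\<bar> = \<bar>sin (pi * (1 - t))\<bar>"
      by (simp add: right_diff_distrib sin_diff)
    then show ?thesis using main[of "1 - t"] assms e False by auto
  qed
qed

lemma lorentz_has_integral:
  fixes b :: real
  assumes "0 < b"
  shows "((\<lambda>t. 1 / (1 + b * t\<^sup>2) + 1 / (1 + b * (1 - t)\<^sup>2)) has_integral 2 * arctan (sqrt b) / sqrt b) {0..1}"
proof -
  define c where "c = sqrt b"
  have c: "0 < c" "b = c\<^sup>2" using assms by (auto simp: c_def)
  let ?F = "\<lambda>t. (arctan (c * t) - arctan (c * (1 - t))) / c"
  have "((\<lambda>t. 1 / (1 + b * t\<^sup>2) + 1 / (1 + b * (1 - t)\<^sup>2)) has_integral (?F 1 - ?F 0)) {0..1}"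
  proof (rule fundamental_theorem_of_calculus)
    fix t :: real
    have [simp]: "(c - c * t)\<^sup>2 = c\<^sup>2 * (1 - t)\<^sup>2" "(c * t - c)\<^sup>2 = c\<^sup>2 * (1 - t)\<^sup>2"
      by (simp_all add: power2_eq_square algebra_simps)
    have "(?F has_real_derivative 1 / (1 + b * t\<^sup>2) + 1 / (1 + b * (1 - t)\<^sup>2)) (at t within {0..1})"
      using c by (auto intro!: derivative_eq_intros simp: power_mult_distrib field_simps)
    then show "(?F has_vector_derivative 1 / (1 + b * t\<^sup>2) + 1 / (1 + b * (1 - t)\<^sup>2)) (at t within {0..1})"
      by (simp add: has_real_derivative_iff_has_vector_derivative)
  qed simp
  then show ?thesis by (simp add: c_def[symmetric])
qed

lemma lorentz_mean_le:
  fixes b :: real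
  assumes "0 < b"
  shows "2 * arctan (sqrt b) / sqrt b \<le> pi / sqrt b"
  using assms arctan_ubound[of "sqrt b"] by (intro divide_right_mono) auto

text \<open>Writing \<open>\<theta> = X d/dX - j M\<close>, one has \<open>\<theta> F\<^sup>j = j (X F' - M F) F\<^sup>j\<^sup>-\<^sup>1\<close>, and on coefficients \<open>\<theta>\<close> is
  multiplication by \<open>n - j M\<close>. So factors \<open>n - j M\<close>, which express concentration near the mean,
  are traded for factors of the recentred series.\<close>

lemma fps_nth_X_deriv: "fps_nth (fps_X * fps_deriv F) n = of_nat n * fps_nth F n"
  by (cases n) simp_all

lemma fps_power_coeff_first_moment:
  fixes F :: "complex fps" and M :: complex
  defines "F1 \<equiv> fps_X * fps_deriv F - fps_const M * F"
  shows "(of_nat n - of_nat (Suc j) * M) * fps_nth (F ^ Suc j) n = of_nat (Suc j) * fps_nth (F1 * F ^ j) n"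
proof -
  have "fps_X * fps_deriv (F ^ Suc j) - fps_const (of_nat (Suc j) * M) * F ^ Suc j
        = fps_const (of_nat (Suc j)) * (F1 * F ^ j)"
    unfolding F1_def fps_deriv_power by (simp add: algebra_simps fps_const_mult[symmetric] del: fps_const_mult)
  then have "fps_nth (fps_X * fps_deriv (F ^ Suc j) - fps_const (of_nat (Suc j) * M) * F ^ Suc j) n
        = fps_nth (fps_const (of_nat (Suc j)) * (F1 * F ^ j)) n" by (rule arg_cong)
  then show ?thesis
    by (simp only: fps_sub_nth fps_mult_left_const_nth fps_nth_X_deriv left_diff_distrib)
qed

lemma fps_power_coeff_second_moment:
  fixes F :: "complex fps" and M :: complex
  defines "F1 \<equiv> fps_X * fps_deriv F - fps_const M * F"
  defines "F2 \<equiv> fps_X * fps_deriv F1 - fps_const M * F1"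
  shows "(of_nat n - of_nat (Suc (Suc j)) * M)\<^sup>2 * fps_nth (F ^ Suc (Suc j)) n =
     of_nat (Suc (Suc j)) * (fps_nth (F2 * F ^ Suc j) n + of_nat (Suc j) * fps_nth (F1 * F1 * F ^ j) n)"
proof -
  let ?m = "of_nat (Suc (Suc j)) * M"
  have "fps_X * fps_deriv (F1 * F ^ Suc j) - fps_const ?m * (F1 * F ^ Suc j)
        = F2 * F ^ Suc j + fps_const (of_nat (Suc j)) * (F1 * F1 * F ^ j)"
    unfolding F2_def F1_def fps_deriv_mult fps_deriv_power
    by (simp add: algebra_simps fps_numeral_fps_const fps_const_mult[symmetric] fps_const_add[symmetric] del: fps_const_mult fps_const_add)
  then have "fps_nth (fps_X * fps_deriv (F1 * F ^ Suc j) - fps_const ?m * (F1 * F ^ Suc j)) n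
        = fps_nth (F2 * F ^ Suc j + fps_const (of_nat (Suc j)) * (F1 * F1 * F ^ j)) n" by (rule arg_cong)
  then have "(of_nat n - ?m) * fps_nth (F1 * F ^ Suc j) n
      = fps_nth (F2 * F ^ Suc j) n + of_nat (Suc j) * fps_nth (F1 * F1 * F ^ j) n"
    by (simp only: fps_sub_nth fps_add_nth fps_mult_left_const_nth fps_nth_X_deriv left_diff_distrib)
  then show ?thesis
    using fps_power_coeff_first_moment[of n "Suc j" M F]
    unfolding F1_def[symmetric] power2_eq_square by (metis mult.assoc mult.left_commute)
qed

text \<open>The two hypotheses are the uniform and the off-diagonal part of a local limit theorem, with the walk
  at distance \<open>\<bar>x - j\<bar>\<close> from its mean. For \<open>j < 2 x\<close> they combine to \<open>b j = O(sqrt x / (x + (x - j)\<^sup>2))\<close>, which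
  is dominated by the increments of \<open>arctan (y / sqrt x)\<close> at \<open>y = j - x\<close> and so telescopes to a bound
  independent of \<open>x\<close>; for \<open>j \<ge> 2 x\<close> the second one gives \<open>b j = O(j\<^bsup>-3/2\<^esup>)\<close>.\<close>

lemma sum_local_limit_bounded:
  fixes b :: "nat \<Rightarrow> real"
  assumes "0 \<le> x" "0 \<le> C"
    and b1: "\<And>j. 1 \<le> j \<Longrightarrow> b j \<le> C / sqrt j"
    and b2: "\<And>j. 1 \<le> j \<Longrightarrow> (x - j)\<^sup>2 * b j \<le> C * sqrt j"
  shows "(\<Sum>j=1..<J. b j) \<le> C * (4 * (\<Sum>j. real j powr (-3/2)) + 48 * pi)"
proof -
  define s where "s = sqrt x"
  define g where "g y = (if x < 1/2 then 0 else arctan (y / s))" for y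
  have g_mono: "g u \<le> g v" if "u \<le> v" for u v
    using that \<open>0 \<le> x\<close> unfolding g_def s_def by (auto intro!: arctan_monotone' divide_right_mono)
  have near: "b j \<le> 24 * C * (g (real j - x + 1) - g (real j - x))" if j: "1 \<le> j" "real j < 2 * x" for j
  proof -
    have x: "1/2 < x" using j by linarith
    have s: "0 < s" "s\<^sup>2 = x" using x by (auto simp: s_def)
    define y where "y = real j - x"
    obtain u where u: "y < u" "u < y + 1" 
      and "arctan ((y + 1) / s) - arctan (y / s) = (y + 1 - y) * (s / (x + u\<^sup>2))"
    proof -
      have "\<exists>z. y < z \<and> z < y + 1 \<and> arctan ((y + 1) / s) - arctan (y / s) = (y + 1 - y) * (s / (x + z\<^sup>2))"
      proof (rule MVT2)
        fix v assume "y \<le> v" "v \<le> y + 1"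
        have "((\<lambda>v. arctan (v / s)) has_real_derivative (inverse (1 + (v / s)\<^sup>2) * (1 / s))) (at v)"
          using s by (auto intro!: derivative_eq_intros)
        moreover have "inverse (1 + (v / s)\<^sup>2) * (1 / s) = s / (x + v\<^sup>2)"
          using s unfolding s(2)[symmetric] by (simp add: power2_eq_square divide_simps) (simp add: algebra_simps)?
        ultimately show "((\<lambda>v. arctan (v / s)) has_real_derivative s / (x + v\<^sup>2)) (at v)" by simp
      qed simp
      then show ?thesis using that by blast
    qed
    then have g: "g (y + 1) - g y = s / (x + u\<^sup>2)" using x by (simp add: g_def)
    have "u\<^sup>2 \<le> 2 * y\<^sup>2 + 2"
    proof -
      have "u\<^sup>2 = (y + (u - y))\<^sup>2" by simp
      also have "\<dots> \<le> 2 * y\<^sup>2 + 2 * (u - y)\<^sup>2"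
        using zero_le_power2[of "y - (u - y)"] by (simp add: power2_eq_square algebra_simps)
      also have "(u - y)\<^sup>2 \<le> 1" using u by (simp add: power_le_one)
      finally show ?thesis by linarith
    qed
    then have le: "x + u\<^sup>2 \<le> 6 * (x + y\<^sup>2)" 
    proof -
      have "2 \<le> 5 * x + 4 * y\<^sup>2" using x by (intro add_increasing2) auto
      then have "2 * y\<^sup>2 + 2 \<le> 5 * x + 6 * y\<^sup>2" by simp
      then have "u\<^sup>2 \<le> 5 * x + 6 * y\<^sup>2" using \<open>u\<^sup>2 \<le> 2 * y\<^sup>2 + 2\<close> by (rule order_trans[rotated])
      then show ?thesis by (simp add: algebra_simps)
    qed
    have bound: "(x + y\<^sup>2) * b j \<le> 4 * C * s"
    proof (cases "real j \<le> x / 2")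
      case True
      have x2: "2 \<le> x" using True j by linarith
      have "(x / 2)\<^sup>2 \<le> y\<^sup>2" unfolding y_def using True x by (intro abs_le_square_iff[THEN iffD1]) auto
      then have "x * x \<le> 4 * y\<^sup>2" by (simp add: power2_eq_square)
      moreover have "2 * x \<le> x * x" using x2 by (intro mult_right_mono) auto
      ultimately have xy: "x \<le> 2 * y\<^sup>2" by linarith
      have "y\<^sup>2 * b j \<le> C * sqrt j" using b2[OF j(1)] by (simp add: y_def power2_commute)
      also have "\<dots> \<le> C * s" unfolding s_def using True x assms by (intro mult_left_mono) auto
      finally have yb: "y\<^sup>2 * b j \<le> C * s" .
      show ?thesis
      proof (cases "0 \<le> b j")
        case True
        have "(x + y\<^sup>2) * b j \<le> (3 * y\<^sup>2) * b j" using xy True by (intro mult_right_mono) auto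
        then show ?thesis using yb assms s by (simp add: mult.assoc) (smt (verit) mult_nonneg_nonneg)
      next
        case False
        have "(x + y\<^sup>2) * b j \<le> 0" using False x by (intro mult_nonneg_nonpos) auto
        then show ?thesis using assms s by (smt (verit) mult_nonneg_nonneg)
      qed
    next
      case False
      have "sqrt j \<le> sqrt (4 * x)" using j by simp
      then have j1: "sqrt j \<le> 2 * s" by (simp add: s_def real_sqrt_mult)
      have "sqrt x \<le> sqrt (4 * j)" using False by simp
      then have j2: "s \<le> 2 * sqrt j" by (simp add: s_def real_sqrt_mult)
      have "y\<^sup>2 * b j \<le> C * sqrt j" using b2[OF j(1)] by (simp add: y_def power2_commute)
      also have "\<dots> \<le> C * (2 * s)" using j1 assms by (intro mult_left_mono)
      finally have 1: "y\<^sup>2 * b j \<le> 2 * C * s" by simp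
      have "x * b j \<le> x * (C / sqrt j)" using b1[OF j(1)] x by (intro mult_left_mono) auto
      also have "\<dots> \<le> x * (C * (2 / s))"
      proof -
        have "1 / sqrt j \<le> 2 / s" using j2 j s by (simp add: field_simps)
        then have "C * (1 / sqrt j) \<le> C * (2 / s)" using assms by (intro mult_left_mono)
        then show ?thesis using x by (intro mult_left_mono) auto
      qed
      also have "\<dots> = 2 * C * s" using s unfolding s(2)[symmetric] by (simp add: power2_eq_square)
      finally show ?thesis using 1 by (simp add: distrib_right)
    qed
    have pos: "0 < x + y\<^sup>2" "0 < x + u\<^sup>2" using x by (auto intro: add_pos_nonneg)
    have "b j \<le> 4 * C * s / (x + y\<^sup>2)" using bound pos by (simp add: field_simps)
    also have "\<dots> \<le> 4 * C * s * (6 / (x + u\<^sup>2))"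
    proof -
      have "1 / (x + y\<^sup>2) \<le> 6 / (x + u\<^sup>2)" using le pos by (simp add: field_simps)
      then have "4 * C * s * (1 / (x + y\<^sup>2)) \<le> 4 * C * s * (6 / (x + u\<^sup>2))"
        using assms s by (intro mult_left_mono) auto
      then show ?thesis by simp
    qed
    also have "\<dots> = 24 * C * (g (y + 1) - g y)" unfolding g by simp
    finally show ?thesis by (simp add: y_def)
  qed
  have far: "b j \<le> 4 * C * real j powr (-3/2)" if j: "1 \<le> j" "2 * x \<le> real j" for j
  proof -
    have "(real j / 2)\<^sup>2 \<le> (x - j)\<^sup>2" using j by (intro abs_le_square_iff[THEN iffD1]) auto
    then have sq: "(real j)\<^sup>2 \<le> 4 * (x - j)\<^sup>2" by (simp add: power2_eq_square)
    have pw: "real j powr (-3/2) = sqrt j / (real j)\<^sup>2"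
    proof -
      have "real j powr (-3/2) = real j powr (1/2 - 2)" by simp
      also have "\<dots> = real j powr (1/2) / real j powr 2" by (rule powr_diff)
      finally show ?thesis using j by (simp add: powr_half_sqrt powr_numeral)
    qed
    show ?thesis
    proof (cases "0 \<le> b j")
      case True
      have "(real j)\<^sup>2 * b j \<le> 4 * (x - j)\<^sup>2 * b j" using sq True by (intro mult_right_mono) auto
      also have "\<dots> \<le> 4 * C * sqrt j" using b2[OF j(1)] by simp
      finally show ?thesis unfolding pw using j by (simp add: field_simps)
    next
      case False
      then show ?thesis using assms by (smt (verit) mult_nonneg_nonneg powr_ge_zero)
    qed
  qed
  have summ: "summable (\<lambda>j. real j powr (-3/2))" by (simp add: summable_real_powr_iff)
  have "b j \<le> 4 * C * real j powr (-3/2) + 24 * C * (g (real j - x + 1) - g (real j - x))" if "1 \<le> j" for j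
  proof (cases "real j < 2 * x")
    case True then show ?thesis using near[OF that] assms by (smt (verit) mult_nonneg_nonneg powr_ge_zero)
  next
    case False
    have "0 \<le> 24 * C * (g (real j - x + 1) - g (real j - x))"
      using g_mono[of "real j - x" "real j - x + 1"] assms by simp
    then show ?thesis using far[OF that] False by simp
  qed
  then have "(\<Sum>j=1..<J. b j) \<le> (\<Sum>j=1..<J. 4 * C * real j powr (-3/2) + 24 * C * (g (real j - x + 1) - g (real j - x)))"
    by (intro sum_mono) auto
  also have "\<dots> \<le> (\<Sum>j<J. 4 * C * real j powr (-3/2) + 24 * C * (g (real j - x + 1) - g (real j - x)))"
    using g_mono assms by (intro sum_mono2) auto
  also have "\<dots> = 4 * C * (\<Sum>j<J. real j powr (-3/2)) + 24 * C * (\<Sum>j<J. g (real (Suc j) - x) - g (real j - x))"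
  proof -
    have eq: "g (real j - x + 1) = g (real (Suc j) - x)" for j by (simp add: algebra_simps)
    show ?thesis by (simp only: eq sum.distrib sum_distrib_left)
  qed
  also have "\<dots> \<le> 4 * C * (\<Sum>j. real j powr (-3/2)) + 24 * C * (2 * pi)"
  proof (intro add_mono mult_left_mono)
    show "(\<Sum>j<J. real j powr (-3/2)) \<le> (\<Sum>j. real j powr (-3/2))"
      by (rule sum_le_suminf[OF summ]) auto
    have "(\<Sum>j<J. g (real (Suc j) - x) - g (real j - x)) = g (real J - x) - g (real 0 - x)"
      by (rule sum_lessThan_telescope)
    also have "\<dots> \<le> 2 * pi"
      unfolding g_def using arctan_bounded[of "(real J - x) / s"] arctan_bounded[of "(real 0 - x) / s"] pi_gt_zero
      by (auto; linarith)
    finally show "(\<Sum>j<J. g (real (Suc j) - x) - g (real j - x)) \<le> 2 * pi" .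
  qed (use assms in auto)
  finally show ?thesis by (simp add: algebra_simps)
qed

text \<open>If \<open>F\<close> is the law of the jumps of a renewal process, then \<open>\<Sum>j. F\<^sup>j\<close> is its renewal sequence; the
  lemma bounds that sequence for coefficients of arbitrary sign. The decay hypothesis
  makes \<open>G\<^sup>j\<close> at most a Gaussian of width \<open>j\<^bsup>-1/2\<^esup>\<close> on the unit circle, so its integral is \<open>O(j\<^bsup>-1/2\<^esup>)\<close>. For the
  off-diagonal bound, two factors \<open>n - j M\<close> turn \<open>F\<^sup>j\<close> into \<open>j F2 F\<^sup>j\<^sup>-\<^sup>1 + j (j - 1) F1\<^sup>2 F\<^sup>j\<^sup>-\<^sup>2\<close>, and \<open>F1\<close> vanishes
  at \<open>1\<close> because \<open>M\<close> is the mean, which gains a further factor \<open>j\<^sup>-\<^sup>1\<close> in the integral.\<close>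

lemma fps_power_coeffs_bounded:
  fixes G :: "complex \<Rightarrow> complex" and M \<kappa> :: real
  assumes exp: "G has_fps_expansion F" and hol: "G holomorphic_on ball 0 r" and r: "1 < r"
    and G1: "G 1 = 1" and dG1: "deriv G 1 = of_real M" and M: "0 < M" and \<kappa>: "0 < \<kappa>"
    and decay: "\<And>z. cmod z = 1 \<Longrightarrow> (cmod (G z))\<^sup>2 \<le> 1 - \<kappa> * (cmod (z - 1))\<^sup>2"
  shows "\<exists>K. \<forall>n J. (\<Sum>j<J. cmod (fps_nth (F ^ j) n)) \<le> K"
proof -
  let ?e = "\<lambda>t::real. exp (2 * of_real pi * \<i> * of_real t)"
  have e1: "cmod (?e t) = 1" for t by (simp add: norm_exp_eq_Re)
  have sub: "cball 0 1 \<subseteq> ball (0::complex) r" using r by auto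
  have emem: "?e t \<in> ball 0 r" for t using e1[of t] r by simp
  \<comment> \<open>The price of the exponent \<open>i + 1\<close> instead of \<open>i\<close>, as \<open>cmod (w - 1) \<le> 2\<close> on the circle; the shift keeps
    the denominators positive for \<open>i = 0\<close>.\<close>
  define E where "E = exp (2 * \<kappa>)"
  have E: "0 < E" by (simp add: E_def)
  \<comment> \<open>\<open>9\<close> comes from the lower bound \<open>3 * min t (1 - t)\<close> for \<open>cmod (w - 1)\<close>.\<close>
  define \<beta> where "\<beta> = 9 * \<kappa> / 4"
  have \<beta>: "0 < \<beta>" using \<kappa> by (simp add: \<beta>_def)
  define lor where "lor i t = 1 / (1 + (real i + 1) * \<beta> * t\<^sup>2) + 1 / (1 + (real i + 1) * \<beta> * (1 - t)\<^sup>2)"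
    for i t
  have int: "(lor i has_integral 2 * arctan (sqrt ((real i + 1) * \<beta>)) / sqrt ((real i + 1) * \<beta>)) {0..1}" for i
    unfolding lor_def using \<beta> by (intro lorentz_has_integral) auto
  define P where "P = pi / sqrt \<beta>"
  have P: "0 < P" using \<beta> by (simp add: P_def)
  have intle: "2 * arctan (sqrt ((real i + 1) * \<beta>)) / sqrt ((real i + 1) * \<beta>) \<le> P / sqrt (real i + 1)" for i
  proof -
    have "pi / sqrt ((real i + 1) * \<beta>) = P / sqrt (real i + 1)"
      by (simp add: P_def real_sqrt_mult)
    then show ?thesis using lorentz_mean_le[of "(real i + 1) * \<beta>"] \<beta> by simp
  qed
  have pointwise: "cmod (G (?e t)) ^ i \<le> E * lor i t"
      "(cmod (?e t - 1))\<^sup>2 * cmod (G (?e t)) ^ i \<le> (4 / ((real i + 1) * \<kappa>)) * E * lor i t"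
    if t: "t \<in> {0..1}" for i t
  proof -
    define d where "d = cmod (?e t - 1)"
    define m where "m = min t (1 - t)"
    define u where "u = (real i + 1) * \<kappa> * d\<^sup>2 / 4"
    have u: "0 \<le> u" using \<kappa> by (simp add: u_def)
    have d2: "d \<le> 2" unfolding d_def using norm_triangle_ineq4[of "?e t" 1] e1[of t] by simp
    have m: "0 \<le> m" "3 * m \<le> d" using t norm_exp_minus_one_ge[of t] by (auto simp: m_def d_def)
    have "(3 * m)\<^sup>2 \<le> d\<^sup>2" using m by (intro power_mono) auto
    then have "(real i + 1) * \<kappa> / 4 * (9 * m\<^sup>2) \<le> (real i + 1) * \<kappa> / 4 * d\<^sup>2"
      using \<kappa> by (intro mult_left_mono) (auto simp: power_mult_distrib)
    then have mu: "(real i + 1) * \<beta> * m\<^sup>2 \<le> u" by (simp add: u_def \<beta>_def)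
    have "1 / (1 + u) \<le> 1 / (1 + (real i + 1) * \<beta> * m\<^sup>2)"
      using mu \<beta> u by (intro divide_left_mono mult_pos_pos) (auto intro!: add_pos_nonneg)
    also have "\<dots> \<le> lor i t"
      using \<beta> t unfolding lor_def m_def min_def by (auto intro!: add_increasing add_increasing2)
    finally have lor: "1 / (1 + u) \<le> lor i t" .
    have "(cmod (G (?e t)))\<^sup>2 \<le> 1 - \<kappa> * d\<^sup>2" using decay[OF e1] by (simp add: d_def)
    also have "\<dots> \<le> exp (- (\<kappa> * d\<^sup>2))" using exp_ge_add_one_self[of "- (\<kappa> * d\<^sup>2)"] by simp
    also have "\<dots> = (exp (- (\<kappa> * d\<^sup>2 / 2)))\<^sup>2" by (simp add: exp_double[symmetric])
    finally have "cmod (G (?e t)) \<le> exp (- (\<kappa> * d\<^sup>2 / 2))" by (rule power2_le_imp_le) simp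
    then have "cmod (G (?e t)) ^ i \<le> exp (- (\<kappa> * d\<^sup>2 / 2)) ^ i" by (intro power_mono) auto
    also have "\<dots> = exp (\<kappa> * d\<^sup>2 / 2) * exp (- 2 * u)"
      by (simp add: exp_of_nat_mult[symmetric] exp_add[symmetric] u_def field_simps)
    also have "\<dots> \<le> E * (1 / (1 + u)\<^sup>2)"
    proof (intro mult_mono)
      have "d\<^sup>2 \<le> 2\<^sup>2" using d2 by (intro power_mono) (auto simp: d_def)
      then have "\<kappa> * d\<^sup>2 \<le> \<kappa> * 4" using \<kappa> by (intro mult_left_mono) auto
      then show "exp (\<kappa> * d\<^sup>2 / 2) \<le> E" unfolding E_def by simp
      have "(1 + u)\<^sup>2 \<le> (exp u)\<^sup>2" using u exp_ge_add_one_self[of u] by (intro power_mono) auto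
      also have "\<dots> = exp (2 * u)" by (simp add: exp_double)
      finally show "exp (- 2 * u) \<le> 1 / (1 + u)\<^sup>2"
        using u by (simp add: exp_minus field_simps)
    qed (auto simp: E_def)
    finally have *: "cmod (G (?e t)) ^ i \<le> E * (1 / (1 + u)\<^sup>2)" .
    have uu: "0 \<le> 1 / (1 + u)" "1 / (1 + u) \<le> 1" "u / (1 + u) \<le> 1" using u by auto
    have "1 / (1 + u)\<^sup>2 = 1 / (1 + u) * (1 / (1 + u))" by (simp add: power2_eq_square)
    also have "\<dots> \<le> 1 / (1 + u)" using uu by (intro mult_left_le) auto
    finally have "1 / (1 + u)\<^sup>2 \<le> 1 / (1 + u)" .
    then show "cmod (G (?e t)) ^ i \<le> E * lor i t"
      using * lor E by (smt (verit) mult_left_mono)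
    have "u * (1 / (1 + u)\<^sup>2) = 1 / (1 + u) * (u / (1 + u))" by (simp add: power2_eq_square)
    also have "\<dots> \<le> 1 / (1 + u)" using uu by (intro mult_left_le) auto
    finally have "u * (1 / (1 + u)\<^sup>2) \<le> 1 / (1 + u)" .
    then have "E * (u * (1 / (1 + u)\<^sup>2)) \<le> E * lor i t"
      using lor E by (intro mult_left_mono) auto
    moreover have "u * cmod (G (?e t)) ^ i \<le> u * (E * (1 / (1 + u)\<^sup>2))"
      using * u by (rule mult_left_mono)
    ultimately have "u * cmod (G (?e t)) ^ i \<le> E * lor i t" by (simp add: mult_ac)
    moreover have "d\<^sup>2 = (4 / ((real i + 1) * \<kappa>)) * u" using \<kappa> by (simp add: u_def)
    ultimately show "(cmod (?e t - 1))\<^sup>2 * cmod (G (?e t)) ^ i \<le> (4 / ((real i + 1) * \<kappa>)) * E * lor i t"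
      unfolding d_def[symmetric] using \<kappa> by (simp add: divide_right_mono mult.assoc)
  qed
  have coeff: "cmod (fps_nth H n) \<le> D * (P / sqrt (real i + 1))"
    if "h has_fps_expansion H" "h holomorphic_on ball 0 r" "0 \<le> D"
      "\<And>t. t \<in> {0..1} \<Longrightarrow> cmod (h (?e t)) \<le> D * lor i t" for h H D i n
  proof -
    have "cmod (fps_nth H n) \<le> D * (2 * arctan (sqrt ((real i + 1) * \<beta>)) / sqrt ((real i + 1) * \<beta>))"
      using that r by (intro fps_coeff_integral_bound[OF _ _ _ has_integral_mult_right[OF int]]) auto
    also have "\<dots> \<le> D * (P / sqrt (real i + 1))" using that intle by (intro mult_left_mono) auto
    finally show ?thesis .
  qed
  have expG: "(\<lambda>z. G z ^ i) has_fps_expansion F ^ i" for i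
    by (induction i) (auto intro!: has_fps_expansion_mult exp)
  define F1 where "F1 = fps_X * fps_deriv F - fps_const (of_real M) * F"
  define g1 where "g1 z = z * deriv G z - of_real M * G z" for z
  define F2 where "F2 = fps_X * fps_deriv F1 - fps_const (of_real M) * F1"
  define g2 where "g2 z = z * deriv g1 z - of_real M * g1 z" for z
  have g1: "g1 has_fps_expansion F1" unfolding g1_def F1_def by (intro fps_expansion_intros exp)
  have g2: "g2 has_fps_expansion F2" unfolding g2_def F2_def by (intro fps_expansion_intros g1)
  have hol1: "g1 holomorphic_on ball 0 r" unfolding g1_def by (intro holomorphic_intros hol) auto
  have hol2: "g2 holomorphic_on ball 0 r" unfolding g2_def by (intro holomorphic_intros hol1) auto
  have bdd: "\<exists>a. \<forall>z. cmod z \<le> 1 \<longrightarrow> cmod (f z) \<le> a" if "f holomorphic_on ball 0 r" for f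
  proof -
    have "continuous_on (cball 0 1) f"
      using holomorphic_on_imp_continuous_on[OF that] sub continuous_on_subset by blast
    then have "bounded (f ` cball 0 1)"
      by (intro compact_imp_bounded compact_continuous_image compact_cball)
    then obtain a where "\<forall>x\<in>cball 0 1. cmod (f x) \<le> a" unfolding bounded_iff by auto
    then show ?thesis by (intro exI[of _ a]) simp
  qed
  obtain a where a: "\<And>z. cmod z \<le> 1 \<Longrightarrow> cmod (g2 z) \<le> a" using bdd[OF hol2] by blast
  have a0: "0 \<le> a" using order_trans[OF norm_ge_zero a[of 0]] by simp
  have "deriv g1 holomorphic_on ball 0 r" by (intro holomorphic_intros hol1) auto
  then obtain L where L: "\<And>z. cmod z \<le> 1 \<Longrightarrow> cmod (deriv g1 z) \<le> L" using bdd by blast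
  have lip: "cmod (g1 z) \<le> L * cmod (z - 1)" if "cmod z \<le> 1" for z
  proof -
    have "norm (g1 z - g1 1) \<le> L * norm (z - 1)"
    proof (rule field_differentiable_bound[of "cball 0 1"])
      fix w :: complex assume "w \<in> cball 0 1"
      then show "(g1 has_field_derivative deriv g1 w) (at w within cball 0 1)" "cmod (deriv g1 w) \<le> L"
        using holomorphic_derivI[OF hol1, of w] sub L by (auto intro: has_field_derivative_at_within)
    qed (use that in auto)
    moreover have "g1 1 = 0" by (simp add: g1_def G1 dG1)
    ultimately show ?thesis by simp
  qed
  define Q where "Q = a * E * P + 8 * L\<^sup>2 * E * P / \<kappa>"
  have LL: "0 \<le> L" using order_trans[OF norm_ge_zero L[of 0]] by simp
  have Q: "0 \<le> Q" using a0 LL E P \<kappa> by (simp add: Q_def)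
  have c0: "cmod (fps_nth (F ^ j) n) \<le> E * (P / sqrt (real j + 1))" for j n
    using E by (intro coeff[OF expG]) (auto simp: norm_power intro!: pointwise holomorphic_intros hol)
  have c2: "cmod (fps_nth (F2 * F ^ j) n) \<le> a * E * (P / sqrt (real j + 1))" for j n
  proof (rule coeff[OF has_fps_expansion_mult[OF g2 expG]])
    fix t :: real assume "t \<in> {0..1}"
    then show "cmod (g2 (?e t) * G (?e t) ^ j) \<le> a * E * lor j t"
      unfolding norm_mult norm_power mult.assoc[of a] using pointwise(1)[of t j] a[of "?e t"] e1[of t] a0
      by (intro mult_mono) auto
  qed (use E a0 in \<open>auto intro!: holomorphic_intros hol hol2\<close>)
  have c1: "cmod (fps_nth (F1 * F1 * F ^ i) n) \<le> L\<^sup>2 * ((4 / ((real i + 1) * \<kappa>)) * E) * (P / sqrt (real i + 1))" for i n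
  proof (rule coeff[OF has_fps_expansion_mult[OF has_fps_expansion_mult[OF g1 g1] expG]])
    fix t :: real assume t: "t \<in> {0..1}"
    have "cmod (g1 (?e t)) * cmod (g1 (?e t)) \<le> (L * cmod (?e t - 1)) * (L * cmod (?e t - 1))"
      using e1[of t] LL by (intro mult_mono lip) auto
    then have "cmod (g1 (?e t) * g1 (?e t) * G (?e t) ^ i) \<le> (L * cmod (?e t - 1)) * (L * cmod (?e t - 1)) * cmod (G (?e t)) ^ i"
      unfolding norm_mult norm_power by (intro mult_right_mono) auto
    also have "\<dots> = L\<^sup>2 * ((cmod (?e t - 1))\<^sup>2 * cmod (G (?e t)) ^ i)"
      by (simp add: power2_eq_square mult_ac)
    also have "\<dots> \<le> L\<^sup>2 * ((4 / ((real i + 1) * \<kappa>)) * E * lor i t)"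
      using pointwise(2)[OF t] by (intro mult_left_mono) auto
    finally show "cmod (g1 (?e t) * g1 (?e t) * G (?e t) ^ i) \<le> L\<^sup>2 * ((4 / ((real i + 1) * \<kappa>)) * E) * lor i t"
      by (simp add: mult.assoc)
  qed (use E \<kappa> in \<open>auto intro!: holomorphic_intros hol hol1\<close>)
  have nsq: "cmod ((complex_of_real y)\<^sup>2 * w) = y\<^sup>2 * cmod w" for y w
    by (simp add: norm_mult norm_power)
  have moment: "(real n - real j * M)\<^sup>2 * cmod (fps_nth (F ^ j) n) \<le> Q * sqrt j" if "1 \<le> j" for j n
  proof (cases "j = 1")
    case True
    have "(of_nat n - of_real M) * fps_nth F n = fps_nth F1 n"
      using fps_power_coeff_first_moment[of n 0 "of_real M" F] by (simp add: F1_def)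
    moreover have "(of_nat n - of_real M) * fps_nth F1 n = fps_nth F2 n"
      unfolding F2_def by (simp only: fps_sub_nth fps_mult_left_const_nth fps_nth_X_deriv left_diff_distrib)
    ultimately have "(of_nat n - of_real M)\<^sup>2 * fps_nth F n = fps_nth F2 n"
      by (simp add: power2_eq_square mult.assoc)
    then have "cmod ((of_real (real n - M))\<^sup>2 * fps_nth F n) = cmod (fps_nth F2 n)" by simp
    also have "\<dots> \<le> a * E * (P / sqrt (real 0 + 1))" using c2[of 0 n] by simp
    also have "\<dots> \<le> Q" using E P \<kappa> by (simp add: Q_def)
    finally show ?thesis unfolding nsq using True by simp
  next
    case False
    define i where "i = j - 2"
    have j: "j = Suc (Suc i)" using that False by (simp add: i_def)
    have nj: "complex_of_real (real n - real j * M) = of_nat n - of_nat (Suc (Suc i)) * of_real M"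
      by (simp add: j)
    have "cmod ((of_real (real n - real j * M))\<^sup>2 * fps_nth (F ^ j) n)
       = cmod (of_nat j * (fps_nth (F2 * F ^ Suc i) n + of_nat (Suc i) * fps_nth (F1 * F1 * F ^ i) n))"
      using fps_power_coeff_second_moment[of n i "of_real M" F]
      unfolding nj F1_def[symmetric] F2_def[symmetric] by (simp only: j)
    also have "\<dots> \<le> real j * (a * E * (P / sqrt (real (Suc i) + 1)) + real (Suc i) * (L\<^sup>2 * ((4 / ((real i + 1) * \<kappa>)) * E) * (P / sqrt (real i + 1))))"
      unfolding norm_mult[of "of_nat j"] norm_of_nat
    proof (intro mult_left_mono order_trans[OF norm_triangle_ineq] add_mono c2)
      show "cmod (of_nat (Suc i) * fps_nth (F1 * F1 * F ^ i) n)
          \<le> real (Suc i) * (L\<^sup>2 * ((4 / ((real i + 1) * \<kappa>)) * E) * (P / sqrt (real i + 1)))"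
        unfolding norm_mult norm_of_nat by (intro mult_left_mono c1) simp
    qed simp
    also have "\<dots> \<le> real j * (a * E * P * (1 / sqrt j) + 4 * L\<^sup>2 * E * P / \<kappa> * (2 / sqrt j))"
    proof (intro mult_left_mono add_mono)
      show "a * E * (P / sqrt (real (Suc i) + 1)) \<le> a * E * P * (1 / sqrt j)"
        by (simp add: j add.commute)
      have "sqrt (real j) \<le> sqrt (4 * (real i + 1))" by (simp add: j)
      then have "sqrt (real j) \<le> 2 * sqrt (real i + 1)" by (simp only: real_sqrt_mult real_sqrt_four)
      then have "1 / sqrt (real i + 1) \<le> 2 / sqrt j"
        by (simp add: j field_simps)
      then have "4 * L\<^sup>2 * E * P / \<kappa> * (1 / sqrt (real i + 1)) \<le> 4 * L\<^sup>2 * E * P / \<kappa> * (2 / sqrt j)"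
        using E P \<kappa> by (intro mult_left_mono) auto
      moreover have "real (Suc i) * (L\<^sup>2 * ((4 / ((real i + 1) * \<kappa>)) * E) * (P / sqrt (real i + 1)))
         = 4 * L\<^sup>2 * E * P / \<kappa> * (1 / sqrt (real i + 1))"
      proof -
        have "k * (L\<^sup>2 * ((4 / (k * \<kappa>)) * E) * (P / sqrt k)) = 4 * L\<^sup>2 * E * P / \<kappa> * (1 / sqrt k)"
          if "0 < k" for k :: real
        proof -
          have "k * (L\<^sup>2 * ((4 / (k * \<kappa>)) * E) * (P / sqrt k)) = (k * (4 / (k * \<kappa>))) * (L\<^sup>2 * E * (P / sqrt k))"
            by (simp only: mult_ac)
          also have "k * (4 / (k * \<kappa>)) = 4 / \<kappa>" using that by simp
          finally show ?thesis by simp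
        qed
        from this[of "real i + 1"] show ?thesis by (simp add: add.commute)
      qed
      ultimately show "real (Suc i) * (L\<^sup>2 * ((4 / ((real i + 1) * \<kappa>)) * E) * (P / sqrt (real i + 1)))
         \<le> 4 * L\<^sup>2 * E * P / \<kappa> * (2 / sqrt j)" by simp
    qed simp
    also have "real j * (a * E * P * (1 / sqrt j) + 4 * L\<^sup>2 * E * P / \<kappa> * (2 / sqrt j)) = Q * (real j / sqrt j)"
      by (simp add: Q_def algebra_simps)
    also have "real j / sqrt j = sqrt j" by (rule real_div_sqrt) simp
    finally show ?thesis unfolding nsq .
  qed
  define C where "C = E * P + Q / M\<^sup>2"
  have C: "0 \<le> C" "E * P \<le> C" "Q / M\<^sup>2 \<le> C" using E P Q M by (auto simp: C_def)
  have "(\<Sum>j<J. cmod (fps_nth (F ^ j) n)) \<le> 1 + C * (4 * (\<Sum>j. real j powr (-3/2)) + 48 * pi)" for n J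
  proof -
    have "(\<Sum>j<J. cmod (fps_nth (F ^ j) n)) \<le> (\<Sum>j\<in>insert 0 {1..<J}. cmod (fps_nth (F ^ j) n))"
      by (intro sum_mono2) auto
    also have "\<dots> = cmod (fps_nth 1 n) + (\<Sum>j=1..<J. cmod (fps_nth (F ^ j) n))"
      by simp
    also have "cmod (fps_nth 1 n) \<le> 1" by simp
    also have "(\<Sum>j=1..<J. cmod (fps_nth (F ^ j) n)) \<le> C * (4 * (\<Sum>j. real j powr (-3/2)) + 48 * pi)"
    proof (rule sum_local_limit_bounded[where x = "n / M"])
      fix j :: nat assume j: "1 \<le> j"
      have "cmod (fps_nth (F ^ j) n) \<le> E * P / sqrt (real j + 1)" using c0[of j n] by simp
      also have "\<dots> \<le> C / sqrt j" using C j E P by (intro frac_le) auto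
      finally show "cmod (fps_nth (F ^ j) n) \<le> C / sqrt j" .
      have "real n / M - j = (real n - real j * M) / M" using M by (simp add: field_simps)
      then have "(real n / M - j)\<^sup>2 * cmod (fps_nth (F ^ j) n) = (real n - real j * M)\<^sup>2 * cmod (fps_nth (F ^ j) n) / M\<^sup>2"
        by (simp add: power_divide)
      also have "\<dots> \<le> Q * sqrt j / M\<^sup>2" using moment[OF j] by (intro divide_right_mono) auto
      also have "\<dots> = Q / M\<^sup>2 * sqrt j" by simp
      also have "\<dots> \<le> C * sqrt j" using C by (intro mult_right_mono) auto
      finally show "(real n / M - j)\<^sup>2 * cmod (fps_nth (F ^ j) n) \<le> C * sqrt j" .
    qed (use M C in auto)
    finally show ?thesis by simp
  qed
  then show ?thesis by blast
qed

section \<open>Completely monotonic rational functions\<close>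

text \<open>Complete monotonicity speaks of real derivatives on the half-line, the Taylor expansion of complex
  ones; with \<open>L\<close> the real or the imaginary part this identifies them.\<close>

lemma higher_deriv_of_real_linear:
  fixes f :: "complex \<Rightarrow> complex" and L :: "complex \<Rightarrow> real"
  assumes hol: "f holomorphic_on U" "open U" and pos: "\<And>s. 0 < s \<Longrightarrow> of_real s \<in> U"
    and L: "bounded_linear L" and s: "0 < s"
  shows "(deriv ^^ n) (\<lambda>x. L (f (of_real x))) s = L ((deriv ^^ n) f (of_real s))"
  using s
proof (induction n arbitrary: s)
  case (Suc n)
  have "(deriv ^^ Suc n) (\<lambda>x. L (f (of_real x))) s = deriv (\<lambda>x. L ((deriv ^^ n) f (of_real x))) s"
    unfolding funpow.simps comp_apply
  proof (rule deriv_cong_ev)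
    have "eventually (\<lambda>x. x \<in> {0<..}) (nhds s)"
      using Suc.prems by (intro eventually_nhds_in_open) auto
    then show "\<forall>\<^sub>F x in nhds s. (deriv ^^ n) (\<lambda>x. L (f (of_real x))) x = L ((deriv ^^ n) f (of_real x))"
      by eventually_elim (simp add: Suc.IH)
  qed simp
  also have "\<dots> = L (deriv ((deriv ^^ n) f) (of_real s))"
  proof (rule DERIV_imp_deriv)
    have "(deriv ^^ n) f holomorphic_on U" using hol by (rule holomorphic_higher_deriv)
    then have "((deriv ^^ n) f has_field_derivative deriv ((deriv ^^ n) f) (of_real s)) (at (of_real s))"
      using hol(2) pos[OF Suc.prems] by (rule holomorphic_derivI)
    then have "((\<lambda>x. (deriv ^^ n) f (of_real x)) has_vector_derivative deriv ((deriv ^^ n) f) (of_real s)) (at s)"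
      by (rule has_vector_derivative_real_field)
    then have "((\<lambda>x. L ((deriv ^^ n) f (of_real x))) has_vector_derivative L (deriv ((deriv ^^ n) f) (of_real s))) (at s)"
      by (rule bounded_linear.has_vector_derivative[OF L])
    then show "((\<lambda>x. L ((deriv ^^ n) f (of_real x))) has_real_derivative L (deriv ((deriv ^^ n) f) (of_real s))) (at s)"
      by (simp add: has_real_derivative_iff_has_vector_derivative)
  qed
  finally show ?case by simp
qed simp

lemma higher_deriv_eq_of_real:
  assumes hol: "f holomorphic_on U" "open U" and pos: "\<And>s. 0 < s \<Longrightarrow> of_real s \<in> U"
    and real: "\<And>s. 0 < s \<Longrightarrow> f (of_real s) \<in> \<real>" and s: "0 < s"
  shows "(deriv ^^ n) f (of_real s) = of_real ((deriv ^^ n) (\<lambda>x. Re (f (of_real x))) s)"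
proof -
  have "(deriv ^^ n) (\<lambda>x. Im (f (of_real x))) s = 0"
    using s
  proof (induction n arbitrary: s)
    case 0
    then show ?case using real[of s] by (simp add: complex_is_Real_iff)
  next
    case (Suc n)
    have "deriv ((deriv ^^ n) (\<lambda>x. Im (f (of_real x)))) s = deriv (\<lambda>_. 0) s"
    proof (rule deriv_cong_ev)
      have "eventually (\<lambda>x. x \<in> {0<..}) (nhds s)"
        using Suc.prems by (intro eventually_nhds_in_open) auto
      then show "\<forall>\<^sub>F x in nhds s. (deriv ^^ n) (\<lambda>x. Im (f (of_real x))) x = 0"
        by eventually_elim (simp add: Suc.IH)
    qed simp
    then show ?case by simp
  qed
  then have "Im ((deriv ^^ n) f (of_real s)) = 0"
    using higher_deriv_of_real_linear[OF hol pos bounded_linear_Im s] by simp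
  moreover have "Re ((deriv ^^ n) f (of_real s)) = (deriv ^^ n) (\<lambda>x. Re (f (of_real x))) s"
    using higher_deriv_of_real_linear[OF hol pos bounded_linear_Re s] by simp
  ultimately show ?thesis by (simp add: complex_eq_iff)
qed

text \<open>The closed disc with centre \<open>t\<close> through \<open>0\<close> lies in the closed right half-plane, so the expansion at
  \<open>t\<close> converges on all of \<open>[0, t]\<close>; for \<open>f\<close> and its derivatives its terms are nonnegative up to one
  common sign.\<close>

lemma cm_taylor_sums:
  fixes f :: "complex \<Rightarrow> complex"
  assumes hol: "f holomorphic_on U" "open U" and half: "{z. 0 \<le> Re z} \<subseteq> U"
    and real: "\<And>s. 0 < s \<Longrightarrow> f (of_real s) \<in> \<real>"
    and cm: "completely_monotonic (\<lambda>s. Re (f (of_real s)))"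
    and t: "0 < t"
  defines "D \<equiv> \<lambda>n. (-1) ^ n * (deriv ^^ n) (\<lambda>s. Re (f (of_real s))) t"
  shows "0 \<le> D n"
    and "0 \<le> x \<Longrightarrow> x \<le> t \<Longrightarrow>
      (\<lambda>n. of_real (D (n + k) * (t - x) ^ n / fact n)) sums ((-1) ^ k * (deriv ^^ k) f (of_real x))"
proof -
  show "0 \<le> D n" using cm t by (simp add: completely_monotonic_def D_def)
  have pos: "of_real s \<in> U" if "0 < s" for s using half that by auto
  assume x: "0 \<le> x" "x \<le> t"
  have sub: "cball (of_real t) t \<subseteq> U"
  proof
    fix z :: complex assume "z \<in> cball (of_real t) t"
    then have "\<bar>Re (of_real t - z)\<bar> \<le> t"
      using abs_Re_le_cmod[of "of_real t - z"] by (simp add: dist_norm)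
    then show "z \<in> U" using half by auto
  qed
  obtain e where e: "0 < e" "(\<Union>z\<in>cball (of_real t) t. cball z e) \<subseteq> U"
    using compact_subset_open_imp_cball_epsilon_subset[OF compact_cball hol(2) sub] by blast
  have ball: "ball (of_real t) (t + e) \<subseteq> U"
  proof
    fix z :: complex assume z: "z \<in> ball (of_real t) (t + e)"
    define w where "w = of_real t + of_real (t / (t + e)) * (z - of_real t)"
    have "cmod (w - of_real t) = \<bar>t / (t + e)\<bar> * cmod (z - of_real t)"
      unfolding w_def add_diff_cancel_left' norm_mult norm_of_real ..
    then have "cmod (w - of_real t) = t / (t + e) * cmod (z - of_real t)"
      using t e by simp
    also have "\<dots> \<le> t / (t + e) * (t + e)"
      using z t e by (intro mult_left_mono) (auto simp: dist_norm norm_minus_commute)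
    finally have w: "w \<in> cball (of_real t) t" using t e by (simp add: dist_norm norm_minus_commute)
    have "z - w = of_real (1 - t / (t + e)) * (z - of_real t)"
      by (simp add: w_def algebra_simps)
    moreover have "1 - t / (t + e) = e / (t + e)" using t e by (simp add: field_simps)
    ultimately have "z - w = of_real (e / (t + e)) * (z - of_real t)" by simp
    then have "cmod (z - w) = \<bar>e / (t + e)\<bar> * cmod (z - of_real t)"
      by (simp only: norm_mult norm_of_real)
    then have "cmod (z - w) = e / (t + e) * cmod (z - of_real t)"
      using t e by simp
    also have "\<dots> \<le> e / (t + e) * (t + e)"
      using z t e by (intro mult_left_mono) (auto simp: dist_norm norm_minus_commute)
    finally have "z \<in> cball w e" using t e by (simp add: dist_norm norm_minus_commute)
    then show "z \<in> U" using e(2) w by blast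
  qed
  have "(\<lambda>n. (deriv ^^ n) ((deriv ^^ k) f) (of_real t) / fact n * (of_real x - of_real t) ^ n) sums
      (deriv ^^ k) f (of_real x)"
  proof (rule holomorphic_power_series)
    show "(deriv ^^ k) f holomorphic_on ball (of_real t) (t + e)"
      using holomorphic_on_subset[OF holomorphic_higher_deriv[OF hol]] ball by blast
    have "cmod (of_real t - of_real x) = t - x" using x by (metis abs_of_nonneg diff_ge_0_iff_ge norm_of_real of_real_diff)
    then show "of_real x \<in> ball (complex_of_real t) (t + e)" using x e by (simp add: dist_norm)
  qed
  then have "(\<lambda>n. (-1) ^ k * ((deriv ^^ n) ((deriv ^^ k) f) (of_real t) / fact n * (of_real x - of_real t) ^ n)) sums
      ((-1) ^ k * (deriv ^^ k) f (of_real x))"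
    by (rule sums_mult)
  moreover have "(-1) ^ k * ((deriv ^^ n) ((deriv ^^ k) f) (of_real t) / fact n * (of_real x - of_real t) ^ n)
     = of_real (D (n + k) * (t - x) ^ n / fact n)" for n
  proof -
    have "(deriv ^^ n) ((deriv ^^ k) f) (of_real t) = of_real ((deriv ^^ (n + k)) (\<lambda>s. Re (f (of_real s))) t)"
      using higher_deriv_eq_of_real[OF hol pos real t, of "n + k"] by (simp add: funpow_add)
    moreover have "complex_of_real x - of_real t = - of_real (t - x)" by simp
    ultimately show ?thesis
      by (simp add: D_def power_add power_minus[of "of_real (t - x) :: complex"] del: of_real_diff)
  qed
  ultimately show "(\<lambda>n. of_real (D (n + k) * (t - x) ^ n / fact n)) sums ((-1) ^ k * (deriv ^^ k) f (of_real x))"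
    by simp
qed

lemma exp_neg_le_taylor:
  fixes l x m :: real
  assumes "0 \<le> l" "0 \<le> x" "0 \<le> m"
  shows "exp (- l * x) \<le> exp (- l * m) * (1 - l * (x - m)) + l\<^sup>2 * (x - m)\<^sup>2 / 2"
proof (cases "x = m")
  case False
  define diff where "diff = (\<lambda>n x. (- l) ^ n * exp (- l * x))"
  have "\<exists>t. (if x < m then x < t \<and> t < m else m < t \<and> t < x) \<and>
      exp (- l * x) = (\<Sum>k<2. diff k m / fact k * (x - m) ^ k) + diff 2 t / fact 2 * (x - m) ^ 2"
  proof (rule Taylor[of 2 diff "\<lambda>x. exp (- l * x)" "min x m" "max x m"])
    show "\<forall>k t. k < 2 \<and> min x m \<le> t \<and> t \<le> max x m \<longrightarrow> (diff k has_real_derivative diff (Suc k) t) (at t)"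
      unfolding diff_def by (auto intro!: derivative_eq_intros)
  qed (use False in \<open>auto simp: diff_def\<close>)
  then obtain t where t: "min x m < t"
    "exp (- l * x) = (\<Sum>k<2. diff k m / fact k * (x - m) ^ k) + diff 2 t / fact 2 * (x - m) ^ 2"
    by (auto split: if_splits)
  have "diff 2 t \<le> l\<^sup>2" unfolding diff_def using assms t(1) by (simp add: mult_left_le)
  then have "diff 2 t * (x - m)\<^sup>2 \<le> l\<^sup>2 * (x - m)\<^sup>2" by (rule mult_right_mono) simp
  then have "diff 2 t / fact 2 * (x - m)\<^sup>2 \<le> l\<^sup>2 * (x - m)\<^sup>2 / 2" by simp
  moreover have "(\<Sum>k<2. diff k m / fact k * (x - m) ^ k) = exp (- l * m) * (1 - l * (x - m))"
    by (simp add: diff_def numeral_2_eq_2 algebra_simps)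
  ultimately show ?thesis unfolding t(2) by linarith
qed simp

text \<open>This lemma and the next show that a nonzero rational function cannot decay exponentially.\<close>

lemma poly_times_exp_tendsto_0:
  fixes q :: "complex poly"
  assumes "0 < m"
  shows "((\<lambda>x. poly q (of_real x) * of_real (exp (- m * x))) \<longlongrightarrow> 0) at_top"
proof -
  have mono: "((\<lambda>x. x ^ i * exp (- m * x)) \<longlongrightarrow> 0) at_top" for i
  proof -
    have "((\<lambda>x. (m * x) ^ i / exp (m * x)) \<longlongrightarrow> 0) at_top"
      using assms by (intro filterlim_compose[OF tendsto_power_div_exp_0]
        filterlim_tendsto_pos_mult_at_top[OF tendsto_const]) (auto intro: filterlim_ident)
    then have "((\<lambda>x. 1 / m ^ i * ((m * x) ^ i / exp (m * x))) \<longlongrightarrow> 1 / m ^ i * 0) at_top"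
      by (intro tendsto_mult tendsto_const)
    moreover have "1 / m ^ i * ((m * x) ^ i / exp (m * x)) = x ^ i * exp (- m * x)" for x
      using assms by (simp add: power_mult_distrib exp_minus field_simps)
    ultimately show ?thesis by simp
  qed
  have "((\<lambda>x. \<Sum>i\<le>degree q. coeff q i * of_real (x ^ i * exp (- m * x))) \<longlongrightarrow> (\<Sum>i\<le>degree q. coeff q i * of_real 0)) at_top"
    by (intro tendsto_intros mono)
  then show ?thesis by (simp add: poly_altdef sum_distrib_right mult.assoc)
qed

lemma poly_not_tendsto_0:
  fixes p :: "complex poly"
  assumes "((\<lambda>x. poly p (of_real x)) \<longlongrightarrow> 0) (at_top :: real filter)"
  shows "p = 0"
  using assms
proof (induction p)
  case (pCons a q)
  have inv: "((\<lambda>x. inverse (complex_of_real x)) \<longlongrightarrow> 0) at_top"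
  proof -
    have "((\<lambda>x. complex_of_real (inverse x)) \<longlongrightarrow> of_real 0) at_top"
      by (intro tendsto_of_real tendsto_inverse_0_at_top filterlim_ident)
    then show ?thesis by simp
  qed
  have "((\<lambda>x. (poly (pCons a q) (of_real x) - a) * inverse (of_real x)) \<longlongrightarrow> (0 - a) * 0) at_top"
    by (intro tendsto_intros inv pCons.prems)
  then have lim: "((\<lambda>x. (poly (pCons a q) (of_real x) - a) * inverse (of_real x)) \<longlongrightarrow> 0) at_top"
    by (simp only: mult_zero_right)
  have "\<forall>\<^sub>F x in at_top. (poly (pCons a q) (of_real x) - a) * inverse (of_real x) = poly q (of_real x)"
    using eventually_gt_at_top[of "0::real"] by eventually_elim simp
  with lim have "((\<lambda>x. poly q (of_real x)) \<longlongrightarrow> 0) (at_top :: real filter)"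
    by (rule Lim_transform_eventually)
  then have "q = 0" by (rule pCons.IH)
  then have "((\<lambda>x. a) \<longlongrightarrow> 0) (at_top :: real filter)" using pCons.prems by simp
  then have "a = 0" by (simp add: tendsto_const_iff)
  then show ?case using \<open>q = 0\<close> by simp
qed simp

text \<open>The waiting time has positive mean and positive variance. For each \<open>t\<close> the
  Taylor coefficients at \<open>t\<close> turn \<open>f\<close> into the generating function \<open>f (t - t w) = (\<Sum>n. p n * w ^ n)\<close> of a
  probability distribution on the naturals; \<open>n / t\<close> has mean \<open>m\<close> and variance \<open>s - m\<^sup>2 + m / t\<close>.
  If \<open>s - m\<^sup>2\<close> vanished, then \<open>t \<rightarrow> \<infinity>\<close> would concentrate the distribution at \<open>m\<close> and force
  \<open>f l \<le> exp (- m l)\<close>, which is too small for a rational function.\<close>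

lemma cm_rational_moments:
  fixes f :: "complex \<Rightarrow> complex"
  assumes hol: "f holomorphic_on U" "open U" and half: "{z. 0 \<le> Re z} \<subseteq> U"
    and real: "\<And>s. 0 < s \<Longrightarrow> f (of_real s) \<in> \<real>"
    and cm: "completely_monotonic (\<lambda>s. Re (f (of_real s)))"
    and rat: "rational_function f"
    and lt1: "\<And>s. 0 < s \<Longrightarrow> cmod (f (of_real s)) < 1" and ge1: "1 \<le> cmod (f 0)"
  shows "f 0 = 1"
    and "\<exists>m s. 0 < m \<and> m\<^sup>2 < s \<and> deriv f 0 = - of_real m \<and> (deriv ^^ 2) f 0 = of_real s"
proof -
  define D where "D t n = (-1) ^ n * (deriv ^^ n) (\<lambda>s. Re (f (of_real s))) t" for t n
  have D0: "0 \<le> D t n" if "0 < t" for t n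
    using cm_taylor_sums(1)[OF hol half real cm that] by (simp add: D_def)
  have S: "(\<lambda>n. of_real (D t (n + k) * (t - x) ^ n / fact n)) sums ((-1) ^ k * (deriv ^^ k) f (of_real x))"
    if "0 < t" "0 \<le> x" "x \<le> t" for t x k
    using cm_taylor_sums(2)[OF hol half real cm that, of k] by (simp add: D_def)
  have real0: "(-1) ^ k * (deriv ^^ k) f 0 \<in> \<real>" for k
  proof -
    have "(\<lambda>n. of_real (D 1 (n + k) * (1 - 0) ^ n / fact n)) sums ((-1) ^ k * (deriv ^^ k) f (of_real 0))"
      by (rule S) auto
    then have lim: "(\<lambda>N. \<Sum>n<N. complex_of_real (D 1 (n + k) * (1 - 0) ^ n / fact n)) \<longlonglongrightarrow> (-1) ^ k * (deriv ^^ k) f 0"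
      unfolding sums_def by simp
    show ?thesis
      by (rule Lim_in_closed_set[OF closed_complex_Reals _ _ lim])
         (auto intro!: eventuallyI sum_in_Reals Reals_of_real simp del: of_real_divide of_real_mult)
  qed
  define v where "v k = Re ((-1) ^ k * (deriv ^^ k) f 0)" for k
  have v: "(-1) ^ k * (deriv ^^ k) f 0 = of_real (v k)" for k
    unfolding v_def by (rule of_real_Re[OF real0, symmetric])
  have Sv: "(\<lambda>n. D t (n + k) * t ^ n / fact n) sums v k" if "0 < t" for t k
    using S[OF that order_refl less_imp_le[OF that], of k] unfolding of_real_0 diff_zero v sums_of_real_iff .
  have v_nonneg: "0 \<le> v k" for k
    by (rule sums_le[OF _ sums_zero Sv[OF zero_less_one, of k]]) (simp add: D0)
  have cont: "continuous (at 0) f"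
    using half by (intro field_differentiable_imp_continuous_at holomorphic_on_imp_differentiable_at[OF hol]) auto
  show f0: "f 0 = 1"
  proof -
    have "((\<lambda>s. cmod (f (of_real s))) \<longlongrightarrow> cmod (f 0)) (at_right 0)"
    proof (rule tendsto_norm, rule continuous_within_tendsto_compose'[of 0 UNIV])
      show "((\<lambda>s. complex_of_real s) \<longlongrightarrow> 0) (at_right 0)"
        using tendsto_of_real[OF tendsto_ident_at, of 0 "{0<..}"] by simp
    qed (use cont in auto)
    moreover have "\<forall>\<^sub>F s in at_right 0. cmod (f (of_real s)) \<le> 1"
      using eventually_at_right_less[of "0::real"] by eventually_elim (use lt1 in force)
    ultimately have "cmod (f 0) \<le> 1" by (rule tendsto_upperbound) simp
    moreover have "f 0 = of_real (v 0)" using v[of 0] by simp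
    ultimately have "v 0 = 1" using ge1 v_nonneg[of 0] by simp
    then show ?thesis using \<open>f 0 = of_real (v 0)\<close> by simp
  qed
  then have v0: "v 0 = 1" by (simp add: v_def)
  define m where "m = v 1"
  define s where "s = v 2"
  have upper: "Re (f (of_real l)) \<le> exp (- l * m) + l\<^sup>2 / 2 * (s - m\<^sup>2 + m / t)" if l: "0 < l" "l \<le> t" for l t
  proof -
    have t: "0 < t" using l by linarith
    define p where "p = (\<lambda>n. D t n * t ^ n / fact n)"
    have p: "0 \<le> p n" for n using D0[OF t] t by (simp add: p_def)
    have p0: "p sums 1" using Sv[OF t, of 0] v0 by (simp add: p_def)
    have p1: "(\<lambda>n. real n * p n) sums (t * m)"
    proof -
      have "(\<lambda>n. t * (D t (n + 1) * t ^ n / fact n)) sums (t * m)"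
        unfolding m_def by (intro sums_mult Sv t)
      moreover have "t * (D t (n + 1) * t ^ n / fact n) = real (Suc n) * p (Suc n)" for n
        by (simp add: p_def divide_simps)
      ultimately have "(\<lambda>n. real (Suc n) * p (Suc n)) sums (t * m)" by simp
      then show ?thesis using sums_Suc_iff[of "\<lambda>n. real n * p n" "t * m"] by simp
    qed
    have p2: "(\<lambda>n. real n * (real n - 1) * p n) sums (t\<^sup>2 * s)"
    proof -
      have "(\<lambda>n. t\<^sup>2 * (D t (n + 2) * t ^ n / fact n)) sums (t\<^sup>2 * s)"
        unfolding s_def by (intro sums_mult Sv t)
      moreover have "t\<^sup>2 * (D t (n + 2) * t ^ n / fact n) = real (n + 2) * (real (n + 2) - 1) * p (n + 2)" for n
        by (simp add: p_def divide_simps power2_eq_square)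
      ultimately have "(\<lambda>n. real (n + 2) * (real (n + 2) - 1) * p (n + 2)) sums (t\<^sup>2 * s)" by simp
      then show ?thesis using sums_iff_shift[of "\<lambda>n. real n * (real n - 1) * p n" 2 "t\<^sup>2 * s"]
        by (simp add: numeral_2_eq_2)
    qed
    have fl: "(\<lambda>n. p n * (1 - l / t) ^ n) sums Re (f (of_real l))"
    proof -
      have "(\<lambda>n. of_real (D t n * (t - l) ^ n / fact n)) sums f (of_real l)"
        using S[of t l 0] l t by simp
      then have "(\<lambda>n. D t n * (t - l) ^ n / fact n) sums Re (f (of_real l))"
        by (metis (mono_tags, lifting) Re_complex_of_real sums_Re sums_cong)
      moreover have "D t n * (t - l) ^ n / fact n = p n * (1 - l / t) ^ n" for n
      proof -
        have "t - l = t * (1 - l / t)" using t by (simp add: field_simps)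
        then have "(t - l) ^ n = t ^ n * (1 - l / t) ^ n" by (metis power_mult_distrib)
        then show ?thesis by (simp add: p_def)
      qed
      ultimately show ?thesis by simp
    qed
    define c where "c = exp (- l * m)"
    let ?r = "\<lambda>n. (c + c * l * m + l\<^sup>2 * m\<^sup>2 / 2) * p n + (l\<^sup>2 / (2 * t\<^sup>2) - c * l / t - l\<^sup>2 * m / t) * (real n * p n)
        + l\<^sup>2 / (2 * t\<^sup>2) * (real n * (real n - 1) * p n)"
    have rs: "?r sums ((c + c * l * m + l\<^sup>2 * m\<^sup>2 / 2) * 1 + (l\<^sup>2 / (2 * t\<^sup>2) - c * l / t - l\<^sup>2 * m / t) * (t * m)
        + l\<^sup>2 / (2 * t\<^sup>2) * (t\<^sup>2 * s))"
      by (intro sums_add sums_mult p0 p1 p2)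
    have le: "p n * (1 - l / t) ^ n \<le> ?r n" for n
    proof -
      have "0 \<le> 1 - l / t" using l t by simp
      moreover have "1 - l / t \<le> exp (- (l / t))" using exp_ge_add_one_self[of "- (l / t)"] by simp
      ultimately have "(1 - l / t) ^ n \<le> exp (- (l / t)) ^ n" by (intro power_mono)
      also have "\<dots> = exp (- l * (real n / t))" by (simp add: exp_of_nat_mult[symmetric])
      also have "\<dots> \<le> c * (1 - l * (real n / t - m)) + l\<^sup>2 * (real n / t - m)\<^sup>2 / 2"
        unfolding c_def using l t v_nonneg[of 1] by (intro exp_neg_le_taylor) (auto simp: m_def)
      finally have "p n * (1 - l / t) ^ n \<le> p n * (c * (1 - l * (real n / t - m)) + l\<^sup>2 * (real n / t - m)\<^sup>2 / 2)"
        using p by (intro mult_left_mono)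
      also have "\<dots> = ?r n" using t by (simp add: power2_eq_square field_simps)
      finally show ?thesis .
    qed
    have "Re (f (of_real l)) \<le> (c + c * l * m + l\<^sup>2 * m\<^sup>2 / 2) * 1 + (l\<^sup>2 / (2 * t\<^sup>2) - c * l / t - l\<^sup>2 * m / t) * (t * m)
        + l\<^sup>2 / (2 * t\<^sup>2) * (t\<^sup>2 * s)"
      by (rule sums_le[OF le fl rs])
    also have "\<dots> = c + l\<^sup>2 / 2 * (s - m\<^sup>2 + m / t)" using t by (simp add: power2_eq_square field_simps)
    finally show ?thesis by (simp add: c_def)
  qed
  have limit: "Re (f (of_real l)) \<le> exp (- l * m) + l\<^sup>2 / 2 * (s - m\<^sup>2)" if l: "0 < l" for l
  proof (rule tendsto_lowerbound)
    have "((\<lambda>t. m / t) \<longlongrightarrow> 0) at_top"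
      by (intro tendsto_divide_0[OF tendsto_const] filterlim_at_top_imp_at_infinity filterlim_ident)
    then have "((\<lambda>t. exp (- l * m) + l\<^sup>2 / 2 * (s - m\<^sup>2 + m / t)) \<longlongrightarrow> exp (- l * m) + l\<^sup>2 / 2 * (s - m\<^sup>2 + 0)) at_top"
      by (intro tendsto_intros)
    then show "((\<lambda>t. exp (- l * m) + l\<^sup>2 / 2 * (s - m\<^sup>2 + m / t)) \<longlongrightarrow> exp (- l * m) + l\<^sup>2 / 2 * (s - m\<^sup>2)) at_top"
      by simp
    show "\<forall>\<^sub>F t in at_top. Re (f (of_real l)) \<le> exp (- l * m) + l\<^sup>2 / 2 * (s - m\<^sup>2 + m / t)"
      using eventually_ge_at_top[of l] by eventually_elim (rule upper[OF l])
  qed simp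
  have m: "0 < m"
  proof (rule ccontr)
    assume "\<not> 0 < m"
    then have m0: "v 1 = 0" using v_nonneg[of 1] by (simp add: m_def)
    have "(\<lambda>n. D 1 (n + 1) / fact n) sums 0" using Sv[of 1 1] m0 by simp
    then have D1: "D 1 (n + 1) = 0" for n
      using suminf_eq_zero_iff[of "\<lambda>n. D 1 (n + 1) / fact n"] D0[of 1] by (auto simp: sums_iff)
    have "(\<lambda>n. D 1 n * 1 ^ n / fact n) sums v 0" using Sv[of 1 0] by simp
    moreover have "(\<lambda>n. D 1 n * 1 ^ n / fact n) sums (\<Sum>n\<in>{0}. D 1 n * 1 ^ n / fact n)"
      by (rule sums_finite) (use D1 in \<open>auto simp: gr0_conv_Suc\<close>)
    ultimately have "D 1 0 = 1" using v0 sums_unique2 by fastforce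
    moreover have "D 1 0 = Re (f (of_real 1))" by (simp add: D_def)
    ultimately show False using lt1[of 1] complex_Re_le_cmod[of "f 1"] by simp
  qed
  have s: "m\<^sup>2 < s"
  proof (rule ccontr)
    assume "\<not> m\<^sup>2 < s"
    then have small: "Re (f (of_real l)) \<le> exp (- l * m)" if "0 < l" for l
      using limit[OF that] by (smt (verit) mult_nonneg_nonpos zero_le_power2 divide_nonneg_nonneg)
    have norm: "cmod (f (of_real l)) \<le> exp (- m * l)" if "0 < l" for l
    proof -
      have "0 \<le> Re (f (of_real l))" using D0[OF that, of 0] by (simp add: D_def)
      moreover have "f (of_real l) = of_real (Re (f (of_real l)))" by (rule of_real_Re[OF real[OF that], symmetric])
      ultimately have "cmod (f (of_real l)) = Re (f (of_real l))" by (metis abs_of_nonneg norm_of_real)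
      then show ?thesis using small[OF that] by (simp add: mult.commute)
    qed
    obtain a b where ab: "b \<noteq> 0" "\<And>z. f z = poly a z / poly b z"
      using rat unfolding rational_function_def by blast
    have "((\<lambda>x. poly a (of_real x)) \<longlongrightarrow> 0) (at_top :: real filter)"
    proof (rule Lim_null_comparison)
      show "((\<lambda>x. cmod (poly b (of_real x) * of_real (exp (- m * x)))) \<longlongrightarrow> 0) at_top"
        using tendsto_norm[OF poly_times_exp_tendsto_0[OF m]] by simp
      have "finite {z. poly b z = 0}" using ab poly_roots_finite by blast
      then have "finite (complex_of_real -` {z. poly b z = 0})"
        by (rule finite_vimageI) (simp add: inj_on_def)
      then obtain x0 where x0: "\<And>x. x \<in> complex_of_real -` {z. poly b z = 0} \<Longrightarrow> x \<le> x0"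
        by (meson bdd_above_finite bdd_above.E bdd_above_def)
      show "\<forall>\<^sub>F x in at_top. norm (poly a (complex_of_real x)) \<le> cmod (poly b (of_real x) * of_real (exp (- m * x)))"
        using eventually_gt_at_top[of "max x0 0"]
      proof eventually_elim
        case (elim x)
        then have nz: "poly b (of_real x) \<noteq> 0" using x0[of x] by auto
        then have "poly a (of_real x) = f (of_real x) * poly b (of_real x)" using ab by simp
        moreover have "cmod (f (of_real x)) \<le> exp (- m * x)" using elim by (intro norm) auto
        then have "cmod (poly b (of_real x)) * cmod (f (of_real x)) \<le> cmod (poly b (of_real x)) * exp (- m * x)"
          by (rule mult_left_mono) simp
        ultimately show ?case by (simp add: norm_mult mult.commute)
      qed
    qed
    then have "a = 0" by (rule poly_not_tendsto_0)
    then show False using ab(2)[of 0] f0 by simp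
  qed
  show "\<exists>m s. 0 < m \<and> m\<^sup>2 < s \<and> deriv f 0 = - of_real m \<and> (deriv ^^ 2) f 0 = of_real s"
  proof (intro exI conjI)
    show "deriv f 0 = - of_real m" using v[of 1] by (simp add: m_def minus_equation_iff[of "deriv f 0"])
    show "(deriv ^^ 2) f 0 = of_real s" using v[of 2] by (simp add: s_def)
  qed (use m s in auto)
qed

section \<open>Estimates on circles touching the imaginary axis\<close>

lemma circle_iff:
  assumes "0 < c"
  shows "cmod (z + of_real c) = c \<longleftrightarrow> Re z = - (cmod z)\<^sup>2 / (2 * c)"
proof -
  have "cmod (z + of_real c) = c \<longleftrightarrow> (cmod (z + of_real c))\<^sup>2 = c\<^sup>2"
    using assms by (metis norm_ge_zero less_imp_le power2_eq_iff_nonneg)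
  also have "(cmod (z + of_real c))\<^sup>2 = (cmod z)\<^sup>2 + 2 * c * Re z + c\<^sup>2"
    unfolding cmod_power2 by (simp add: power2_eq_square algebra_simps)
  finally show ?thesis using assms by (auto simp: field_simps)
qed

text \<open>On the circle the real part is \<open>- \<bar>z\<bar>\<^sup>2 / (2 c)\<close>, so the squared modulus of the Taylor polynomial is
  \<open>1 - (s - m\<^sup>2 - m / c) \<bar>z\<bar>\<^sup>2 + O(\<bar>z\<bar>\<^sup>4)\<close>. Leaving the imaginary axis costs \<open>m / c\<close>, and half of the
  variance \<open>s - m\<^sup>2\<close> pays for it once \<open>c\<close> is large.\<close>

lemma quadratic_on_circle_le:
  fixes m s c r :: real and z :: complex
  assumes m: "0 < m" and s: "m\<^sup>2 < s" and c: "1 \<le> c" "2 * m \<le> (s - m\<^sup>2) * c"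
    and z: "Re z = - (cmod z)\<^sup>2 / (2 * c)" "cmod z \<le> 1"
  shows "(cmod (1 - of_real m * z + of_real s / 2 * z\<^sup>2))\<^sup>2
     \<le> 1 - (s - m\<^sup>2) / 2 * (cmod z)\<^sup>2 + ((m + s)\<^sup>2 + s + m * s + s\<^sup>2) * (cmod z) ^ 4"
proof -
  define x y r where "x = Re z" and "y = Im z" and "r = cmod z"
  have r: "0 \<le> r" "r \<le> 1" "r\<^sup>2 = x\<^sup>2 + y\<^sup>2" using z by (auto simp: r_def x_def y_def cmod_power2)
  have s0: "0 < s" using s zero_le_power2[of m] by linarith
  have x: "x = - r\<^sup>2 / (2 * c)" using z by (simp add: x_def r_def)
  have r4: "r ^ 4 = r\<^sup>2 * r\<^sup>2" by (simp add: power2_eq_square numeral_eq_Suc)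
  have r2: "r\<^sup>2 \<le> 1" using r(1,2) by (rule power_le_one)
  have xabs: "0 \<le> - x" "- x \<le> r\<^sup>2 / 2"
  proof -
    have "r\<^sup>2 * 1 \<le> r\<^sup>2 * c" using c by (intro mult_left_mono) auto
    then show "0 \<le> - x" "- x \<le> r\<^sup>2 / 2" unfolding x using c by (auto simp: field_simps)
  qed
  have x2: "x\<^sup>2 \<le> r ^ 4 / 4"
  proof -
    have "(- x)\<^sup>2 \<le> (r\<^sup>2 / 2)\<^sup>2" using xabs by (intro power_mono)
    then show ?thesis unfolding r4 by (simp add: power2_eq_square)
  qed
  have r44: "r ^ 4 \<le> r\<^sup>2" using r by (intro power_decreasing) auto
  define u where "u = - m * x + s / 2 * (x\<^sup>2 - y\<^sup>2)"
  define v where "v = - m * y + s * x * y"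
  have P: "(cmod (1 - of_real m * z + of_real s / 2 * z\<^sup>2))\<^sup>2 = (1 + u)\<^sup>2 + v\<^sup>2"
  proof -
    have "Re (1 - of_real m * z + of_real s / 2 * z\<^sup>2) = 1 + u"
      by (simp add: u_def x_def y_def power2_eq_square field_simps)
    moreover have "Im (1 - of_real m * z + of_real s / 2 * z\<^sup>2) = v"
      by (simp add: v_def x_def y_def power2_eq_square field_simps)
    ultimately show ?thesis unfolding cmod_power2 by (simp only:)
  qed
  have u_eq: "u = - m * x - s / 2 * r\<^sup>2 + s * x\<^sup>2" unfolding u_def r(3) by (simp add: algebra_simps)
  have mx: "0 \<le> - m * x" "- m * x \<le> m * r\<^sup>2" "2 * (- m * x) \<le> (s - m\<^sup>2) / 2 * r\<^sup>2"
  proof -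
    show "0 \<le> - m * x" using xabs m by (simp add: mult_nonneg_nonpos)
    have "m * (- x) \<le> m * r\<^sup>2" using xabs m by (intro mult_left_mono) auto
    then show "- m * x \<le> m * r\<^sup>2" by simp
    have "2 * (- m * x) = (m / c) * r\<^sup>2" unfolding x using c by (simp add: field_simps)
    also have "\<dots> \<le> ((s - m\<^sup>2) / 2) * r\<^sup>2"
      using c by (intro mult_right_mono) (auto simp: field_simps)
    finally show "2 * (- m * x) \<le> (s - m\<^sup>2) / 2 * r\<^sup>2" .
  qed
  have sx: "0 \<le> s * x\<^sup>2" "s * x\<^sup>2 \<le> s * (r ^ 4 / 4)" using s0 x2 by (auto intro: mult_left_mono)
  have sr: "s * r ^ 4 \<le> s * r\<^sup>2" "0 \<le> s * r ^ 4" "0 \<le> m * r\<^sup>2" using s0 r44 m by (auto intro: mult_left_mono)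
  have "\<bar>u\<bar> \<le> (m + s) * r\<^sup>2"
    unfolding u_eq abs_le_iff using mx sx sr by (simp add: distrib_right)
  then have "\<bar>u\<bar>\<^sup>2 \<le> ((m + s) * r\<^sup>2)\<^sup>2" by (intro power_mono) auto
  then have u2: "u\<^sup>2 \<le> (m + s)\<^sup>2 * r ^ 4" by (simp add: power_mult_distrib r4 power2_eq_square mult_ac)
  have v2: "v\<^sup>2 \<le> m\<^sup>2 * r\<^sup>2 + (m * s + s\<^sup>2) * r ^ 4"
  proof -
    have "s * (- x) \<le> s * (r\<^sup>2 / 2)" using xabs s0 by (intro mult_left_mono) auto
    then have "m + s * (- x) \<le> m + s * r\<^sup>2 / 2" by simp
    moreover have "0 \<le> s * (- x)" using xabs s0 by (intro mult_nonneg_nonneg) auto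
    ultimately have "(m + s * (- x))\<^sup>2 \<le> (m + s * r\<^sup>2 / 2)\<^sup>2" using m by (intro power_mono) auto
    moreover have "y\<^sup>2 \<le> r\<^sup>2" unfolding r(3) by simp
    ultimately have "y\<^sup>2 * (m + s * (- x))\<^sup>2 \<le> r\<^sup>2 * (m + s * r\<^sup>2 / 2)\<^sup>2" by (intro mult_mono) auto
    also have "\<dots> = m\<^sup>2 * r\<^sup>2 + m * s * r ^ 4 + s\<^sup>2 / 4 * (r ^ 4 * r\<^sup>2)"
      unfolding r4 by (simp add: power2_eq_square algebra_simps)
    also have "s\<^sup>2 / 4 * (r ^ 4 * r\<^sup>2) \<le> s\<^sup>2 * (r ^ 4 * 1)"
      using r2 by (intro mult_mono) auto
    finally show ?thesis by (simp add: v_def power2_eq_square algebra_simps)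
  qed
  have "(1 + u)\<^sup>2 + v\<^sup>2 = 1 + 2 * u + u\<^sup>2 + v\<^sup>2" by (simp add: power2_eq_square algebra_simps)
  also have "\<dots> \<le> 1 + ((s - m\<^sup>2) / 2 * r\<^sup>2 - s * r\<^sup>2 + s * r ^ 4) + (m + s)\<^sup>2 * r ^ 4 + (m\<^sup>2 * r\<^sup>2 + (m * s + s\<^sup>2) * r ^ 4)"
    using mx sx sr u2 v2 unfolding u_eq by (intro add_mono) auto
  also have "\<dots> = 1 - (s - m\<^sup>2) / 2 * r\<^sup>2 + ((m + s)\<^sup>2 + s + m * s + s\<^sup>2) * r ^ 4"
    by (simp add: algebra_simps diff_divide_distrib add_divide_distrib)
  finally show ?thesis unfolding P r_def .
qed

lemma near_zero_circle_bound:
  fixes f :: "complex \<Rightarrow> complex" and m s :: real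
  assumes hol: "f holomorphic_on U" "open U" "0 \<in> U"
    and f0: "f 0 = 1" and f1: "deriv f 0 = - of_real m" and f2: "(deriv ^^ 2) f 0 = of_real s"
    and m: "0 < m" and s: "m\<^sup>2 < s"
  shows "\<exists>\<delta>>0. \<forall>c z. 1 \<le> c \<longrightarrow> 2 * m \<le> (s - m\<^sup>2) * c \<longrightarrow> cmod (z + of_real c) = c \<longrightarrow> cmod z \<le> \<delta> \<longrightarrow>
           (cmod (f z))\<^sup>2 \<le> 1 - (s - m\<^sup>2) / 4 * (cmod z)\<^sup>2"
proof -
  obtain \<rho> where \<rho>: "0 < \<rho>" "cball 0 \<rho> \<subseteq> U" using hol(2,3) open_contains_cball by blast
  have hold: "(deriv ^^ n) f holomorphic_on U" for n using hol by (intro holomorphic_higher_deriv)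
  have "continuous_on (cball 0 \<rho>) ((deriv ^^ 3) f)"
    using holomorphic_on_imp_continuous_on[OF hold] \<rho>(2) continuous_on_subset by blast
  then have "bounded ((deriv ^^ 3) f ` cball 0 \<rho>)"
    by (intro compact_imp_bounded compact_continuous_image compact_cball)
  then obtain B where B: "\<And>z. z \<in> cball 0 \<rho> \<Longrightarrow> cmod ((deriv ^^ 3) f z) \<le> B"
    unfolding bounded_iff by blast
  have B0: "0 \<le> B" using order_trans[OF norm_ge_zero B[of 0]] \<rho> by simp
  define P where "P z = 1 - of_real m * z + of_real s / 2 * z\<^sup>2" for z :: complex
  have taylor: "cmod (f z - P z) \<le> B * cmod z ^ 3" if z: "z \<in> cball 0 \<rho>" for z
  proof -
    have "cmod ((deriv ^^ 0) f z - (\<Sum>i\<le>2. (deriv ^^ i) f 0 * (z - 0) ^ i / fact i)) \<le> B * cmod (z - 0) ^ Suc 2 / fact 2"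
    proof (rule complex_Taylor[of "cball 0 \<rho>"])
      fix i and x :: complex assume "x \<in> cball 0 \<rho>" "i \<le> (2::nat)"
      then show "((deriv ^^ i) f has_field_derivative (deriv ^^ Suc i) f x) (at x within cball 0 \<rho>)"
        using holomorphic_derivI[OF hold hol(2), of x i] \<rho>(2) by (auto intro: has_field_derivative_at_within)
    next
      fix x :: complex assume "x \<in> cball 0 \<rho>"
      then show "cmod ((deriv ^^ Suc 2) f x) \<le> B" using B by (simp add: numeral_eq_Suc)
    qed (use z \<rho> in auto)
    moreover have "(\<Sum>i\<le>2. (deriv ^^ i) f 0 * (z - 0) ^ i / fact i) = P z"
      using f0 f1 f2 by (simp add: P_def numeral_2_eq_2)
    ultimately have "cmod (f z - P z) \<le> B * cmod z ^ 3 / 2" by (simp add: numeral_eq_Suc)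
    also have "\<dots> \<le> B * cmod z ^ 3" using B0 by simp
    finally show ?thesis .
  qed
  define K where "K = (m + s)\<^sup>2 + s + m * s + s\<^sup>2"
  define L where "L = K + 2 * (1 + m + s) * B + B\<^sup>2"
  have s0: "0 < s" using s zero_le_power2[of m] by linarith
  have "0 < s + ((m + s)\<^sup>2 + m * s + s\<^sup>2)" using m s0 by (intro add_pos_nonneg) auto
  then have K: "0 < K" by (simp add: K_def add_ac)
  moreover have "0 < L" unfolding L_def using K m s0 B0 by (intro add_pos_nonneg) auto
  ultimately have L: "0 < L" "0 < K" by auto
  define \<delta> where "\<delta> = min (min 1 \<rho>) ((s - m\<^sup>2) / (4 * L))"
  have \<delta>: "0 < \<delta>" using \<rho> L s by (simp add: \<delta>_def)
  have "(cmod (f z))\<^sup>2 \<le> 1 - (s - m\<^sup>2) / 4 * (cmod z)\<^sup>2"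
    if c: "1 \<le> c" "2 * m \<le> (s - m\<^sup>2) * c" and z: "cmod (z + of_real c) = c" "cmod z \<le> \<delta>" for c z
  proof -
    define r where "r = cmod z"
    have r: "0 \<le> r" "r \<le> 1" "r \<le> \<rho>" "r * (4 * L) \<le> s - m\<^sup>2"
      using z L by (auto simp: r_def \<delta>_def field_simps)
    have P2: "(cmod (P z))\<^sup>2 \<le> 1 - (s - m\<^sup>2) / 2 * r\<^sup>2 + K * r ^ 4"
      unfolding P_def K_def r_def
      using c z(1) r circle_iff[of c z] by (intro quadratic_on_circle_le[OF m s c]) (auto simp: r_def)
    have P1: "cmod (P z) \<le> 1 + m + s"
    proof -
      have "cmod (P z) \<le> cmod 1 + cmod (of_real m * z) + cmod (of_real s / 2 * z\<^sup>2)"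
        unfolding P_def by (meson add_mono_thms_linordered_semiring(3) norm_triangle_ineq norm_triangle_ineq4 order_trans)
      also have "\<dots> = 1 + m * r + s / 2 * r\<^sup>2" using m s0 by (simp add: norm_mult norm_divide norm_power r_def)
      also have "\<dots> \<le> 1 + m * 1 + s * 1"
        using m s0 r by (intro add_mono mult_mono power_le_one) auto
      finally show ?thesis by simp
    qed
    have diff: "cmod (f z - P z) \<le> B * r ^ 3" using taylor[of z] r by (simp add: r_def)
    have "cmod (f z) \<le> cmod (P z) + B * r ^ 3"
      using diff norm_triangle_ineq2[of "f z" "P z"] by linarith
    then have "(cmod (f z))\<^sup>2 \<le> (cmod (P z) + B * r ^ 3)\<^sup>2" by (intro power_mono) auto
    also have "\<dots> = (cmod (P z))\<^sup>2 + 2 * cmod (P z) * (B * r ^ 3) + B\<^sup>2 * r ^ 6"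
      by (simp add: power2_sum power_mult_distrib power_mult[symmetric] algebra_simps)
    also have "\<dots> \<le> (1 - (s - m\<^sup>2) / 2 * r\<^sup>2 + K * r ^ 3) + 2 * (1 + m + s) * (B * r ^ 3) + B\<^sup>2 * r ^ 3"
    proof (intro add_mono mult_right_mono mult_left_mono)
      have "K * r ^ 4 \<le> K * r ^ 3" using L r by (intro mult_left_mono power_decreasing) auto
      then show "(cmod (P z))\<^sup>2 \<le> 1 - (s - m\<^sup>2) / 2 * r\<^sup>2 + K * r ^ 3" using P2 by linarith
      show "r ^ 6 \<le> r ^ 3" using r by (intro power_decreasing) auto
    qed (use P1 B0 r in auto)
    also have "\<dots> = 1 - (s - m\<^sup>2) / 2 * r\<^sup>2 + (L * r) * r\<^sup>2"
      by (simp add: L_def algebra_simps power2_eq_square power3_eq_cube)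
    also have "\<dots> \<le> 1 - (s - m\<^sup>2) / 2 * r\<^sup>2 + ((s - m\<^sup>2) / 4) * r\<^sup>2"
      using r by (intro add_left_mono mult_right_mono) (auto simp: field_simps)
    also have "\<dots> = 1 - (s - m\<^sup>2) / 4 * r\<^sup>2" by (simp add: field_simps)
    finally show ?thesis by (simp add: r_def)
  qed
  then show ?thesis using \<delta> by blast
qed

text \<open>As \<open>c \<rightarrow> \<infinity>\<close> the circles converge to the imaginary axis on bounded sets: a sequence of violations would stay
  bounded since \<open>f\<close> vanishes at infinity, and would accumulate at a point of the axis away from \<open>0\<close>.\<close>

lemma far_strip_bound:
  fixes f :: "complex \<Rightarrow> complex"
  assumes hol: "f holomorphic_on U" "open U" and imag: "\<And>z. Re z = 0 \<Longrightarrow> z \<in> U"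
    and lt1: "\<And>z. Re z = 0 \<Longrightarrow> z \<noteq> 0 \<Longrightarrow> cmod (f z) < 1" and lim: "(f \<longlongrightarrow> 0) at_infinity"
    and \<delta>: "0 < \<delta>"
  shows "\<exists>c0>0. \<exists>\<eta>>0. \<forall>c\<ge>c0. \<forall>z. cmod (z + of_real c) = c \<longrightarrow> \<delta> \<le> cmod z \<longrightarrow> cmod (f z) \<le> 1 - \<eta>"
proof (rule ccontr)
  assume "\<not> ?thesis"
  then have "\<exists>c z. real (Suc n) \<le> c \<and> cmod (z + of_real c) = c \<and> \<delta> \<le> cmod z \<and> 1 - 1 / real (Suc n) < cmod (f z)" for n
    by (smt (verit) of_nat_0_less_iff zero_less_Suc divide_pos_pos zero_less_one)
  then obtain c z where cz: "\<And>n. real (Suc n) \<le> c n" "\<And>n. cmod (z n + of_real (c n)) = c n"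
    "\<And>n. \<delta> \<le> cmod (z n)" "\<And>n. 1 - 1 / real (Suc n) < cmod (f (z n))" by metis
  obtain R where R: "\<And>w. R \<le> cmod w \<Longrightarrow> cmod (f w) < 1/2"
    using tendstoD[OF lim, of "1/2"] by (auto simp: eventually_at_infinity)
  have zR: "cmod (z (Suc n)) \<le> R" for n
  proof (rule ccontr)
    assume "\<not> ?thesis"
    then have "cmod (f (z (Suc n))) < 1/2" using R by simp
    moreover have "1 / real (Suc (Suc n)) \<le> 1/2" by (simp add: field_simps)
    ultimately show False using cz(4)[of "Suc n"] by linarith
  qed
  have "compact (cball (0::complex) R)" by simp
  moreover have "\<forall>n. z (Suc n) \<in> cball 0 R" using zR by simp
  ultimately obtain l k where l: "strict_mono (k :: nat \<Rightarrow> nat)" "((\<lambda>n. z (Suc n)) \<circ> k) \<longlonglongrightarrow> l"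
    unfolding compact_def by metis
  define w where "w = (\<lambda>n. z (Suc (k n)))"
  have w: "w \<longlonglongrightarrow> l" using l(2) by (simp add: w_def o_def)
  have kn: "n \<le> k n" for n using l(1) by (rule seq_suble)
  have inv0: "(\<lambda>n. 1 / real (Suc n)) \<longlonglongrightarrow> 0" by (rule LIMSEQ_Suc[OF lim_1_over_n])
  have "(\<lambda>n. Re (w n)) \<longlonglongrightarrow> 0"
  proof (rule Lim_null_comparison)
    show "\<forall>\<^sub>F n in sequentially. norm (Re (w n)) \<le> R\<^sup>2 / 2 * (1 / real (Suc n))"
    proof (rule always_eventually, rule allI)
      fix n
      define C where "C = c (Suc (k n))"
      have C: "real (Suc n) \<le> C" using cz(1)[of "Suc (k n)"] kn[of n] by (simp add: C_def)
      then have C0: "0 < C" by linarith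
      have "Re (w n) = - (cmod (w n))\<^sup>2 / (2 * C)"
        using circle_iff[OF C0, of "w n"] cz(2)[of "Suc (k n)"] by (simp add: w_def C_def)
      then have "norm (Re (w n)) = (cmod (w n))\<^sup>2 / 2 * (1 / C)" using C0 by simp
      also have "\<dots> \<le> R\<^sup>2 / 2 * (1 / real (Suc n))"
      proof (intro mult_mono divide_right_mono power_mono)
        show "cmod (w n) \<le> R" using zR by (simp add: w_def)
        show "1 / C \<le> 1 / real (Suc n)" using C C0 by (intro frac_le) auto
      qed (use C0 in auto)
      finally show "norm (Re (w n)) \<le> R\<^sup>2 / 2 * (1 / real (Suc n))" .
    qed
    show "(\<lambda>n. R\<^sup>2 / 2 * (1 / real (Suc n))) \<longlonglongrightarrow> 0" using tendsto_mult_left[OF inv0, of "R\<^sup>2 / 2"] by simp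
  qed
  then have Re0: "Re l = 0" using tendsto_Re[OF w] LIMSEQ_unique by blast
  have "\<delta> \<le> cmod l"
    by (rule tendsto_lowerbound[OF tendsto_norm[OF w]]) (use cz(3) in \<open>auto simp: w_def\<close>)
  then have "l \<noteq> 0" using \<delta> by auto
  have "isCont f l"
    using imag[OF Re0] by (intro field_differentiable_imp_continuous_at holomorphic_on_imp_differentiable_at[OF hol])
  then have "(\<lambda>n. cmod (f (w n))) \<longlonglongrightarrow> cmod (f l)"
    by (intro tendsto_norm isCont_tendsto_compose[OF _ w])
  moreover have "(\<lambda>n. 1 - 1 / real (Suc n)) \<longlonglongrightarrow> 1 - 0" by (intro tendsto_diff tendsto_const inv0)
  moreover have "1 - 1 / real (Suc n) \<le> cmod (f (w n))" for n
  proof -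
    have "1 / real (Suc (Suc (k n))) \<le> 1 / real (Suc n)" using kn[of n] by (intro frac_le) auto
    then show ?thesis using cz(4)[of "Suc (k n)"] unfolding w_def by linarith
  qed
  ultimately have "1 - 0 \<le> cmod (f l)" by (intro LIMSEQ_le) auto
  then show False using lt1[OF Re0 \<open>l \<noteq> 0\<close>] by simp
qed

lemma circle_bound:
  fixes f :: "complex \<Rightarrow> complex" and m s :: real
  assumes hol: "f holomorphic_on U" "open U" and imag: "\<And>z. Re z = 0 \<Longrightarrow> z \<in> U"
    and lt1: "\<And>z. Re z = 0 \<Longrightarrow> z \<noteq> 0 \<Longrightarrow> cmod (f z) < 1" and lim: "(f \<longlongrightarrow> 0) at_infinity"
    and f0: "f 0 = 1" and f1: "deriv f 0 = - of_real m" and f2: "(deriv ^^ 2) f 0 = of_real s"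
    and m: "0 < m" and s: "m\<^sup>2 < s"
  shows "\<exists>c0>0. \<forall>c\<ge>c0. \<exists>\<kappa>>0. \<forall>z. cmod (z + of_real c) = c \<longrightarrow> (cmod (f z))\<^sup>2 \<le> 1 - \<kappa> * (cmod z)\<^sup>2"
proof -
  obtain \<delta> where \<delta>: "0 < \<delta>" and near: "\<And>c z. 1 \<le> c \<Longrightarrow> 2 * m \<le> (s - m\<^sup>2) * c \<Longrightarrow> cmod (z + of_real c) = c \<Longrightarrow>
      cmod z \<le> \<delta> \<Longrightarrow> (cmod (f z))\<^sup>2 \<le> 1 - (s - m\<^sup>2) / 4 * (cmod z)\<^sup>2"
    using near_zero_circle_bound[OF hol _ f0 f1 f2 m s] imag[of 0] by auto
  obtain c1 \<eta> where c1: "0 < c1" "0 < \<eta>" and far: "\<And>c z. c1 \<le> c \<Longrightarrow> cmod (z + of_real c) = c \<Longrightarrow>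
      \<delta> \<le> cmod z \<Longrightarrow> cmod (f z) \<le> 1 - \<eta>"
    using far_strip_bound[OF hol imag lt1 lim \<delta>] by blast
  define c0 where "c0 = max (max 1 c1) (2 * m / (s - m\<^sup>2))"
  have "\<exists>\<kappa>>0. \<forall>z. cmod (z + of_real c) = c \<longrightarrow> (cmod (f z))\<^sup>2 \<le> 1 - \<kappa> * (cmod z)\<^sup>2" if c: "c0 \<le> c" for c
  proof -
    have cc: "1 \<le> c" "c1 \<le> c" "2 * m \<le> (s - m\<^sup>2) * c" using c s by (auto simp: c0_def field_simps)
    define \<kappa> where "\<kappa> = min ((s - m\<^sup>2) / 4) (\<eta> / (4 * c\<^sup>2))"
    have \<kappa>: "0 < \<kappa>" using s c1 cc by (simp add: \<kappa>_def)
    have "(cmod (f z))\<^sup>2 \<le> 1 - \<kappa> * (cmod z)\<^sup>2" if z: "cmod (z + of_real c) = c" for z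
    proof (cases "cmod z \<le> \<delta>")
      case True
      have "\<kappa> * (cmod z)\<^sup>2 \<le> (s - m\<^sup>2) / 4 * (cmod z)\<^sup>2" unfolding \<kappa>_def by (intro mult_right_mono min.cobounded1) auto
      then show ?thesis using near[OF cc(1,3) z True] by linarith
    next
      case False
      have "cmod z \<le> 2 * c" using norm_triangle_ineq4[of "z + of_real c" "of_real c"] z cc by simp
      then have "(cmod z)\<^sup>2 \<le> (2 * c)\<^sup>2" by (intro power_mono) auto
      then have "\<kappa> * (cmod z)\<^sup>2 \<le> \<eta> / (4 * c\<^sup>2) * (2 * c)\<^sup>2"
        unfolding \<kappa>_def using c1 by (intro mult_mono min.cobounded2) auto
      also have "\<dots> = \<eta>" using cc by (simp add: power2_eq_square)
      finally have "\<kappa> * (cmod z)\<^sup>2 \<le> \<eta>" .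
      moreover have "cmod (f z) \<le> 1 - \<eta>" using far[OF cc(2) z] False by simp
      moreover have "(cmod (f z))\<^sup>2 \<le> cmod (f z)"
        using \<open>cmod (f z) \<le> 1 - \<eta>\<close> c1 by (simp add: power2_eq_square mult_left_le)
      ultimately show ?thesis by linarith
    qed
    then show ?thesis using \<kappa> by blast
  qed
  moreover have "0 < c0" by (simp add: c0_def)
  ultimately show ?thesis by blast
qed

section \<open>The resolvent and the characteristic function\<close>

lemma norm_vector_smult: "norm (z *s v) = cmod z * norm (v :: complex^'n)"
  unfolding norm_vec_def by (simp add: norm_mult L2_set_right_distrib)

lemma norm_mat_mult: "norm (mat z ** A) = cmod z * norm (A :: complex^'n^'m)"
proof -
  have "(mat z ** A) $ i = z *s A $ i" for i by (simp add: vec_eq_iff)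
  then show ?thesis unfolding norm_vec_def[of "mat z ** A"] norm_vec_def[of A]
    by (simp add: norm_vector_smult L2_set_right_distrib)
qed

lemma mat_nth: "mat z $ i $ j = (if i = j then z else 0)"
  by (simp add: mat_def)

lemma matrix_mult_nth: "(A ** B) $ i $ j = (\<Sum>k\<in>UNIV. A $ i $ k * B $ k $ j)"
  by (simp add: matrix_matrix_mult_def)

lemma mat_mult_mult: "(mat a ** X) ** (mat b ** Y) = mat (a * b) ** (X ** (Y :: complex^'k^'n))"
  for X :: "complex^'n^'m"
proof (rule matrix_eqI)
  fix i j
  show "((mat a ** X) ** (mat b ** Y)) $ i $ j = (mat (a * b) ** (X ** Y)) $ i $ j"
    unfolding mat_mult_nth matrix_mult_nth[of "mat a ** X"] matrix_mult_nth[of X] sum_distrib_left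
    by (simp add: mult_ac)
qed

lemma mat_vector_mult: "mat z *v x = z *s (x :: complex^'n)"
  by (simp add: vec_eq_iff matrix_vector_mult_def mat_def if_distrib if_distribR sum.delta cong: if_cong)

lemma mat_minus_entry_holomorphic: "(\<lambda>z. (mat z - A) $ i $ j) holomorphic_on S"
  for A :: "complex^'m^'m"
  by (cases "i = j") (simp_all add: mat_nth holomorphic_on_diff holomorphic_on_ident[unfolded id_def])

lemma open_resolvent_set: "open (resolvent_set A)" for A :: "complex^'m^'m"
proof -
  have "(\<lambda>z. det (mat z - A)) holomorphic_on UNIV"
    by (intro det_holomorphic_on mat_minus_entry_holomorphic)
  then have "continuous_on UNIV (\<lambda>z. det (mat z - A))" by (rule holomorphic_on_imp_continuous_on)
  then have "open ((\<lambda>z. det (mat z - A)) -` (- {0}))" by (intro open_vimage) auto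
  moreover have "resolvent_set A = (\<lambda>z. det (mat z - A)) -` (- {0})"
    by (auto simp: resolvent_set_def invertible_det_nz)
  ultimately show ?thesis by simp
qed

lemma resolvent_works:
  assumes "z \<in> resolvent_set A"
  shows "(mat z - A) ** resolvent z A = mat 1" "resolvent z A ** (mat z - A) = mat 1"
  using matrix_inv_works assms unfolding resolvent_set_def resolvent_def by blast+

lemma resolvent_entry_holomorphic:
  "(\<lambda>z. resolvent z A $ i $ j) holomorphic_on resolvent_set (A :: complex^'m^'m)"
  unfolding resolvent_def
  by (intro matrix_inv_holomorphic_on mat_minus_entry_holomorphic) (auto simp: resolvent_set_def)

lemma resolvent_large:
  fixes A :: "complex^'m^'m"
  assumes "norm A < cmod z"
  shows "z \<in> resolvent_set A" "norm (resolvent z A) \<le> norm (mat 1 :: complex^'m^'m) / (cmod z - norm A)"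
proof -
  have "\<forall>x. (mat z - A) *v x = 0 \<longrightarrow> x = 0"
  proof (intro allI impI)
    fix x assume "(mat z - A) *v x = 0"
    then have "z *s x = A *v x" by (simp add: matrix_vector_mult_diff_rdistrib mat_vector_mult)
    then have "cmod z * norm x \<le> norm A * norm x"
      using norm_matrix_vector_mult_le[of A x] norm_vector_smult[of z x] by simp
    then show "x = 0" using assms by (auto simp: mult_le_cancel_right)
  qed
  then show z: "z \<in> resolvent_set A"
    unfolding resolvent_set_def by (simp add: invertible_left_inverse matrix_left_invertible_ker)
  have "mat z ** resolvent z A = mat 1 + A ** resolvent z A"
    using resolvent_works(1)[OF z] by (simp add: matrix_diff_rdistrib algebra_simps)
  then have "cmod z * norm (resolvent z A) \<le> norm (mat 1 :: complex^'m^'m) + norm A * norm (resolvent z A)"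
    using norm_triangle_ineq[of "mat 1 :: complex^'m^'m" "A ** resolvent z A"] norm_matrix_matrix_mult_le[of A "resolvent z A"]
    by (simp add: norm_mat_mult[symmetric])
  then show "norm (resolvent z A) \<le> norm (mat 1 :: complex^'m^'m) / (cmod z - norm A)"
    using assms by (simp add: field_simps)
qed

text \<open>The characteristic function is a fixed entry of \<open>A1 R(z) A1\<close>, up to scaling.\<close>

lemma char_fun_holomorphic:
  fixes A0 A1 :: "complex^'m^'m"
  assumes A1: "A1 \<noteq> 0" and char: "\<forall>z\<in>resolvent_set A0. A1 ** resolvent z A0 ** A1 = mat (\<phi> z) ** A1"
  shows "\<phi> holomorphic_on resolvent_set A0" and "(\<phi> \<longlongrightarrow> 0) at_infinity"
proof -
  obtain i j where ij: "A1 $ i $ j \<noteq> 0" using A1 by (auto simp: vec_eq_iff)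
  have \<phi>: "\<phi> z = (A1 ** resolvent z A0 ** A1) $ i $ j / A1 $ i $ j" if "z \<in> resolvent_set A0" for z
    using char that ij by simp
  have "(\<lambda>z. (A1 ** resolvent z A0 ** A1) $ i $ j / A1 $ i $ j) holomorphic_on resolvent_set A0"
    using ij unfolding matrix_matrix_mult_def by (simp, intro holomorphic_intros resolvent_entry_holomorphic, auto)
  then show "\<phi> holomorphic_on resolvent_set A0"
    by (subst holomorphic_cong[OF refl \<phi>])
  have bound: "cmod (\<phi> z) \<le> norm A1 * norm A1 * norm (mat 1 :: complex^'m^'m) / cmod (A1 $ i $ j) * (1 / (cmod z - norm A0))"
    if z: "norm A0 < cmod z" for z
  proof -
    have "cmod ((A1 ** resolvent z A0 ** A1) $ i $ j) \<le> norm (A1 ** resolvent z A0 ** A1)"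
      by (rule norm_mult_entry_le)
    also have "\<dots> \<le> (norm A1 * norm (resolvent z A0)) * norm A1"
      by (intro order_trans[OF norm_matrix_matrix_mult_le] mult_right_mono norm_matrix_matrix_mult_le) auto
    also have "\<dots> \<le> (norm A1 * (norm (mat 1 :: complex^'m^'m) / (cmod z - norm A0))) * norm A1"
      by (intro mult_right_mono mult_left_mono resolvent_large z) auto
    finally have "cmod ((A1 ** resolvent z A0 ** A1) $ i $ j) / cmod (A1 $ i $ j)
        \<le> (norm A1 * (norm (mat 1 :: complex^'m^'m) / (cmod z - norm A0))) * norm A1 / cmod (A1 $ i $ j)"
      by (rule divide_right_mono) simp
    then show ?thesis unfolding \<phi>[OF resolvent_large(1)[OF z]] norm_divide by (simp add: mult_ac)
  qed
  show "(\<phi> \<longlongrightarrow> 0) at_infinity"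
  proof (rule Lim_null_comparison)
    show "\<forall>\<^sub>F z in at_infinity. norm (\<phi> z) \<le> norm A1 * norm A1 * norm (mat 1 :: complex^'m^'m) / cmod (A1 $ i $ j) * (1 / (cmod z - norm A0))"
      unfolding eventually_at_infinity using bound by (intro exI[of _ "norm A0 + 1"]) auto
    have "filterlim (\<lambda>z::complex. - norm A0 + cmod z) at_top at_infinity"
      by (intro filterlim_tendsto_add_at_top[OF tendsto_const] filterlim_norm_at_top)
    then have "filterlim (\<lambda>z::complex. cmod z - norm A0) at_infinity at_infinity"
      using filterlim_at_top_imp_at_infinity by (simp add: filterlim_at_top_imp_at_infinity)
    then have "((\<lambda>z::complex. 1 / (cmod z - norm A0)) \<longlongrightarrow> 0) at_infinity"
      by (intro tendsto_divide_0[OF tendsto_const])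
    then show "((\<lambda>z. norm A1 * norm A1 * norm (mat 1 :: complex^'m^'m) / cmod (A1 $ i $ j) * (1 / (cmod z - norm A0))) \<longlongrightarrow> 0) at_infinity"
      by (rule tendsto_mult_right_zero)
  qed
qed

text \<open>If \<open>Re z \<le> - \<alpha>\<close> on the spectrum, then \<open>\<bar>z + c\<bar>\<^sup>2 \<le> \<parallel>A\<parallel>\<^sup>2 - 2 c \<alpha> + c\<^sup>2 \<le> c (c - \<alpha>)\<close> there for large \<open>c\<close>.\<close>

lemma spectrum_in_disc:
  fixes A :: "complex^'m^'m"
  assumes "spectrum A \<subseteq> {z. Re z < 0}"
  shows "\<exists>c0>0. \<forall>c\<ge>c0. \<exists>\<rho>>1. \<forall>z. c < \<rho> * cmod (z + of_real c) \<longrightarrow> z \<in> resolvent_set A"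
proof -
  have bd: "cmod z \<le> norm A" if "z \<in> spectrum A" for z
    using that resolvent_large(1)[of A z] unfolding spectrum_def by force
  have "compact (spectrum A)"
    using open_resolvent_set[of A] bd unfolding compact_eq_bounded_closed bounded_iff
    by (auto simp: spectrum_def intro: closed_Compl)
  then have "\<exists>\<alpha>>0. \<forall>z\<in>spectrum A. Re z \<le> - \<alpha>"
  proof (cases "spectrum A = {}")
    case False
    have "continuous_on (spectrum A) Re" by (intro continuous_intros)
    then obtain w where "w \<in> spectrum A" "\<And>z. z \<in> spectrum A \<Longrightarrow> Re z \<le> Re w"
      using continuous_attains_sup[OF \<open>compact (spectrum A)\<close> False] by blast
    then show ?thesis using assms by (intro exI[of _ "- Re w"]) auto
  qed (auto intro: exI[of _ 1])
  then obtain \<alpha> where \<alpha>: "0 < \<alpha>" "\<And>z. z \<in> spectrum A \<Longrightarrow> Re z \<le> - \<alpha>" by blast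
  define c0 where "c0 = (norm A)\<^sup>2 / \<alpha> + \<alpha> + 1"
  have c0: "0 < c0" using \<alpha> by (simp add: c0_def add_nonneg_pos)
  have "\<exists>\<rho>>1. \<forall>z. c < \<rho> * cmod (z + of_real c) \<longrightarrow> z \<in> resolvent_set A" if c: "c0 \<le> c" for c
  proof -
    have "0 \<le> (norm A)\<^sup>2 / \<alpha>" using \<alpha> by simp
    then have c1: "0 < c" "\<alpha> < c" using c \<alpha>(1) unfolding c0_def by linarith+
    have "(norm A)\<^sup>2 / \<alpha> \<le> c" using c \<alpha> by (simp add: c0_def)
    then have c2: "(norm A)\<^sup>2 \<le> c * \<alpha>" using \<alpha> by (simp add: field_simps)
    define \<rho> where "\<rho> = sqrt (c / (c - \<alpha>))"
    have \<rho>2: "\<rho>\<^sup>2 = c / (c - \<alpha>)" using c1 by (simp add: \<rho>_def)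
    have \<rho>: "1 < \<rho>" unfolding \<rho>_def using c1 \<alpha> by simp
    have "z \<in> resolvent_set A" if z: "c < \<rho> * cmod (z + of_real c)" for z
    proof (rule ccontr)
      assume "z \<notin> resolvent_set A"
      then have zs: "z \<in> spectrum A" by (simp add: spectrum_def)
      have "(cmod (z + of_real c))\<^sup>2 = (cmod z)\<^sup>2 + 2 * c * Re z + c\<^sup>2"
        unfolding cmod_power2 by (simp add: power2_eq_square algebra_simps)
      also have "\<dots> \<le> (norm A)\<^sup>2 + 2 * c * (- \<alpha>) + c\<^sup>2"
        using bd[OF zs] \<alpha>(2)[OF zs] c1 by (intro add_mono mult_left_mono power_mono) auto
      also have "\<dots> \<le> c * (c - \<alpha>)" using c2 by (simp add: power2_eq_square algebra_simps)
      finally have "\<rho>\<^sup>2 * (cmod (z + of_real c))\<^sup>2 \<le> \<rho>\<^sup>2 * (c * (c - \<alpha>))" by (intro mult_left_mono) auto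
      also have "\<dots> = c\<^sup>2" unfolding \<rho>2 using c1 by (simp add: power2_eq_square)
      finally have "(\<rho> * cmod (z + of_real c))\<^sup>2 \<le> c\<^sup>2" by (simp add: power_mult_distrib)
      then have "\<rho> * cmod (z + of_real c) \<le> c"
        by (rule power2_le_imp_le) (use c1 in simp)
      then show False using z by simp
    qed
    then show ?thesis using \<rho> by blast
  qed
  then show ?thesis using c0 by blast
qed

lemma neumann_inverse_eq_resolvent:
  fixes A :: "complex^'m^'m" and c :: complex
  assumes "w \<noteq> 0" "c \<noteq> 0" and z: "c * (1 / w - 1) \<in> resolvent_set A"
  defines "B \<equiv> mat 1 + mat (1 / c) ** A"
  shows "invertible (mat 1 - mat w ** B)"
    and "matrix_inv (mat 1 - mat w ** B) = mat (c / w) ** resolvent (c * (1 / w - 1)) A"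
proof -
  have eq: "mat 1 - mat w ** B = mat (w / c) ** (mat (c * (1 / w - 1)) - A)"
    using assms(1,2) by (intro matrix_eqI) (simp add: B_def mat_nth field_simps)
  let ?R = "mat (c / w) ** resolvent (c * (1 / w - 1)) A"
  have "(mat 1 - mat w ** B) ** ?R = mat 1"
    unfolding eq mat_mult_mult resolvent_works(1)[OF z] using assms(1,2) by simp
  then have *: "(mat 1 - mat w ** B) ** ?R = mat 1" .
  then show "matrix_inv (mat 1 - mat w ** B) = ?R" by (rule matrix_inv_eqI)
  show "invertible (mat 1 - mat w ** B)" using * by (metis invertible_right_inverse)
qed

text \<open>The data of the discretisation \<open>Q = I + A / c\<close> of the system. Its diagonal part \<open>B = I + A0 / c\<close> has
  spectral radius below \<open>1\<close>. Between two transitions \<open>C = A1 / c\<close> to the next coordinate the powers of \<open>B\<close>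
  act, and the characteristic equation turns \<open>C B\<^sup>n C\<close> into a multiple of \<open>C\<close>; the multiples are the Taylor
  coefficients of \<open>G(w) = \<phi> (c (1 / w - 1))\<close>. The substitution takes the unit circle to the circle
  \<open>\<bar>z + c\<bar> = c\<close>, on which \<open>\<phi>\<close> satisfies the decay that the local limit estimate asks for.\<close>

lemma discretisation_exists:
  fixes A0 A1 :: "complex^'m^'m" and \<phi> :: "complex \<Rightarrow> complex"
  assumes A1: "A1 \<noteq> 0" and rat: "rational_function \<phi>"
    and char: "\<forall>z\<in>resolvent_set A0. A1 ** resolvent z A0 ** A1 = mat (\<phi> z) ** A1"
    and spec: "spectrum A0 \<subseteq> {z. Re z < 0}"
    and zero: "0 \<in> Omega_plus A0 \<phi>"
    and omega: "Omega_plus A0 \<phi> \<subseteq> {z. Re z < 0} \<union> {0}"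
    and cm: "char_completely_monotonic A0 \<phi>"
  shows "\<phi> 0 = 1"
    and "\<exists>c>0. \<exists>F :: complex fps. \<exists>K L q. 0 < q \<and> q < 1 \<and> fps_nth F 0 = 0 \<and>
      (\<forall>n. (mat (of_real (1/c)) ** A1) ** mat_pow (mat 1 + mat (of_real (1/c)) ** A0) n ** (mat (of_real (1/c)) ** A1)
           = mat (fps_nth F (Suc n)) ** (mat (of_real (1/c)) ** A1)) \<and>
      (\<forall>n. norm (mat_pow (mat 1 + mat (of_real (1/c)) ** A0) n) \<le> L * q ^ n) \<and>
      (\<forall>n J. (\<Sum>j<J. cmod (fps_nth (F ^ j) n)) \<le> K)"
proof -
  define U where "U = resolvent_set A0"
  have hol: "\<phi> holomorphic_on U" "open U" and lim: "(\<phi> \<longlongrightarrow> 0) at_infinity"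
    using char_fun_holomorphic[OF A1 char] open_resolvent_set by (auto simp: U_def)
  have half: "{z. 0 \<le> Re z} \<subseteq> U" using spec by (auto simp: spectrum_def U_def)
  have lt1: "cmod (\<phi> z) < 1" if "0 \<le> Re z" "z \<noteq> 0" for z
    using omega half that unfolding Omega_plus_def U_def by (smt (verit) Un_iff mem_Collect_eq singletonD subsetD)
  have real: "\<phi> (of_real s) \<in> \<real>" if "0 < s" for s
    using cm that by (auto simp: char_completely_monotonic_def)
  have cm': "completely_monotonic (\<lambda>s. Re (\<phi> (of_real s)))"
    using cm by (auto simp: char_completely_monotonic_def)
  have ge1: "1 \<le> cmod (\<phi> 0)" using zero by (simp add: Omega_plus_def)
  have lt1': "cmod (\<phi> (of_real s)) < 1" if "0 < s" for s using lt1[of "of_real s"] that by simp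
  show f0: "\<phi> 0 = 1" by (rule cm_rational_moments(1)[OF hol half real cm' rat lt1' ge1])
  obtain m s where ms: "0 < m" "m\<^sup>2 < s" "deriv \<phi> 0 = - of_real m" "(deriv ^^ 2) \<phi> 0 = of_real s"
    using cm_rational_moments(2)[OF hol half real cm' rat lt1' ge1] by blast
  have "\<exists>c0>0. \<forall>c\<ge>c0. \<exists>\<kappa>>0. \<forall>z. cmod (z + of_real c) = c \<longrightarrow> (cmod (\<phi> z))\<^sup>2 \<le> 1 - \<kappa> * (cmod z)\<^sup>2"
    by (rule circle_bound[OF hol _ _ lim f0 ms(3,4,1,2)]) (use half lt1 in auto)
  then obtain c1 where c1: "\<And>c. c1 \<le> c \<Longrightarrow> \<exists>\<kappa>>0. \<forall>z. cmod (z + of_real c) = c \<longrightarrow> (cmod (\<phi> z))\<^sup>2 \<le> 1 - \<kappa> * (cmod z)\<^sup>2"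
    by blast
  obtain c2 where c2: "0 < c2" "\<And>c. c2 \<le> c \<Longrightarrow> \<exists>\<rho>>1. \<forall>z. c < \<rho> * cmod (z + of_real c) \<longrightarrow> z \<in> U"
    using spectrum_in_disc[OF spec] unfolding U_def by blast
  define c where "c = max c1 c2"
  have c: "0 < c" using c2 by (simp add: c_def)
  obtain \<kappa> where \<kappa>: "0 < \<kappa>" "\<And>z. cmod (z + of_real c) = c \<Longrightarrow> (cmod (\<phi> z))\<^sup>2 \<le> 1 - \<kappa> * (cmod z)\<^sup>2"
    using c1[of c] by (auto simp: c_def)
  obtain \<rho> where \<rho>: "1 < \<rho>" "\<And>z. c < \<rho> * cmod (z + of_real c) \<Longrightarrow> z \<in> U"
    using c2(2)[of c] by (auto simp: c_def)
  define B where "B = mat 1 + mat (of_real (1/c)) ** A0"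
  define C where "C = mat (of_real (1/c)) ** A1"
  define pt where "pt w = of_real c * (1 / w - 1)" for w :: complex
  have pt: "pt w + of_real c = of_real c / w" for w by (simp add: pt_def algebra_simps)
  have ptU: "pt w \<in> U" if "w \<noteq> 0" "cmod w < \<rho>" for w
  proof (rule \<rho>(2))
    have "c < \<rho> * (c / cmod w)" using that c by (simp add: field_simps)
    then show "c < \<rho> * cmod (pt w + of_real c)" unfolding pt using c by (simp add: norm_divide)
  qed
  have cc: "complex_of_real c \<noteq> 0" using c by simp
  have Bc: "B = mat 1 + mat (1 / complex_of_real c) ** A0" by (simp add: B_def)
  have inv: "invertible (mat 1 - mat w ** B)" if "cmod w < \<rho>" for w
  proof (cases "w = 0")
    case True
    have "mat 1 - mat 0 ** B = mat 1" by (rule matrix_eqI) simp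
    then show ?thesis using True by (metis invertible_def matrix_mul_lid)
  next
    case False
    then show ?thesis using neumann_inverse_eq_resolvent(1)[OF False cc] ptU[OF False that] by (simp add: Bc U_def pt_def)
  qed
  define N where "N w = matrix_inv (mat 1 - mat w ** B)" for w
  have CNC: "mat w ** (C ** N w ** C) = mat (\<phi> (pt w)) ** C" if "w \<noteq> 0" "cmod w < \<rho>" for w
  proof -
    have pU: "pt w \<in> resolvent_set A0" using ptU[OF that] by (simp add: U_def)
    have N: "N w = mat (of_real c / w) ** resolvent (pt w) A0"
      using neumann_inverse_eq_resolvent(2)[OF that(1) cc, of A0] pU by (simp add: N_def Bc pt_def)
    have "A1 ** resolvent (pt w) A0 ** A1 = mat (\<phi> (pt w)) ** A1" using char pU by blast
    moreover have "mat w ** (C ** N w ** C) = mat (of_real (1/c)) ** (A1 ** resolvent (pt w) A0 ** A1)"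
      unfolding C_def N mat_mult_mult using that(1) c by (intro matrix_eqI) simp
    ultimately show ?thesis by (intro matrix_eqI) (simp add: C_def)
  qed
  have C: "C \<noteq> 0"
  proof -
    obtain i j where "A1 $ i $ j \<noteq> 0" using A1 by (auto simp: vec_eq_iff)
    then have "C $ i $ j \<noteq> 0" using c by (simp add: C_def)
    then show ?thesis by auto
  qed
  then obtain a b where ab: "C $ a $ b \<noteq> 0" by (auto simp: vec_eq_iff)
  have "0 < \<rho>" using \<rho> by simp
  note neu = neumann_has_fps_expansion[OF this inv, folded N_def]
  define H where "H i j w = (C ** N w ** C) $ i $ j" for i j w
  have H_alt: "H i j = (\<lambda>w. \<Sum>l\<in>UNIV. (\<Sum>k\<in>UNIV. C $ i $ k * N w $ k $ l) * C $ l $ j)" for i j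
    by (simp add: H_def fun_eq_iff matrix_matrix_mult_def)
  have H: "H i j has_fps_expansion Abs_fps (\<lambda>n. (C ** mat_pow B n ** C) $ i $ j)" for i j
  proof -
    have "H i j has_fps_expansion (\<Sum>l\<in>UNIV. (\<Sum>k\<in>UNIV. fps_const (C $ i $ k) * Abs_fps (\<lambda>n. mat_pow B n $ k $ l)) * fps_const (C $ l $ j))"
      unfolding H_alt by (intro fps_expansion_intros neu)
    also have "(\<Sum>l\<in>UNIV. (\<Sum>k\<in>UNIV. fps_const (C $ i $ k) * Abs_fps (\<lambda>n. mat_pow B n $ k $ l)) * fps_const (C $ l $ j))
       = Abs_fps (\<lambda>n. (C ** mat_pow B n ** C) $ i $ j)"
      by (simp add: fps_eq_iff fps_sum_nth matrix_matrix_mult_def)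
    finally show ?thesis .
  qed
  have holH: "H i j holomorphic_on ball 0 \<rho>" for i j
    unfolding H_alt by (intro holomorphic_intros neu)
  define G where "G w = w * (H a b w / C $ a $ b)" for w
  define F where "F = fps_X * (Abs_fps (\<lambda>n. (C ** mat_pow B n ** C) $ a $ b) * fps_const (1 / C $ a $ b))"
  have GF: "G has_fps_expansion F"
    unfolding G_def F_def divide_inverse by (simp, intro fps_expansion_intros H)
  have holG: "G holomorphic_on ball 0 \<rho>" unfolding G_def using ab by (intro holomorphic_intros holH) auto
  have G: "G w = \<phi> (pt w)" if "w \<noteq> 0" "cmod w < \<rho>" for w
    using arg_cong[OF CNC[OF that], of "\<lambda>M. M $ a $ b"] ab by (simp add: G_def H_def field_simps)
  have HG: "w * H i j w = G w * C $ i $ j" if "cmod w < \<rho>" for i j w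
  proof (cases "w = 0")
    case False
    then show ?thesis using arg_cong[OF CNC[OF False that], of "\<lambda>M. M $ i $ j"] G[OF False that] by (simp add: H_def)
  qed (simp add: G_def)
  have coeffs: "C ** mat_pow B n ** C = mat (fps_nth F (Suc n)) ** C" for n
  proof (rule matrix_eqI)
    fix i j
    have ev: "\<forall>\<^sub>F w in nhds 0. w * H i j w = G w * C $ i $ j"
    proof -
      have "\<forall>\<^sub>F w in nhds 0. w \<in> ball (0::complex) \<rho>" using \<rho> by (intro eventually_nhds_in_open) auto
      then show ?thesis by eventually_elim (simp add: HG)
    qed
    have "(\<lambda>w. w * H i j w) has_fps_expansion fps_X * Abs_fps (\<lambda>n. (C ** mat_pow B n ** C) $ i $ j)"
      by (intro fps_expansion_intros H)
    then have "(\<lambda>w. G w * C $ i $ j) has_fps_expansion fps_X * Abs_fps (\<lambda>n. (C ** mat_pow B n ** C) $ i $ j)"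
      using has_fps_expansion_cong[OF ev refl] by blast
    moreover have "(\<lambda>w. G w * C $ i $ j) has_fps_expansion F * fps_const (C $ i $ j)"
      by (intro fps_expansion_intros GF)
    ultimately have "fps_X * Abs_fps (\<lambda>n. (C ** mat_pow B n ** C) $ i $ j) = F * fps_const (C $ i $ j)"
      by (rule fps_expansion_unique_complex)
    then have "fps_nth (fps_X * Abs_fps (\<lambda>n. (C ** mat_pow B n ** C) $ i $ j)) (Suc n) = fps_nth (F * fps_const (C $ i $ j)) (Suc n)"
      by simp
    then show "(C ** mat_pow B n ** C) $ i $ j = (mat (fps_nth F (Suc n)) ** C) $ i $ j" by simp
  qed
  have "\<exists>K. \<forall>n J. (\<Sum>j<J. cmod (fps_nth (F ^ j) n)) \<le> K"
  proof (rule fps_power_coeffs_bounded[OF GF holG \<rho>(1)])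
    show "G 1 = 1" using G[of 1] \<rho> f0 by (simp add: pt_def)
    have "(\<phi> has_field_derivative deriv \<phi> 0) (at 0)"
      using half by (intro holomorphic_derivI[OF hol]) auto
    then have "(\<phi> has_field_derivative deriv \<phi> 0) (at (pt 1))" by (simp add: pt_def)
    moreover have "(pt has_field_derivative of_real c * (- 1)) (at 1)"
      unfolding pt_def by (auto intro!: derivative_eq_intros)
    ultimately have "((\<lambda>w. \<phi> (pt w)) has_field_derivative deriv \<phi> 0 * (of_real c * (- 1))) (at 1)"
      by (rule DERIV_chain2)
    moreover have ev: "\<forall>\<^sub>F w in nhds 1. G w = \<phi> (pt w)"
    proof -
      have "\<forall>\<^sub>F w in nhds 1. w \<in> ball (0::complex) \<rho> - {0}" using \<rho> by (intro eventually_nhds_in_open) auto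
      then show ?thesis by eventually_elim (simp add: G)
    qed
    ultimately have "(G has_field_derivative deriv \<phi> 0 * (of_real c * (- 1))) (at 1)"
      by (subst DERIV_cong_ev[OF refl ev refl])
    then show "deriv G 1 = of_real (m * c)" using ms(3) by (simp add: DERIV_imp_deriv)
    show "0 < m * c" using ms c by simp
    show "0 < \<kappa> * c\<^sup>2" using \<kappa> c by simp
    fix w :: complex assume w: "cmod w = 1"
    then have w0: "w \<noteq> 0" by auto
    have "cmod (pt w + of_real c) = c" unfolding pt using w c by (simp add: norm_divide)
    then have "(cmod (\<phi> (pt w)))\<^sup>2 \<le> 1 - \<kappa> * (cmod (pt w))\<^sup>2" by (rule \<kappa>(2))
    moreover have "pt w = of_real c * ((1 - w) / w)" using w0 by (simp add: pt_def field_simps)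
    then have "cmod (pt w) = c * cmod (w - 1)" using w c by (simp add: norm_mult norm_divide norm_minus_commute)
    ultimately show "(cmod (G w))\<^sup>2 \<le> 1 - \<kappa> * c\<^sup>2 * (cmod (w - 1))\<^sup>2"
      using G[OF w0] w \<rho> by (simp add: power_mult_distrib mult.assoc)
  qed
  then obtain K where K: "\<forall>n J. (\<Sum>j<J. cmod (fps_nth (F ^ j) n)) \<le> K" by blast
  obtain L q where Lq: "0 < q" "q < 1" "\<forall>n. norm (mat_pow B n) \<le> L * q ^ n"
    using mat_pow_decay[OF \<rho>(1) inv] by blast
  have F0: "fps_nth F 0 = 0" by (simp add: F_def)
  show "\<exists>c>0. \<exists>F :: complex fps. \<exists>K L q. 0 < q \<and> q < 1 \<and> fps_nth F 0 = 0 \<and>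
      (\<forall>n. (mat (of_real (1/c)) ** A1) ** mat_pow (mat 1 + mat (of_real (1/c)) ** A0) n ** (mat (of_real (1/c)) ** A1)
           = mat (fps_nth F (Suc n)) ** (mat (of_real (1/c)) ** A1)) \<and>
      (\<forall>n. norm (mat_pow (mat 1 + mat (of_real (1/c)) ** A0) n) \<le> L * q ^ n) \<and>
      (\<forall>n J. (\<Sum>j<J. cmod (fps_nth (F ^ j) n)) \<le> K)"
    by (rule exI[of _ c], intro conjI exI[of _ F] exI[of _ K] exI[of _ L] exI[of _ q] allI c Lq(1,2) F0
        coeffs[unfolded B_def C_def] Lq(3)[unfolded B_def, rule_format] K[rule_format])
qed

section \<open>Power boundedness of the discretised system\<close>

lemma matrix_mult_sum_right: "A ** (\<Sum>i\<in>I. f i) = (\<Sum>i\<in>I. A ** (f i :: complex^'k^'n))"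
  by (rule matrix_eqI) (simp add: matrix_matrix_mult_def sum_distrib_left sum.swap[of _ I])

lemma matrix_vector_mult_sum_right: "A *v (\<Sum>i\<in>I. f i) = (\<Sum>i\<in>I. A *v (f i :: complex^'n))"
  by (simp add: vec_eq_iff matrix_vector_mult_def sum_distrib_left sum.swap[of _ I])

definition disc_op :: "complex^'m^'m \<Rightarrow> complex^'m^'m \<Rightarrow> 'm::finite cseq \<Rightarrow> 'm cseq" where
  "disc_op B C x = (\<lambda>k. B *v x k + C *v right_shift x k)"

lemma disc_op_apply: "disc_op B C x k = B *v x k + C *v right_shift x k"
  by (simp add: disc_op_def)

text \<open>\<open>disc_ker B C n j\<close> is the coefficient of the \<open>j\<close>-fold shift in the \<open>n\<close>-th power of \<^term>\<open>disc_op B C\<close>.\<close>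

primrec disc_ker :: "complex^'m^'m \<Rightarrow> complex^'m^'m \<Rightarrow> nat \<Rightarrow> nat \<Rightarrow> complex^'m^'m" where
  "disc_ker B C 0 j = (if j = 0 then mat 1 else 0)"
| "disc_ker B C (Suc n) j = B ** disc_ker B C n j + (case j of 0 \<Rightarrow> 0 | Suc i \<Rightarrow> C ** disc_ker B C n i)"

lemma disc_op_funpow:
  "(disc_op B C ^^ n) x k = (\<Sum>j\<le>k. disc_ker B C n j *v x (k - j))"
proof (induction n arbitrary: k)
  case 0
  have "(\<Sum>j\<le>k. disc_ker B C 0 j *v x (k - j)) = (\<Sum>j\<in>{0}. disc_ker B C 0 j *v x (k - j))"
    by (intro sum.mono_neutral_right) auto
  then show ?case by simp
next
  case (Suc n)
  have step: "(disc_op B C ^^ Suc n) x k = B *v ((disc_op B C ^^ n) x k) + C *v right_shift ((disc_op B C ^^ n) x) k"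
    unfolding funpow.simps comp_apply by (rule disc_op_apply)
  show ?case
  proof (cases k)
    case 0
    then show ?thesis unfolding step by (simp add: Suc matrix_vector_mul_assoc)
  next
    case k: (Suc k')
    have "(\<Sum>j\<le>k. disc_ker B C (Suc n) j *v x (k - j))
        = (\<Sum>j\<le>k. B *v (disc_ker B C n j *v x (k - j)))
          + (\<Sum>j\<le>k. (case j of 0 \<Rightarrow> 0 | Suc i \<Rightarrow> C ** disc_ker B C n i) *v x (k - j))"
      by (simp add: matrix_vector_mult_add_rdistrib sum.distrib matrix_vector_mul_assoc)
    also have "(\<Sum>j\<le>k. (case j of 0 \<Rightarrow> 0 | Suc i \<Rightarrow> C ** disc_ker B C n i) *v x (k - j))
        = (\<Sum>j\<le>k'. C *v (disc_ker B C n j *v x (k' - j)))"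
      unfolding k sum.atMost_Suc_shift by (simp add: matrix_vector_mul_assoc)
    finally have "(\<Sum>j\<le>k. disc_ker B C (Suc n) j *v x (k - j)) = (\<Sum>j\<le>k. B *v (disc_ker B C n j *v x (k - j)))
        + (\<Sum>j\<le>k'. C *v (disc_ker B C n j *v x (k' - j)))" .
    moreover have "B *v ((disc_op B C ^^ n) x k) = (\<Sum>j\<le>k. B *v (disc_ker B C n j *v x (k - j)))"
      by (simp only: Suc matrix_vector_mult_sum_right)
    moreover have "C *v right_shift ((disc_op B C ^^ n) x) k = (\<Sum>j\<le>k'. C *v (disc_ker B C n j *v x (k' - j)))"
      by (simp only: k right_shift_simps Suc matrix_vector_mult_sum_right)
    ultimately show ?thesis by (simp only: step)
  qed
qed

lemma disc_ker_diagonal: "disc_ker B C n 0 = mat_pow B n"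
  by (induction n) auto

text \<open>Decomposition at the time of the last step of the walk.\<close>

lemma disc_ker_duhamel:
  "disc_ker B C n (Suc j) = (\<Sum>i<n. mat_pow B (n - Suc i) ** (C ** disc_ker B C i j))"
proof (induction n)
  case (Suc n)
  have "(\<Sum>i<n. mat_pow B (Suc n - Suc i) ** (C ** disc_ker B C i j))
      = (\<Sum>i<n. B ** (mat_pow B (n - Suc i) ** (C ** disc_ker B C i j)))"
  proof (rule sum.cong)
    fix i assume "i \<in> {..<n}"
    then have "Suc n - Suc i = Suc (n - Suc i)" by auto
    then show "mat_pow B (Suc n - Suc i) ** (C ** disc_ker B C i j) = B ** (mat_pow B (n - Suc i) ** (C ** disc_ker B C i j))"
      by (simp only: mat_pow.simps matrix_mul_assoc)
  qed simp
  then show ?case by (simp add: Suc matrix_mult_sum_right)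
qed simp

text \<open>The renewal equation: every further transition convolves with \<open>F\<close>.\<close>

lemma disc_ker_entry_fps:
  fixes B C :: "complex^'m^'m"
  assumes F0: "fps_nth F 0 = 0" and F: "\<And>n. C ** mat_pow B n ** C = mat (fps_nth F (Suc n)) ** C"
  shows "Abs_fps (\<lambda>n. (C ** disc_ker B C n j) $ a $ b) = Abs_fps (\<lambda>n. (C ** mat_pow B n) $ a $ b) * F ^ j"
proof (induction j)
  case (Suc j)
  have "Abs_fps (\<lambda>n. (C ** disc_ker B C n (Suc j)) $ a $ b) = Abs_fps (\<lambda>n. (C ** disc_ker B C n j) $ a $ b) * F"
  proof (rule fps_ext)
    fix n
    have "C ** disc_ker B C n (Suc j) = (\<Sum>i<n. mat (fps_nth F (n - i)) ** (C ** disc_ker B C i j))"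
      unfolding disc_ker_duhamel matrix_mult_sum_right
    proof (rule sum.cong)
      fix i assume "i \<in> {..<n}"
      then have "Suc (n - Suc i) = n - i" by auto
      then show "C ** (mat_pow B (n - Suc i) ** (C ** disc_ker B C i j)) = mat (fps_nth F (n - i)) ** (C ** disc_ker B C i j)"
        using F[of "n - Suc i"] by (metis matrix_mul_assoc)
    qed simp
    then have "(C ** disc_ker B C n (Suc j)) $ a $ b = (\<Sum>i<n. fps_nth F (n - i) * (C ** disc_ker B C i j) $ a $ b)"
      by simp
    also have "\<dots> = (\<Sum>i=0..n. (C ** disc_ker B C i j) $ a $ b * fps_nth F (n - i))"
      by (rule sum.mono_neutral_cong_left) (use F0 in \<open>auto simp: not_less\<close>)
    finally show "fps_nth (Abs_fps (\<lambda>n. (C ** disc_ker B C n (Suc j)) $ a $ b)) n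
       = fps_nth (Abs_fps (\<lambda>n. (C ** disc_ker B C n j) $ a $ b) * F) n"
      by (simp add: fps_mult_nth)
  qed
  then show ?case by (simp add: Suc mult_ac)
qed (simp add: disc_ker_diagonal)

lemma norm_le_sum_entries: "norm A \<le> (\<Sum>a\<in>UNIV. \<Sum>b\<in>UNIV. cmod (A $ a $ b))" for A :: "complex^'n^'m"
proof -
  have "norm A \<le> (\<Sum>a\<in>UNIV. norm (A $ a))"
    unfolding norm_vec_def[of A] by (rule L2_set_le_sum) simp
  also have "\<dots> \<le> (\<Sum>a\<in>UNIV. \<Sum>b\<in>UNIV. cmod (A $ a $ b))"
    unfolding norm_vec_def by (intro sum_mono L2_set_le_sum) simp
  finally show ?thesis .
qed

lemma sum_geometric_le:
  fixes q :: real
  assumes "0 < q" "q < 1"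
  shows "(\<Sum>i<n. q ^ i) \<le> 1 / (1 - q)"
  using assms sum_le_suminf[OF summable_geometric[of q], of "{..<n}"] suminf_geometric[of q] by auto

text \<open>Summed over \<open>j\<close> first, the powers of \<open>F\<close> contribute at most \<open>K\<close> at every time; the remaining sums, over the
  first and the last waiting time, are geometric.\<close>

lemma disc_ker_summable:
  fixes B C :: "complex^'m^'m"
  assumes q: "0 < q" "q < 1" and F0: "fps_nth F 0 = 0"
    and F: "\<And>n. C ** mat_pow B n ** C = mat (fps_nth F (Suc n)) ** C"
    and B: "\<And>n. norm (mat_pow B n) \<le> L * q ^ n"
    and K: "\<And>n J. (\<Sum>j<J. cmod (fps_nth (F ^ j) n)) \<le> K"
  shows "\<exists>M. \<forall>n J. (\<Sum>j<J. norm (disc_ker B C n j)) \<le> M"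
proof -
  have L: "0 \<le> L" using order_trans[OF norm_ge_zero B[of 0]] by simp
  have K0: "0 \<le> K" using K[of 0 0] by simp
  have conv: "(\<Sum>i<n. q ^ (n - Suc i)) \<le> 1 / (1 - q)" for n
    using sum_geometric_le[OF q, of n] by (subst sum.nat_diff_reindex) 
  define W where "W = norm C * L * K * (1 / (1 - q))"
  have entry: "(\<Sum>j<J. cmod ((C ** disc_ker B C n j) $ a $ b)) \<le> W" for n J a b
  proof -
    have CB: "cmod ((C ** mat_pow B i) $ a $ b) \<le> norm C * L * q ^ i" for i
    proof -
      have "cmod ((C ** mat_pow B i) $ a $ b) \<le> norm (C ** mat_pow B i)" by (rule norm_mult_entry_le)
      also have "\<dots> \<le> norm C * norm (mat_pow B i)" by (rule norm_matrix_matrix_mult_le)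
      also have "\<dots> \<le> norm C * (L * q ^ i)" by (intro mult_left_mono B) simp
      finally show ?thesis by (simp add: mult.assoc)
    qed
    have "cmod ((C ** disc_ker B C n j) $ a $ b) \<le> (\<Sum>i=0..n. norm C * L * q ^ i * cmod (fps_nth (F ^ j) (n - i)))" for j
    proof -
      have "(C ** disc_ker B C n j) $ a $ b = (\<Sum>i=0..n. (C ** mat_pow B i) $ a $ b * fps_nth (F ^ j) (n - i))"
        using arg_cong[OF disc_ker_entry_fps[OF F0 F], of "\<lambda>G. fps_nth G n" j a b] by (simp add: fps_mult_nth)
      also have "cmod \<dots> \<le> (\<Sum>i=0..n. norm C * L * q ^ i * cmod (fps_nth (F ^ j) (n - i)))"
        by (intro sum_norm_le) (auto simp: norm_mult intro!: mult_right_mono CB)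
      finally show ?thesis .
    qed
    then have "(\<Sum>j<J. cmod ((C ** disc_ker B C n j) $ a $ b)) \<le> (\<Sum>j<J. \<Sum>i=0..n. norm C * L * q ^ i * cmod (fps_nth (F ^ j) (n - i)))"
      by (intro sum_mono)
    also have "\<dots> = (\<Sum>i=0..n. norm C * L * q ^ i * (\<Sum>j<J. cmod (fps_nth (F ^ j) (n - i))))"
      by (subst sum.swap) (simp add: sum_distrib_left)
    also have "\<dots> \<le> (\<Sum>i=0..n. norm C * L * q ^ i * K)"
      using L q by (intro sum_mono mult_left_mono K) auto
    also have "\<dots> = norm C * L * K * (\<Sum>i<Suc n. q ^ i)"
      by (simp add: sum_distrib_left mult_ac atLeast0AtMost lessThan_Suc_atMost del: sum.lessThan_Suc)
    also have "\<dots> \<le> W" unfolding W_def using L K0 by (intro mult_left_mono sum_geometric_le q) auto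
    finally show ?thesis .
  qed
  define V where "V = (\<Sum>a\<in>(UNIV::'m set). \<Sum>b\<in>(UNIV::'m set). W)"
  have V: "(\<Sum>j<J. norm (C ** disc_ker B C n j)) \<le> V" for n J
  proof -
    have "(\<Sum>j<J. norm (C ** disc_ker B C n j)) \<le> (\<Sum>j<J. \<Sum>a\<in>UNIV. \<Sum>b\<in>UNIV. cmod ((C ** disc_ker B C n j) $ a $ b))"
      by (intro sum_mono norm_le_sum_entries)
    also have "\<dots> = (\<Sum>a\<in>UNIV. \<Sum>b\<in>UNIV. \<Sum>j<J. cmod ((C ** disc_ker B C n j) $ a $ b))"
      by (simp add: sum.swap[of _ _ "{..<J}"])
    also have "\<dots> \<le> V" unfolding V_def by (intro sum_mono entry)
    finally show ?thesis .
  qed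
  have V0: "0 \<le> V" using V[of 0 0] by simp
  have "(\<Sum>j<J. norm (disc_ker B C n j)) \<le> L + L * (1 / (1 - q)) * V" for n J
  proof -
    have "norm (disc_ker B C n 0) \<le> L"
    proof -
      have "norm (disc_ker B C n 0) \<le> L * q ^ n" unfolding disc_ker_diagonal by (rule B)
      also have "\<dots> \<le> L" using q L by (simp add: mult_left_le power_le_one)
      finally show ?thesis .
    qed
    moreover have "(\<Sum>j<J. norm (disc_ker B C n (Suc j))) \<le> L * (1 / (1 - q)) * V" for J
    proof -
      have "norm (disc_ker B C n (Suc j)) \<le> (\<Sum>i<n. L * q ^ (n - Suc i) * norm (C ** disc_ker B C i j))" for j
        unfolding disc_ker_duhamel
      proof (rule sum_norm_le)
        fix i
        have "norm (mat_pow B (n - Suc i) ** (C ** disc_ker B C i j)) \<le> norm (mat_pow B (n - Suc i)) * norm (C ** disc_ker B C i j)"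
          by (rule norm_matrix_matrix_mult_le)
        also have "\<dots> \<le> L * q ^ (n - Suc i) * norm (C ** disc_ker B C i j)"
          by (intro mult_right_mono B) simp
        finally show "norm (mat_pow B (n - Suc i) ** (C ** disc_ker B C i j)) \<le> L * q ^ (n - Suc i) * norm (C ** disc_ker B C i j)" .
      qed
      then have "(\<Sum>j<J. norm (disc_ker B C n (Suc j))) \<le> (\<Sum>j<J. \<Sum>i<n. L * q ^ (n - Suc i) * norm (C ** disc_ker B C i j))"
        by (intro sum_mono)
      also have "\<dots> = (\<Sum>i<n. L * q ^ (n - Suc i) * (\<Sum>j<J. norm (C ** disc_ker B C i j)))"
        by (subst sum.swap) (simp add: sum_distrib_left)
      also have "\<dots> \<le> (\<Sum>i<n. L * q ^ (n - Suc i) * V)"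
        using L q by (intro sum_mono mult_left_mono V) auto
      also have "\<dots> = L * (\<Sum>i<n. q ^ (n - Suc i)) * V"
        by (simp add: sum_distrib_left sum_distrib_right)
      also have "\<dots> \<le> L * (1 / (1 - q)) * V" using L V0 by (intro mult_right_mono mult_left_mono conv) auto
      finally show ?thesis .
    qed
    ultimately have *: "(\<Sum>j<Suc J. norm (disc_ker B C n j)) \<le> L + L * (1 / (1 - q)) * V"
      unfolding sum.lessThan_Suc_shift by (intro add_mono) auto
    have "(\<Sum>j<J. norm (disc_ker B C n j)) \<le> (\<Sum>j<Suc J. norm (disc_ker B C n j))" by simp
    then show ?thesis using * by linarith
  qed
  then show ?thesis by blast
qed

text \<open>Shifts do not increase norms, so summable kernels give operators that are bounded in the same way on
  every sequence space.\<close>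

lemma disc_op_power_bounded:
  assumes p: "1 \<le> p" and M: "\<And>n J. (\<Sum>j<J. norm (disc_ker B C n j)) \<le> M" and x: "lp_le p x D"
  shows "lp_le p ((disc_op B C ^^ n) x) (M * D)"
proof (rule lp_le_limit[OF p])
  let ?X = "\<lambda>J k. \<Sum>j<J. disc_ker B C n j *v (right_shift ^^ j) x k"
  show "((\<lambda>J. ?X J k) \<longlongrightarrow> (disc_op B C ^^ n) x k) sequentially" for k
  proof (rule tendsto_eventually)
    show "\<forall>\<^sub>F J in sequentially. ?X J k = (disc_op B C ^^ n) x k"
      using eventually_gt_at_top[of k]
    proof eventually_elim
      case (elim J)
      have "?X J k = (\<Sum>j\<le>k. disc_ker B C n j *v x (k - j))"
        using elim by (intro sum.mono_neutral_cong_right) (auto simp: right_shift_funpow)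
      then show ?case by (simp add: disc_op_funpow)
    qed
  qed
  have "lp_le p (?X J) (M * D)" for J
  proof -
    have "lp_le p (?X J) (\<Sum>j<J. norm (disc_ker B C n j) * D)"
    proof (rule lp_le_sum[OF p])
      show "lp_le p (\<lambda>k. disc_ker B C n j *v (right_shift ^^ j) x k) (norm (disc_ker B C n j) * D)" for j
        by (rule lp_le_dominated[OF lp_le_shift_funpow[OF p x, of j] norm_matrix_vector_mult_le _ p]) simp
    qed simp
    moreover have "(\<Sum>j<J. norm (disc_ker B C n j) * D) \<le> M * D"
      unfolding sum_distrib_right[symmetric] using lp_le_nonneg[OF x] by (intro mult_right_mono M)
    ultimately show ?thesis using lp_le_mono p by blast
  qed
  then show "\<forall>\<^sub>F J in sequentially. lp_le p (?X J) (M * D)" by simp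
qed simp

section \<open>Uniform boundedness and the generated semigroup\<close>

lemma of_real_smult: "of_real a *s v = a *\<^sub>R (v :: complex^'m)"
  by (simp add: vec_eq_iff scaleR_conv_of_real[where 'a = complex])

lemma lp_bounded_linear_closed:
  "lp_bounded_linear p B \<Longrightarrow> x \<in> lp_space p \<Longrightarrow> B x \<in> lp_space p"
  by (simp add: lp_bounded_linear_def)

lemma lp_bounded_linear_add:
  "lp_bounded_linear p B \<Longrightarrow> x \<in> lp_space p \<Longrightarrow> y \<in> lp_space p \<Longrightarrow> B (\<lambda>k. x k + y k) = (\<lambda>k. B x k + B y k)"
  by (simp add: lp_bounded_linear_def)

lemma lp_bounded_linear_scaleR:
  "lp_bounded_linear p B \<Longrightarrow> x \<in> lp_space p \<Longrightarrow> B (\<lambda>k. a *\<^sub>R x k) = (\<lambda>k. a *\<^sub>R B x k)"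
  unfolding of_real_smult[symmetric] by (simp add: lp_bounded_linear_def)

lemma lp_space_scaleR: "1 \<le> p \<Longrightarrow> x \<in> lp_space p \<Longrightarrow> (\<lambda>k. a *\<^sub>R x k) \<in> lp_space p"
  using lp_le_scaleR lp_le_iff lp_space_iff_lp_le by metis

lemma lp_space_add: "1 \<le> p \<Longrightarrow> x \<in> lp_space p \<Longrightarrow> y \<in> lp_space p \<Longrightarrow> (\<lambda>k. x k + y k) \<in> lp_space p"
  using lp_le_add lp_le_iff lp_space_iff_lp_le by metis

lemma lp_space_diff: "1 \<le> p \<Longrightarrow> x \<in> lp_space p \<Longrightarrow> y \<in> lp_space p \<Longrightarrow> (\<lambda>k. x k - y k) \<in> lp_space p"
  using lp_le_diff lp_le_iff lp_space_iff_lp_le by metis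

lemma lp_bounded_linear_diff:
  assumes "1 \<le> p" "lp_bounded_linear p B" "x \<in> lp_space p" "y \<in> lp_space p"
  shows "B (\<lambda>k. x k - y k) = (\<lambda>k. B x k - B y k)"
proof -
  have "B (\<lambda>k. x k + (-1) *\<^sub>R y k) = (\<lambda>k. B x k + B (\<lambda>k. (-1) *\<^sub>R y k) k)"
    using assms by (intro lp_bounded_linear_add lp_space_scaleR)
  then show ?thesis using lp_bounded_linear_scaleR[OF assms(2,4), of "-1"] by simp
qed

lemma lp_bounded_linear_bound:
  assumes "1 \<le> p" "lp_bounded_linear p B"
  shows "\<exists>C\<ge>0. \<forall>x D. lp_le p x D \<longrightarrow> lp_le p (B x) (C * D)"
proof -
  obtain C where C: "\<And>x. x \<in> lp_space p \<Longrightarrow> lp_norm p (B x) \<le> C * lp_norm p x"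
    using assms(2) unfolding lp_bounded_linear_def by blast
  have "lp_le p (B x) (\<bar>C\<bar> * D)" if "lp_le p x D" for x D
  proof -
    have x: "x \<in> lp_space p" "lp_norm p x \<le> D" using that assms(1) by (auto simp: lp_le_iff)
    have "lp_norm p (B x) \<le> \<bar>C\<bar> * lp_norm p x"
      using C[OF x(1)] lp_norm_nonneg[OF assms(1) x(1)] by (smt (verit) mult_right_mono)
    also have "\<dots> \<le> \<bar>C\<bar> * D" using x by (intro mult_left_mono) auto
    finally show ?thesis using lp_bounded_linear_closed[OF assms(2) x(1)] assms(1) by (simp add: lp_le_iff)
  qed
  then show ?thesis by (intro exI[of _ "\<bar>C\<bar>"]) auto
qed

text \<open>The uniform boundedness principle by nested balls: \<open>y (Suc k)\<close> lies so close to \<open>y k\<close> that the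
  largeness of an earlier operator at \<open>y (Suc k)\<close> is not lost in the limit.\<close>

lemma lp_uniform_boundedness:
  fixes T :: "nat \<Rightarrow> 'm::finite cseq \<Rightarrow> 'm cseq"
  assumes p: "1 \<le> p" and T: "\<And>n. lp_bounded_linear p (T n)"
    and bdd: "\<And>x. x \<in> lp_space p \<Longrightarrow> \<exists>C. \<forall>n. lp_le p (T n x) C"
  shows "\<exists>M\<ge>0. \<forall>n x D. lp_le p x D \<longrightarrow> lp_le p (T n x) (M * D)"
proof (rule ccontr)
  assume no: "\<not> ?thesis"
  have step: "\<exists>n u. lp_le p u r \<and> \<not> lp_le p (T n (\<lambda>k. y k + u k)) K"
    if y: "y \<in> lp_space p" and r: "0 < r" for y K r
  proof (rule ccontr)
    assume none: "\<not> ?thesis"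
    obtain Cy where Cy: "\<And>n. lp_le p (T n y) Cy" using bdd[OF y] by blast
    have Cy0: "0 \<le> Cy" using Cy lp_le_nonneg by blast
    have small: "lp_le p (T n u) (\<bar>K\<bar> + Cy)" if "lp_le p u r" for n u
    proof -
      have u: "u \<in> lp_space p" using that p lp_le_iff by blast
      have "lp_le p (T n (\<lambda>k. y k + u k)) K" using none that by blast
      then have "lp_le p (T n (\<lambda>k. y k + u k)) \<bar>K\<bar>" by (rule lp_le_mono) (use p in auto)
      then have "lp_le p (\<lambda>k. T n (\<lambda>k. y k + u k) k - T n y k) (\<bar>K\<bar> + Cy)"
        by (intro lp_le_diff p Cy)
      then show ?thesis by (simp add: lp_bounded_linear_add[OF T y u])
    qed
    have "lp_le p (T n x) ((\<bar>K\<bar> + Cy) / r * D)" if x: "lp_le p x D" for n x D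
    proof (cases "D = 0")
      case True
      have "x k = 0" for k using lp_le_coord[OF p x, of k] True by simp
      then have "x = (\<lambda>k. 0 *\<^sub>R x k)" by auto
      then have "T n x = (\<lambda>k. 0 *\<^sub>R T n x k)" using lp_bounded_linear_scaleR[OF T, of x n 0] x p lp_le_iff by metis
      then have "T n x = (\<lambda>k. 0)" by simp
      then show ?thesis using True lp_le_zero by simp
    next
      case False
      then have D: "0 < D" using lp_le_nonneg[OF x] by simp
      have xs: "x \<in> lp_space p" using x p lp_le_iff by blast
      have "lp_le p (\<lambda>k. (r / D) *\<^sub>R x k) (\<bar>r / D\<bar> * D)" by (rule lp_le_scaleR[OF p x])
      then have "lp_le p (\<lambda>k. (r / D) *\<^sub>R x k) r" using D r by simp
      then have "lp_le p (\<lambda>k. (r / D) *\<^sub>R T n x k) (\<bar>K\<bar> + Cy)"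
        using small lp_bounded_linear_scaleR[OF T xs] by metis
      then have "lp_le p (\<lambda>k. (D / r) *\<^sub>R ((r / D) *\<^sub>R T n x k)) (\<bar>D / r\<bar> * (\<bar>K\<bar> + Cy))"
        by (rule lp_le_scaleR[OF p])
      then show ?thesis using D r by (simp add: mult.commute)
    qed
    moreover have "0 \<le> (\<bar>K\<bar> + Cy) / r" using Cy0 r by simp
    ultimately show False using no by blast
  qed
  define P where "P = (\<lambda>(y :: 'm cseq, r :: real, n :: nat). y \<in> lp_space p \<and> 0 < r \<and> r \<le> 1)"
  define R where "R = (\<lambda>k (y, r :: real, n :: nat) (y', r', n').
     lp_le p (\<lambda>j. y' j - y j) r \<and> r' \<le> r / 2 \<and> \<not> lp_le p (T n' y') (real k + 1) \<and>
     (\<forall>w. lp_le p w (2 * r') \<longrightarrow> lp_le p (T n' w) 1))"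
  have "\<exists>f. \<forall>k. P (f k) \<and> R k (f k) (f (Suc k))"
  proof (rule dependent_nat_choice)
    show "\<exists>x. P x" unfolding P_def using lp_le_zero lp_le_iff[OF p] by (intro exI[of _ "(\<lambda>k. 0, 1, 0)"]) auto
    fix x k assume "P x"
    then obtain y r n where x: "x = (y, r, n)" and y: "y \<in> lp_space p" "0 < r" "r \<le> 1"
      by (auto simp: P_def)
    obtain n' u where u: "lp_le p u r" "\<not> lp_le p (T n' (\<lambda>j. y j + u j)) (real k + 1)"
      using step[OF y(1,2)] by blast
    obtain C where C: "0 \<le> C" "\<And>w D. lp_le p w D \<Longrightarrow> lp_le p (T n' w) (C * D)"
      using lp_bounded_linear_bound[OF p T, of n'] by blast
    define r' where "r' = r / (2 * (1 + C))"
    have r': "0 < r'" "r' \<le> r / 2" "2 * r' * C \<le> 1"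
    proof -
      show "0 < r'" using y C by (simp add: r'_def)
      show "r' \<le> r / 2" unfolding r'_def using y C by (intro divide_left_mono) auto
      have "2 * r' * C = r * (C / (1 + C))" using C by (simp add: r'_def field_simps)
      also have "\<dots> \<le> 1 * 1" using y C by (intro mult_mono) (auto simp: field_simps)
      finally show "2 * r' * C \<le> 1" by simp
    qed
    have us: "u \<in> lp_space p" using u(1) p lp_le_iff by blast
    have "P (\<lambda>j. y j + u j, r', n')" unfolding P_def using y r' lp_space_add[OF p y(1) us] by auto
    moreover have "R k x (\<lambda>j. y j + u j, r', n')"
    proof -
      have "lp_le p (T n' w) 1" if "lp_le p w (2 * r')" for w
        by (rule lp_le_mono[OF C(2)[OF that] _ p]) (use r'(3) in \<open>simp add: mult_ac\<close>)
      then show ?thesis unfolding R_def x using u r' by auto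
    qed
    ultimately show "\<exists>y. P y \<and> R k x y" by blast
  qed
  then obtain f where f: "\<And>k. P (f k)" "\<And>k. R k (f k) (f (Suc k))" by blast
  define y where "y k = fst (f k)" for k
  define r where "r k = fst (snd (f k))" for k
  define n where "n k = snd (snd (f k))" for k
  have yl: "y k \<in> lp_space p" and r0: "0 < r k" and r1: "r k \<le> 1" for k
    using f(1)[of k] by (auto simp: P_def y_def r_def split: prod.splits)
  have yr: "lp_le p (\<lambda>j. y (Suc k) j - y k j) (r k)" and rr: "r (Suc k) \<le> r k / 2"
    and big: "\<not> lp_le p (T (n (Suc k)) (y (Suc k))) (real k + 1)"
    and sm: "lp_le p w (2 * r (Suc k)) \<Longrightarrow> lp_le p (T (n (Suc k)) w) 1" for k w
    using f(2)[of k] by (auto simp: R_def y_def r_def n_def split: prod.splits)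
  have close: "lp_le p (\<lambda>j. y (k + i) j - y k j) (2 * r k - 2 * r (k + i))" for k i
  proof (induction i)
    case 0
    then show ?case by (simp add: lp_le_zero)
  next
    case (Suc i)
    have "lp_le p (\<lambda>j. (y (k + i) j - y k j) + (y (Suc (k + i)) j - y (k + i) j)) ((2 * r k - 2 * r (k + i)) + r (k + i))"
      by (rule lp_le_add[OF p Suc yr])
    moreover have "(\<lambda>j. (y (k + i) j - y k j) + (y (Suc (k + i)) j - y (k + i) j)) = (\<lambda>j. y (k + Suc i) j - y k j)"
      by simp
    ultimately have "lp_le p (\<lambda>j. y (k + Suc i) j - y k j) ((2 * r k - 2 * r (k + i)) + r (k + i))"
      by (simp only:)
    then show ?case by (rule lp_le_mono[OF _ _ p]) (use rr[of "k + i"] in auto)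
  qed
  have rgeo: "r k \<le> (1/2) ^ k" for k
  proof (induction k)
    case 0 show ?case using r1[of 0] by simp
  next
    case (Suc k) then show ?case using rr[of k] by simp
  qed
  have "convergent (\<lambda>k. y k j)" for j
  proof -
    have "summable (\<lambda>k. y (Suc k) j - y k j)"
    proof (rule summable_comparison_test')
      show "summable (\<lambda>k. (1/2::real) ^ k)" by (rule summable_geometric) simp
      show "norm (y (Suc k) j - y k j) \<le> (1/2) ^ k" for k
        using lp_le_coord[OF p yr, of k j] rgeo[of k] by linarith
    qed
    then have "convergent (\<lambda>N. \<Sum>k<N. y (Suc k) j - y k j)" by (simp add: summable_iff_convergent)
    then have "convergent (\<lambda>N. y N j - y 0 j)" unfolding sum_lessThan_telescope[of "\<lambda>k. y k j"] .
    then have "convergent (\<lambda>N. (y N j - y 0 j) + y 0 j)" by (intro convergent_add convergent_const)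
    then show ?thesis by simp
  qed
  then obtain x where x: "\<And>j. (\<lambda>k. y k j) \<longlonglongrightarrow> x j" unfolding convergent_def by metis
  have xy: "lp_le p (\<lambda>j. x j - y k j) (2 * r k)" for k
  proof (rule lp_le_limit[OF p])
    show "((\<lambda>i. y (k + i) j - y k j) \<longlongrightarrow> x j - y k j) sequentially" for j
      using LIMSEQ_ignore_initial_segment[OF x, of k j] by (intro tendsto_diff tendsto_const) (simp add: add.commute)
    show "\<forall>\<^sub>F i in sequentially. lp_le p (\<lambda>j. y (k + i) j - y k j) (2 * r k)"
      by (intro always_eventually allI lp_le_mono[OF close _ p]) (use r0 in \<open>auto intro: less_imp_le\<close>)
  qed simp
  have xs: "x \<in> lp_space p"
  proof -
    have "(\<lambda>j. (x j - y 0 j) + y 0 j) \<in> lp_space p"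
      using xy[of 0] p yl by (intro lp_space_add) (auto simp: lp_le_iff)
    then show ?thesis by simp
  qed
  obtain C where C: "\<And>n. lp_le p (T n x) C" using bdd[OF xs] by blast
  obtain k where k: "C \<le> real k" using real_arch_simple by blast
  let ?n = "n (Suc k)"
  have "lp_le p (\<lambda>j. T ?n x j - T ?n (\<lambda>j. x j - y (Suc k) j) j) (C + 1)"
    by (intro lp_le_diff p C sm xy)
  moreover have "T ?n (\<lambda>j. x j - y (Suc k) j) = (\<lambda>j. T ?n x j - T ?n (y (Suc k)) j)"
    by (rule lp_bounded_linear_diff[OF p T xs yl])
  ultimately have "lp_le p (T ?n (y (Suc k))) (C + 1)" by simp
  then have "lp_le p (T ?n (y (Suc k))) (real k + 1)" by (rule lp_le_mono) (use k p in auto)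
  then show False using big by blast
qed

lemma lp_tendsto_zero_le:
  assumes "1 \<le> p" "(g \<longlongrightarrow> 0) F" "eventually (\<lambda>b. lp_le p (\<lambda>k. f b k - y k) (g b)) F"
  shows "lp_tendsto p f y F"
  unfolding lp_tendsto_def
proof (rule Lim_null_comparison[OF _ assms(2)])
  show "\<forall>\<^sub>F b in F. norm (lp_norm p (\<lambda>k. f b k - y k)) \<le> g b"
    using assms(3) by eventually_elim (simp add: lp_le_iff[OF assms(1)] lp_norm_nonneg[OF assms(1)])
qed

lemma lp_tendsto_coord:
  assumes p: "1 \<le> p" and "lp_tendsto p f y F" and "eventually (\<lambda>b. f b \<in> lp_space p) F" and y: "y \<in> lp_space p"
  shows "((\<lambda>b. f b k) \<longlongrightarrow> y k) F"
proof -
  have "((\<lambda>b. f b k - y k) \<longlongrightarrow> 0) F"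
  proof (rule Lim_null_comparison)
    show "((\<lambda>b. lp_norm p (\<lambda>k. f b k - y k)) \<longlongrightarrow> 0) F" using assms(2) by (simp add: lp_tendsto_def)
    show "\<forall>\<^sub>F b in F. norm (f b k - y k) \<le> lp_norm p (\<lambda>k. f b k - y k)"
      using assms(3)
    proof eventually_elim
      case (elim b)
      then have "lp_le p (\<lambda>k. f b k - y k) (lp_norm p (\<lambda>k. f b k - y k))"
        using lp_space_diff[OF p elim y] lp_space_iff_lp_le[OF p] by blast
      then show ?case by (rule lp_le_coord[OF p])
    qed
  qed
  then show ?thesis by (simp add: LIM_zero_iff)
qed

text \<open>Otherwise the operators at suitable times \<open>s n \<rightarrow> 0\<close> are not uniformly bounded, although strong
  continuity bounds them at each sequence. The semigroup law extends a bound near \<open>0\<close> to \<open>[0, t]\<close>.\<close>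

lemma semigroup_locally_bounded:
  fixes T :: "real \<Rightarrow> 'm::finite cseq \<Rightarrow> 'm cseq"
  assumes p: "1 \<le> p" and T: "lp_C0_semigroup p T"
  shows "\<exists>K\<ge>0. \<forall>s x D. 0 \<le> s \<longrightarrow> s \<le> t \<longrightarrow> lp_le p x D \<longrightarrow> lp_le p (T s x) (K * D)"
proof -
  have bl: "lp_bounded_linear p (T s)" if "0 \<le> s" for s using T that by (simp add: lp_C0_semigroup_def)
  have sg: "T (s + s') x = T s (T s' x)" if "0 \<le> s" "0 \<le> s'" "x \<in> lp_space p" for s s' x
    using T that by (simp add: lp_C0_semigroup_def)
  have T0: "T 0 x = x" if "x \<in> lp_space p" for x using T that by (simp add: lp_C0_semigroup_def)
  have "\<exists>\<delta>>0. \<exists>M\<ge>0. \<forall>s x D. 0 \<le> s \<longrightarrow> s \<le> \<delta> \<longrightarrow> lp_le p x D \<longrightarrow> lp_le p (T s x) (M * D)"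
  proof (rule ccontr)
    assume no: "\<not> ?thesis"
    have "\<exists>s x D. 0 \<le> s \<and> s \<le> 1 / real (Suc n) \<and> lp_le p x D \<and> \<not> lp_le p (T s x) (real n * D)" for n
    proof (rule ccontr)
      assume "\<not> ?thesis"
      then have "\<forall>s x D. 0 \<le> s \<longrightarrow> s \<le> 1 / real (Suc n) \<longrightarrow> lp_le p x D \<longrightarrow> lp_le p (T s x) (real n * D)" by blast
      moreover have "0 < 1 / real (Suc n)" "0 \<le> real n" by simp_all
      ultimately show False using no by blast
    qed
    then obtain s x D where s: "\<And>n. 0 \<le> s n" "\<And>n. s n \<le> 1 / real (Suc n)"
      and x: "\<And>n. lp_le p (x n) (D n)" "\<And>n. \<not> lp_le p (T (s n) (x n)) (real n * D n)" by metis
    have "\<exists>M\<ge>0. \<forall>n x D. lp_le p x D \<longrightarrow> lp_le p (T (s n) x) (M * D)"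
    proof (rule lp_uniform_boundedness[OF p])
      show "lp_bounded_linear p (T (s n))" for n using bl s by blast
      fix z :: "'m cseq" assume z: "z \<in> lp_space p"
      have "lp_tendsto p (\<lambda>t. T t z) z (at_right 0)" using T z by (simp add: lp_C0_semigroup_def)
      then have "\<forall>\<^sub>F t in at_right 0. lp_norm p (\<lambda>k. T t z k - z k) < 1"
        unfolding lp_tendsto_def by (rule order_tendstoD) simp
      then obtain b where b: "0 < b" "\<And>t. 0 < t \<Longrightarrow> t < b \<Longrightarrow> lp_norm p (\<lambda>k. T t z k - z k) < 1"
        by (auto simp: eventually_at_right_field)
      have le: "lp_le p (T t z) (1 + lp_norm p z)" if "0 \<le> t" "t < b" for t
      proof (cases "t = 0")
        case True
        then show ?thesis using T0[OF z] z lp_norm_nonneg[OF p z] by (simp add: lp_le_iff[OF p])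
      next
        case False
        have "lp_le p (\<lambda>k. T t z k - z k) 1"
          using b(2)[of t] False that lp_space_diff[OF p lp_bounded_linear_closed[OF bl[OF that(1)] z] z]
          by (simp add: lp_le_iff[OF p])
        then have "lp_le p (\<lambda>k. (T t z k - z k) + z k) (1 + lp_norm p z)"
          by (intro lp_le_add[OF p]) (use z lp_space_iff_lp_le[OF p] in auto)
        then show ?thesis by simp
      qed
      obtain N where N: "1 / real (Suc N) < b" using b(1) reals_Archimedean by (metis inverse_eq_divide)
      define C where "C = 1 + lp_norm p z + (\<Sum>i\<le>N. lp_norm p (T (s i) z))"
      have nn: "0 \<le> lp_norm p (T (s i) z)" for i
        using lp_norm_nonneg[OF p lp_bounded_linear_closed[OF bl[OF s(1)] z]] .
      have "lp_le p (T (s n) z) C" for n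
      proof (cases "n \<le> N")
        case True
        have "lp_norm p (T (s n) z) \<le> (\<Sum>i\<le>N. lp_norm p (T (s i) z))"
          using True nn by (intro member_le_sum) auto
        then show ?thesis
          using lp_bounded_linear_closed[OF bl[OF s(1)] z] lp_norm_nonneg[OF p z] unfolding C_def
          by (simp add: lp_le_iff[OF p])
      next
        case False
        have "1 / real (Suc n) \<le> 1 / real (Suc N)" using False by (intro frac_le) auto
        then have "s n < b" using s(2)[of n] N by linarith
        then show ?thesis using nn unfolding C_def by (intro lp_le_mono[OF le[OF s(1)] _ p]) (auto intro: sum_nonneg)
      qed
      then show "\<exists>C. \<forall>n. lp_le p (T (s n) z) C" by blast
    qed
    then obtain M where M: "\<And>n x D. lp_le p x D \<Longrightarrow> lp_le p (T (s n) x) (M * D)" by blast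
    obtain n where n: "M \<le> real n" using real_arch_simple by blast
    have "lp_le p (T (s n) (x n)) (M * D n)" using M x(1) by blast
    then have "lp_le p (T (s n) (x n)) (real n * D n)"
      by (rule lp_le_mono) (use n p lp_le_nonneg[OF x(1)] in \<open>auto intro: mult_right_mono\<close>)
    then show False using x(2) by blast
  qed
  then obtain \<delta> M0 where \<delta>: "0 < \<delta>" and M0: "\<And>s x D. 0 \<le> s \<Longrightarrow> s \<le> \<delta> \<Longrightarrow> lp_le p x D \<Longrightarrow> lp_le p (T s x) (M0 * D)"
    by blast
  define M where "M = max 1 M0"
  have M: "lp_le p (T s x) (M * D)" if "0 \<le> s" "s \<le> \<delta>" "lp_le p x D" for s x D
    by (rule lp_le_mono[OF M0[OF that] _ p]) (use lp_le_nonneg[OF that(3)] in \<open>auto simp: M_def intro: mult_right_mono\<close>)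
  have M1: "1 \<le> M" by (simp add: M_def)
  have iter: "lp_le p (T s x) (M ^ n * D)" if "0 \<le> s" "s \<le> real n * \<delta>" "lp_le p x D" for n s x D
    using that
  proof (induction n arbitrary: s)
    case 0
    then have "x \<in> lp_space p" using lp_le_iff[OF p] by blast
    then show ?case using T0[of x] 0 by simp
  next
    case (Suc n)
    have x: "x \<in> lp_space p" using Suc.prems lp_le_iff[OF p] by blast
    show ?case
    proof (cases "s \<le> \<delta>")
      case True
      have "M * D \<le> M ^ Suc n * D"
        using M1 lp_le_nonneg[OF Suc.prems(3)] power_increasing[of 1 "Suc n" M] by (intro mult_right_mono) auto
      then show ?thesis using lp_le_mono[OF M[OF Suc.prems(1) True Suc.prems(3)] _ p] by blast
    next
      case False
      have "T s x = T \<delta> (T (s - \<delta>) x)" using sg[of \<delta> "s - \<delta>" x] False \<delta> x by simp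
      moreover have "lp_le p (T (s - \<delta>) x) (M ^ n * D)"
        using Suc.prems False by (intro Suc.IH) (auto simp: algebra_simps)
      ultimately show ?thesis using M[of \<delta> "T (s - \<delta>) x" "M ^ n * D"] \<delta> by (simp add: mult.assoc)
    qed
  qed
  obtain n where n: "t \<le> real n * \<delta>" using \<delta> by (metis reals_Archimedean3 less_imp_le)
  show ?thesis using M1 n by (intro exI[of _ "M ^ n"]) (auto intro!: iter)
qed

text \<open>The orbits are differentiable in the norm from both sides; the left derivative needs the
  local boundedness.\<close>

lemma semigroup_derivative:
  fixes T :: "real \<Rightarrow> 'm::finite cseq \<Rightarrow> 'm cseq"
  assumes p: "1 \<le> p" and T: "lp_generates p A T" and A: "\<And>x. x \<in> lp_space p \<Longrightarrow> A x \<in> lp_space p"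
    and x: "x \<in> lp_space p" and t: "0 \<le> t"
  shows "T t (A x) = A (T t x)" and "lp_has_derivative_at p (\<lambda>s. T s x) (A (T t x)) t"
proof -
  have C0: "lp_C0_semigroup p T" using T by (simp add: lp_generates_def)
  have bl: "lp_bounded_linear p (T s)" if "0 \<le> s" for s using C0 that by (simp add: lp_C0_semigroup_def)
  have cl: "T s z \<in> lp_space p" if "0 \<le> s" "z \<in> lp_space p" for s z
    using lp_bounded_linear_closed[OF bl] that by blast
  have sg: "T (s + s') z = T s (T s' z)" if "0 \<le> s" "0 \<le> s'" "z \<in> lp_space p" for s s' z
    using C0 that by (simp add: lp_C0_semigroup_def)
  have gen: "lp_tendsto p (\<lambda>h k. (T h z k - z k) /\<^sub>R h) (A z) (at_right 0)" if "z \<in> lp_space p" for z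
    using T that A[OF that] by (simp add: lp_generates_def)
  have quot: "(\<lambda>k. (T h z k - z k) /\<^sub>R h) \<in> lp_space p" if "0 \<le> h" "z \<in> lp_space p" for h z
    using lp_space_scaleR[OF p lp_space_diff[OF p cl[OF that] that(2)]] by simp
  obtain K where K: "0 \<le> K" "\<And>s z D. 0 \<le> s \<Longrightarrow> s \<le> t \<Longrightarrow> lp_le p z D \<Longrightarrow> lp_le p (T s z) (K * D)"
    using semigroup_locally_bounded[OF p C0, of t] by blast
  define e where "e h = lp_norm p (\<lambda>k. (T h x k - x k) /\<^sub>R h - A x k)" for h
  define e' where "e' h = lp_norm p (\<lambda>k. T h (A x) k - A x k)" for h
  have e: "(e \<longlongrightarrow> 0) (at_right 0)" using gen[OF x] by (simp add: lp_tendsto_def e_def[abs_def])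
  have e': "(e' \<longlongrightarrow> 0) (at_right 0)"
    using C0 A[OF x] by (simp add: lp_C0_semigroup_def lp_tendsto_def e'_def[abs_def])
  have e_le: "lp_le p (\<lambda>k. (T h x k - x k) /\<^sub>R h - A x k) (e h)" if "0 \<le> h" for h
    unfolding e_def lp_space_iff_lp_le[OF p, symmetric] by (intro lp_space_diff p quot x A that)
  have e'_le: "lp_le p (\<lambda>k. T h (A x) k - A x k) (e' h)" if "0 \<le> h" for h
    unfolding e'_def lp_space_iff_lp_le[OF p, symmetric] by (intro lp_space_diff p cl x A that)
  have pos: "\<forall>\<^sub>F h in at_right 0. (0::real) < h" by (rule eventually_at_right_less)
  have Tq: "T s (\<lambda>k. (T h x k - x k) /\<^sub>R h) = (\<lambda>k. (T (s + h) x k - T s x k) /\<^sub>R h)" if "0 \<le> s" "0 \<le> h" for s h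
    using lp_bounded_linear_scaleR[OF bl[OF that(1)] lp_space_diff[OF p cl[OF that(2) x] x], of "inverse h"]
      lp_bounded_linear_diff[OF p bl[OF that(1)] cl[OF that(2) x] x] sg[OF that x] by simp
  show comm: "T t (A x) = A (T t x)"
  proof -
    have "lp_tendsto p (\<lambda>h k. (T h (T t x) k - T t x k) /\<^sub>R h) (T t (A x)) (at_right 0)"
    proof (rule lp_tendsto_zero_le[OF p tendsto_mult_right_zero[OF e, of K]])
      show "\<forall>\<^sub>F h in at_right 0. lp_le p (\<lambda>k. (T h (T t x) k - T t x k) /\<^sub>R h - T t (A x) k) (K * e h)"
        using pos
      proof eventually_elim
        case (elim h)
        have "lp_le p (T t (\<lambda>k. (T h x k - x k) /\<^sub>R h - A x k)) (K * e h)"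
          using elim t by (intro K e_le) auto
        moreover have "T t (\<lambda>k. (T h x k - x k) /\<^sub>R h - A x k) = (\<lambda>k. T t (\<lambda>k. (T h x k - x k) /\<^sub>R h) k - T t (A x) k)"
          using elim by (intro lp_bounded_linear_diff[OF p] bl t quot x A) auto
        moreover have "T (t + h) x = T h (T t x)" using sg[of h t x] elim t x by (simp add: add.commute)
        ultimately show ?case using Tq[OF t, of h] elim by simp
      qed
    qed
    then show ?thesis
      using T cl[OF t x] cl[OF t A[OF x]] by (simp add: lp_generates_def)
  qed
  have right: "((\<lambda>s. lp_norm p (\<lambda>k. (T s x k - T t x k) /\<^sub>R (s - t) - A (T t x) k)) \<longlongrightarrow> 0) (at_right t)"
  proof -
    have "((\<lambda>h. lp_norm p (\<lambda>k. (T h (T t x) k - T t x k) /\<^sub>R h - A (T t x) k)) \<longlongrightarrow> 0) (at_right 0)"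
      using gen[OF cl[OF t x]] by (simp add: lp_tendsto_def)
    moreover have "\<forall>\<^sub>F h in at_right 0. lp_norm p (\<lambda>k. (T h (T t x) k - T t x k) /\<^sub>R h - A (T t x) k)
        = lp_norm p (\<lambda>k. (T (h + t) x k - T t x k) /\<^sub>R (h + t - t) - A (T t x) k)"
      using pos by eventually_elim (use sg[OF _ t x] in auto)
    ultimately show ?thesis
      unfolding filterlim_at_right_to_0[of _ _ t] by (rule Lim_transform_eventually)
  qed
  show "lp_has_derivative_at p (\<lambda>s. T s x) (A (T t x)) t"
    unfolding lp_has_derivative_at_def lp_tendsto_def
  proof (intro conjI A cl t x)
    show "((\<lambda>s. lp_norm p (\<lambda>k. (T s x k - T t x k) /\<^sub>R (s - t) - A (T t x) k)) \<longlongrightarrow> 0) (at t within {0..})"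
    proof (cases "t = 0")
      case True
      then show ?thesis using right by (simp add: at_within_Ici_at_right)
    next
      case False
      then have t0: "0 < t" using t by simp
      have "lp_tendsto p (\<lambda>h k. (T (t - h) x k - T t x k) /\<^sub>R (t - h - t)) (A (T t x)) (at_right 0)"
      proof (rule lp_tendsto_zero_le[OF p])
        show "((\<lambda>h. K * (e h + e' h)) \<longlongrightarrow> 0) (at_right 0)"
          using tendsto_mult_right_zero[OF tendsto_add_zero[OF e e']] .
        have "\<forall>\<^sub>F h in at_right 0. h < t"
          using t0 eventually_at_right_field by blast
        with pos show "\<forall>\<^sub>F h in at_right 0. lp_le p (\<lambda>k. (T (t - h) x k - T t x k) /\<^sub>R (t - h - t) - A (T t x) k) (K * (e h + e' h))"
        proof eventually_elim
          case (elim h)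
          let ?q = "\<lambda>k. (T h x k - x k) /\<^sub>R h"
          have h: "0 \<le> h" "0 \<le> t - h" "t - h \<le> t" using elim by auto
          have "lp_le p (\<lambda>k. (?q k - A x k) - (T h (A x) k - A x k)) (e h + e' h)"
            by (intro lp_le_diff p e_le e'_le h)
          then have "lp_le p (T (t - h) (\<lambda>k. ?q k - T h (A x) k)) (K * (e h + e' h))"
            by (intro K h) simp
          moreover have "T (t - h) (\<lambda>k. ?q k - T h (A x) k) = (\<lambda>k. T (t - h) ?q k - T (t - h) (T h (A x)) k)"
            by (intro lp_bounded_linear_diff[OF p] bl h quot cl x A)
          moreover have "T (t - h) (T h (A x)) = A (T t x)"
            using sg[OF h(2,1) A[OF x]] comm by simp
          moreover have "T (t - h) ?q = (\<lambda>k. (T t x k - T (t - h) x k) /\<^sub>R h)"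
            using Tq[OF h(2,1)] by simp
          moreover have "(T t x k - T (t - h) x k) /\<^sub>R h = (T (t - h) x k - T t x k) /\<^sub>R (t - h - t)" for k
            by (simp add: algebra_simps)
          ultimately show ?case by simp
        qed
      qed
      then have "((\<lambda>s. lp_norm p (\<lambda>k. (T s x k - T t x k) /\<^sub>R (s - t) - A (T t x) k)) \<longlongrightarrow> 0) (at_left t)"
        unfolding lp_tendsto_def filterlim_at_left_to_right[of _ _ t] filterlim_at_right_to_0[of _ _ "- t"]
        by simp
      then have "((\<lambda>s. lp_norm p (\<lambda>k. (T s x k - T t x k) /\<^sub>R (s - t) - A (T t x) k)) \<longlongrightarrow> 0) (at t)"
        using right by (rule filterlim_split_at)
      then show ?thesis by (rule tendsto_within_subset) simp
    qed
  qed
qed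

section \<open>Poisson averages of a power bounded operator\<close>

definition poi :: "real \<Rightarrow> nat \<Rightarrow> real" where
  "poi \<tau> n = exp (- \<tau>) * \<tau> ^ n / fact n"

lemma poi_nonneg: "0 \<le> \<tau> \<Longrightarrow> 0 \<le> poi \<tau> n"
  by (simp add: poi_def)

lemma poi_Suc: "real (Suc n) * poi \<tau> (Suc n) = \<tau> * poi \<tau> n"
  by (simp add: poi_def divide_simps)

lemma poi_sums: "poi \<tau> sums 1"
proof -
  have "(\<lambda>n. exp (- \<tau>) * (\<tau> ^ n /\<^sub>R fact n)) sums (exp (- \<tau>) * exp \<tau>)"
    by (intro sums_mult exp_converges)
  then show ?thesis by (simp add: poi_def[abs_def] divide_inverse mult_ac exp_minus_inverse)
qed

lemma poi_mean_sums: "(\<lambda>n. real n * poi \<tau> n) sums \<tau>"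
proof -
  have "(\<lambda>n. real (Suc n) * poi \<tau> (Suc n)) sums (\<tau> * 1)"
    unfolding poi_Suc by (intro sums_mult poi_sums)
  then show ?thesis using sums_Suc_iff[of "\<lambda>n. real n * poi \<tau> n" \<tau>] by simp
qed

lemma poi_variance_sums: "(\<lambda>n. (real n - \<tau>)\<^sup>2 * poi \<tau> n) sums \<tau>"
proof -
  have "(\<lambda>n. \<tau> * (real n * poi \<tau> n) + \<tau> * poi \<tau> n) sums (\<tau> * \<tau> + \<tau> * 1)"
    by (intro sums_add sums_mult poi_mean_sums poi_sums)
  moreover have "\<tau> * (real n * poi \<tau> n) + \<tau> * poi \<tau> n = (real (Suc n))\<^sup>2 * poi \<tau> (Suc n)" for n
  proof -
    have "(real (Suc n))\<^sup>2 * poi \<tau> (Suc n) = real (Suc n) * (\<tau> * poi \<tau> n)"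
      unfolding power2_eq_square mult.assoc poi_Suc ..
    then show ?thesis by (simp add: algebra_simps)
  qed
  ultimately have "(\<lambda>n. (real (Suc n))\<^sup>2 * poi \<tau> (Suc n)) sums (\<tau> * \<tau> + \<tau>)" by simp
  then have sq: "(\<lambda>n. (real n)\<^sup>2 * poi \<tau> n) sums (\<tau> * \<tau> + \<tau>)"
    using sums_Suc_iff[of "\<lambda>n. (real n)\<^sup>2 * poi \<tau> n" "\<tau> * \<tau> + \<tau>"] by simp
  have "(\<lambda>n. (real n)\<^sup>2 * poi \<tau> n + (- 2 * \<tau>) * (real n * poi \<tau> n) + \<tau>\<^sup>2 * poi \<tau> n) sums
     ((\<tau> * \<tau> + \<tau>) + (- 2 * \<tau>) * \<tau> + \<tau>\<^sup>2 * 1)"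
    by (intro sums_add sums_mult sq poi_mean_sums poi_sums)
  then show ?thesis by (simp add: power2_eq_square algebra_simps)
qed

text \<open>The ratio of consecutive Poisson weights is \<open>n / \<tau>\<close>, so the total variation of the weights is
  the mean absolute deviation divided by \<open>\<tau>\<close>, which is at most \<open>\<tau>\<^bsup>-1/2\<^esup>\<close> because the variance is \<open>\<tau>\<close>.\<close>

lemma poi_variation_le:
  assumes "0 < \<tau>"
  shows "(\<Sum>n<N. \<bar>real n / \<tau> * poi \<tau> n - poi \<tau> n\<bar>) \<le> 1 / sqrt \<tau>"
proof -
  define s where "s = sqrt \<tau>"
  have s: "0 < s" "\<tau> = s\<^sup>2" using assms by (auto simp: s_def)
  have pt: "\<bar>real n / \<tau> * poi \<tau> n - poi \<tau> n\<bar> \<le> 1 / (2 * s) * poi \<tau> n + 1 / (2 * s ^ 3) * ((real n - \<tau>)\<^sup>2 * poi \<tau> n)" for n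
  proof -
    have "0 \<le> (\<bar>real n - \<tau>\<bar> - s)\<^sup>2" by simp
    then have "2 * (s * \<bar>real n - \<tau>\<bar>) \<le> s\<^sup>2 + (real n - \<tau>)\<^sup>2" by (simp add: power2_diff algebra_simps)
    then have "(2 * (s * \<bar>real n - \<tau>\<bar>)) / (2 * s ^ 3) \<le> (s\<^sup>2 + (real n - \<tau>)\<^sup>2) / (2 * s ^ 3)"
      using s by (intro divide_right_mono) auto
    moreover have "(2 * (s * \<bar>real n - \<tau>\<bar>)) / (2 * s ^ 3) = \<bar>real n - \<tau>\<bar> / \<tau>"
      using s by (simp add: power2_eq_square power3_eq_cube)
    moreover have "(s\<^sup>2 + (real n - \<tau>)\<^sup>2) / (2 * s ^ 3) = 1 / (2 * s) + 1 / (2 * s ^ 3) * (real n - \<tau>)\<^sup>2"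
      using s(1) by (simp add: add_divide_distrib power2_eq_square power3_eq_cube)
    ultimately have "\<bar>real n - \<tau>\<bar> / \<tau> * poi \<tau> n \<le> (1 / (2 * s) + 1 / (2 * s ^ 3) * (real n - \<tau>)\<^sup>2) * poi \<tau> n"
      using assms by (intro mult_right_mono) (auto intro: poi_nonneg)
    moreover have "\<bar>real n / \<tau> * poi \<tau> n - poi \<tau> n\<bar> = \<bar>real n - \<tau>\<bar> / \<tau> * poi \<tau> n"
    proof -
      have "real n / \<tau> * poi \<tau> n - poi \<tau> n = (real n - \<tau>) / \<tau> * poi \<tau> n"
        using assms by (simp add: field_simps)
      then show ?thesis using assms poi_nonneg[of \<tau> n] by (simp add: abs_mult)
    qed
    ultimately show ?thesis by (simp add: algebra_simps)
  qed
  have sums: "(\<lambda>n. 1 / (2 * s) * poi \<tau> n + 1 / (2 * s ^ 3) * ((real n - \<tau>)\<^sup>2 * poi \<tau> n)) sums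
      (1 / (2 * s) * 1 + 1 / (2 * s ^ 3) * \<tau>)"
    by (intro sums_add sums_mult poi_sums poi_variance_sums)
  have "(\<Sum>n<N. \<bar>real n / \<tau> * poi \<tau> n - poi \<tau> n\<bar>)
     \<le> (\<Sum>n<N. 1 / (2 * s) * poi \<tau> n + 1 / (2 * s ^ 3) * ((real n - \<tau>)\<^sup>2 * poi \<tau> n))"
    by (intro sum_mono pt)
  also have "\<dots> \<le> 1 / (2 * s) * 1 + 1 / (2 * s ^ 3) * \<tau>"
  proof -
    have "sum f {..<N} \<le> l" if "f sums l" "\<And>n. 0 \<le> f n" for f and l :: real
      using sum_le_suminf[of f "{..<N}"] that by (auto simp: sums_iff)
    from this[OF sums] show ?thesis using s poi_nonneg[of \<tau>] by (auto intro!: add_nonneg_nonneg mult_nonneg_nonneg)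
  qed
  also have "\<dots> = 1 / s" using s(1) unfolding s(2) by (simp add: power2_eq_square power3_eq_cube)
  finally show ?thesis by (simp add: s_def)
qed

lemma poi_summable_vec:
  fixes v :: "nat \<Rightarrow> complex^'m"
  assumes "0 \<le> \<tau>" "\<And>n. norm (v n) \<le> D"
  shows "summable (\<lambda>n. poi \<tau> n *\<^sub>R v n)"
proof (rule summable_comparison_test')
  show "summable (\<lambda>n. poi \<tau> n * D)" using poi_sums by (intro summable_mult2) (auto simp: sums_iff)
  show "norm (poi \<tau> n *\<^sub>R v n) \<le> poi \<tau> n * D" for n
    using assms poi_nonneg[of \<tau> n] by (simp add: mult_left_mono)
qed

lemma poi_scalar_derivative:
  fixes u :: "nat \<Rightarrow> complex"
  assumes b: "\<And>n. cmod (u n) \<le> D"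
  shows "((\<lambda>\<tau>. \<Sum>n. poi \<tau> n *\<^sub>R u n) has_vector_derivative (\<Sum>n. poi \<tau> n *\<^sub>R (u (Suc n) - u n))) (at \<tau>)"
proof -
  have summ: "summable (\<lambda>n. (u (n + k) / fact n) * z ^ n)" for z k
  proof (rule summable_comparison_test')
    show "summable (\<lambda>n. D * (cmod z ^ n /\<^sub>R fact n))"
      by (intro summable_mult summable_exp_generic)
    show "norm ((u (n + k) / fact n) * z ^ n) \<le> D * (cmod z ^ n /\<^sub>R fact n)" for n
    proof -
      have "norm ((u (n + k) / fact n) * z ^ n) = cmod (u (n + k)) * (cmod z ^ n /\<^sub>R fact n)"
        by (simp add: norm_mult norm_divide norm_power divide_inverse norm_inverse)
      also have "\<dots> \<le> D * (cmod z ^ n /\<^sub>R fact n)" by (intro mult_right_mono b) simp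
      finally show ?thesis .
    qed
  qed
  define f where "f k z = (\<Sum>n. (u (n + k) / fact n) * z ^ n)" for k z
  have "DERIV (f 0) z :> f 1 z" for z
  proof -
    have "((\<lambda>z. \<Sum>n. (u n / fact n) * z ^ n) has_field_derivative (\<Sum>n. diffs (\<lambda>n. u n / fact n) n * z ^ n)) (at z)"
      using summ[where k = 0] by (intro termdiffs_strong_converges_everywhere) simp
    moreover have "diffs (\<lambda>n. u n / fact n) n = u (n + 1) / fact n" for n
      by (simp add: diffs_def field_simps del: of_nat_Suc)
    ultimately show ?thesis by (simp add: f_def[abs_def])
  qed
  then have F: "((\<lambda>\<tau>. f 0 (of_real \<tau>)) has_vector_derivative f 1 (of_real \<tau>)) (at \<tau>)"
    by (rule has_vector_derivative_real_field)
  have ev: "(\<lambda>n. poi \<tau> n *\<^sub>R u (n + k)) sums (exp (- \<tau>) *\<^sub>R f k (of_real \<tau>))" for \<tau> k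
  proof -
    have "(\<lambda>n. exp (- \<tau>) *\<^sub>R ((u (n + k) / fact n) * of_real \<tau> ^ n)) sums (exp (- \<tau>) *\<^sub>R f k (of_real \<tau>))"
      unfolding f_def by (intro sums_scaleR_right summable_sums summ)
    moreover have "exp (- \<tau>) *\<^sub>R ((u (n + k) / fact n) * of_real \<tau> ^ n) = poi \<tau> n *\<^sub>R u (n + k)" for n
      by (simp add: poi_def scaleR_conv_of_real)
    ultimately show ?thesis by simp
  qed
  have "(\<lambda>n. poi \<tau> n *\<^sub>R u (n + 1) - poi \<tau> n *\<^sub>R u (n + 0)) sums (exp (- \<tau>) *\<^sub>R f 1 (of_real \<tau>) - exp (- \<tau>) *\<^sub>R f 0 (of_real \<tau>))"
    by (intro sums_diff ev)
  then have d: "(\<Sum>n. poi \<tau> n *\<^sub>R (u (Suc n) - u n)) = exp (- \<tau>) *\<^sub>R f 1 (of_real \<tau>) - exp (- \<tau>) *\<^sub>R f 0 (of_real \<tau>)"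
    by (simp add: sums_iff scaleR_diff_right)
  have "((\<lambda>\<tau>. exp (- \<tau>) *\<^sub>R f 0 (of_real \<tau>)) has_vector_derivative (exp (- \<tau>) *\<^sub>R f 1 (of_real \<tau>) + (- exp (- \<tau>)) *\<^sub>R f 0 (of_real \<tau>))) (at \<tau>)"
    by (rule has_vector_derivative_scaleR[OF _ F]) (auto intro!: derivative_eq_intros)
  moreover have "(\<lambda>\<tau>. exp (- \<tau>) *\<^sub>R f 0 (of_real \<tau>)) = (\<lambda>\<tau>. \<Sum>n. poi \<tau> n *\<^sub>R u n)"
    using ev[where k = 0] by (auto simp: sums_iff)
  ultimately show ?thesis unfolding d by simp
qed

lemma has_vector_derivative_vec:
  fixes f :: "real \<Rightarrow> complex^'m"
  assumes "\<And>i. ((\<lambda>x. f x $ i) has_vector_derivative f' $ i) F"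
  shows "(f has_vector_derivative f') F"
proof -
  have bl: "bounded_linear (\<lambda>z. z *s a)" for a :: "complex^'m"
    by (rule bounded_linear_intro[of _ "norm a"])
       (auto simp: vec_eq_iff algebra_simps norm_vec_def norm_mult L2_set_right_distrib)
  have "((\<lambda>x. \<Sum>i\<in>UNIV. f x $ i *s axis i 1) has_vector_derivative (\<Sum>i\<in>UNIV. f' $ i *s axis i 1)) F"
    by (intro has_vector_derivative_sum bounded_linear.has_vector_derivative[OF bl] assms)
  moreover have "(\<Sum>i\<in>UNIV. v $ i *s axis i 1) = v" for v :: "complex^'m"
    by (simp add: vec_eq_iff axis_def if_distrib cong: if_cong)
  ultimately show ?thesis by simp
qed

lemma poi_vector_derivative:
  fixes v :: "nat \<Rightarrow> complex^'m"
  assumes b: "\<And>n. norm (v n) \<le> D" and \<tau>: "0 \<le> \<tau>"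
  shows "((\<lambda>\<tau>. \<Sum>n. poi \<tau> n *\<^sub>R v n) has_vector_derivative (\<Sum>n. poi \<tau> n *\<^sub>R (v (Suc n) - v n))) (at \<tau> within {0..})"
proof (rule has_vector_derivative_transform[OF _ _ has_vector_derivative_vec])
  have bi: "cmod (v n $ i) \<le> D" for n i using b[of n] Finite_Cartesian_Product.norm_nth_le[of "v n" i] by simp
  let ?g = "\<lambda>\<tau>. \<chi> i. \<Sum>n. poi \<tau> n *\<^sub>R (v n $ i)"
  have comp: "(\<Sum>n. w n) $ i = (\<Sum>n. w n $ i)" if "summable w" for w :: "nat \<Rightarrow> complex^'m" and i
    using bounded_linear.suminf[OF bounded_linear_vec_nth that] by simp
  show "\<tau> \<in> {0..}" using \<tau> by simp
  show "(\<Sum>n. poi x n *\<^sub>R v n) = ?g x" if "x \<in> {0..}" for x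
    using that by (simp add: vec_eq_iff comp[OF poi_summable_vec[OF _ b]])
  have b2: "norm (v (Suc n) - v n) \<le> D + D" for n
    using norm_triangle_ineq4[of "v (Suc n)" "v n"] b[of n] b[of "Suc n"] by linarith
  show "((\<lambda>x. ?g x $ i) has_vector_derivative (\<Sum>n. poi \<tau> n *\<^sub>R (v (Suc n) - v n)) $ i) (at \<tau> within {0..})" for i
    using has_vector_derivative_at_within[OF poi_scalar_derivative[of "\<lambda>n. v n $ i", OF bi]]
    by (simp add: comp[OF poi_summable_vec[OF \<tau> b2]])
qed

section \<open>Identification of the semigroup\<close>

text \<open>Gronwall: \<open>exp (- 2 L t) \<bar>f t\<bar>\<^sup>2\<close> is nonincreasing for \<open>L = \<parallel>A\<parallel>\<close>.\<close>

lemma matrix_ode_unique_zero: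
  fixes f :: "real \<Rightarrow> complex^'m"
  assumes d: "\<And>t. 0 \<le> t \<Longrightarrow> (f has_vector_derivative A *v f t) (at t within {0..})"
    and f0: "f 0 = 0" and t: "0 \<le> t"
  shows "f t = 0"
proof (cases "t = 0")
  case False
  then have t0: "0 < t" using t by simp
  define L where "L = norm A"
  define g where "g s = exp (- 2 * L * s) * (f s \<bullet> f s)" for s
  define g' where "g' s = - 2 * L * exp (- 2 * L * s) * (f s \<bullet> f s) + exp (- 2 * L * s) * (2 * (f s \<bullet> (A *v f s)))" for s
  have dg: "(g has_derivative (\<lambda>h. h * g' s)) (at s within {0..t})" if "0 \<le> s" "s \<le> t" for s
  proof -
    have fd: "(f has_derivative (\<lambda>h. h *\<^sub>R (A *v f s))) (at s within {0..t})"
      using has_vector_derivative_within_subset[OF d[OF that(1)], of "{0..t}"] by (auto simp: has_vector_derivative_def)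
    have ed: "((\<lambda>s. exp (- 2 * L * s)) has_derivative (\<lambda>h. h * (- 2 * L * exp (- 2 * L * s)))) (at s within {0..t})"
      by (auto intro!: derivative_eq_intros)
    have "(g has_derivative (\<lambda>h. exp (- 2 * L * s) * (f s \<bullet> (h *\<^sub>R (A *v f s)) + (h *\<^sub>R (A *v f s)) \<bullet> f s)
         + h * (- 2 * L * exp (- 2 * L * s)) * (f s \<bullet> f s))) (at s within {0..t})"
      unfolding g_def by (intro has_derivative_mult has_derivative_inner ed fd)
    then show ?thesis
      by (rule has_derivative_eq_rhs) (simp add: g'_def fun_eq_iff inner_commute algebra_simps)
  qed
  have "g' s \<le> 0" for s
  proof -
    have "f s \<bullet> (A *v f s) \<le> norm (f s) * norm (A *v f s)" by (rule norm_cauchy_schwarz)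
    also have "\<dots> \<le> norm (f s) * (L * norm (f s))"
      unfolding L_def by (intro mult_left_mono norm_matrix_vector_mult_le) auto
    finally have "f s \<bullet> (A *v f s) \<le> L * (f s \<bullet> f s)" by (simp add: dot_square_norm power2_eq_square mult_ac)
    then have "exp (- 2 * L * s) * (2 * (f s \<bullet> (A *v f s))) \<le> exp (- 2 * L * s) * (2 * (L * (f s \<bullet> f s)))"
      by (intro mult_left_mono) auto
    then show ?thesis by (simp add: g'_def mult_ac)
  qed
  moreover obtain \<xi> where "g t - g 0 = (t - 0) * g' \<xi>"
    using mvt_simple[OF t0 dg] by auto
  ultimately have "g t \<le> g 0" using t0 by (smt (verit) mult_nonneg_nonpos)
  also have "g 0 = 0" by (simp add: g_def f0)
  finally have "f t \<bullet> f t \<le> 0" by (simp add: g_def mult_le_0_iff)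
  then show ?thesis by (metis inner_ge_zero inner_eq_zero_iff order_antisym)
qed (use f0 in simp)

lemma sys_op_apply: "sys_op A0 A1 x k = A0 *v x k + A1 *v right_shift x k"
  by (cases k) (simp_all add: sys_op_def)

text \<open>The system is lower triangular, so the coordinates are determined one after the other.\<close>

lemma sys_op_ode_unique:
  fixes u e :: "real \<Rightarrow> 'm::finite cseq"
  assumes u: "\<And>t k. 0 \<le> t \<Longrightarrow> ((\<lambda>s. u s k) has_vector_derivative sys_op A0 A1 (u t) k) (at t within {0..})"
    and e: "\<And>t k. 0 \<le> t \<Longrightarrow> ((\<lambda>s. e s k) has_vector_derivative sys_op A0 A1 (e t) k) (at t within {0..})"
    and init: "u 0 = e 0" and t: "0 \<le> t"
  shows "u t k = e t k"
  using t
proof (induction k arbitrary: t rule: less_induct)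
  case (less k)
  have rs: "right_shift (u s) k = right_shift (e s) k" if "0 \<le> s" for s
    using less.IH that by (cases k) auto
  have "u t k - e t k = 0"
  proof (rule matrix_ode_unique_zero[where A = A0])
    show "((\<lambda>s. u s k - e s k) has_vector_derivative A0 *v (u s k - e s k)) (at s within {0..})" if "0 \<le> s" for s
      using has_vector_derivative_diff[OF u[OF that, of k] e[OF that, of k]]
      by (simp add: sys_op_apply rs[OF that] matrix_vector_mult_diff_distrib)
  qed (use init less.prems in auto)
  then show ?case by simp
qed

lemma matrix_vector_mult_bounded_linear: "bounded_linear ((*v) (A :: complex^'n^'m))"
proof (rule bounded_linear_intro[of _ "norm A"])
  show "A *v (r *\<^sub>R x) = r *\<^sub>R (A *v x)" for r x
    by (simp add: vec_eq_iff matrix_vector_mult_def scaleR_sum_right)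
  show "norm (A *v x) \<le> norm x * norm A" for x
    using norm_matrix_vector_mult_le[of A x] by (simp add: mult.commute)
qed (rule matrix_vector_right_distrib)

lemma has_vector_derivative_quotient_limit:
  fixes f :: "real \<Rightarrow> 'a::real_normed_vector"
  assumes "((\<lambda>s. (f s - f t) /\<^sub>R (s - t)) \<longlongrightarrow> D) (at t within S)"
  shows "(f has_vector_derivative D) (at t within S)"
  unfolding has_vector_derivative_def has_derivative_iff_norm
proof
  have "((\<lambda>s. norm ((f s - f t) /\<^sub>R (s - t) - D)) \<longlongrightarrow> 0) (at t within S)"
    using tendsto_norm_zero[OF LIM_zero[OF assms]] .
  moreover have "\<forall>\<^sub>F s in at t within S. norm ((f s - f t) /\<^sub>R (s - t) - D) = norm (f s - f t - (s - t) *\<^sub>R D) / norm (s - t)"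
    unfolding eventually_at_filter
  proof (rule always_eventually, intro allI impI)
    fix s assume "s \<noteq> t"
    then have "f s - f t - (s - t) *\<^sub>R D = (s - t) *\<^sub>R ((f s - f t) /\<^sub>R (s - t) - D)"
      by (simp add: scaleR_diff_right)
    then show "norm ((f s - f t) /\<^sub>R (s - t) - D) = norm (f s - f t - (s - t) *\<^sub>R D) / norm (s - t)"
      using \<open>s \<noteq> t\<close> by simp
  qed
  ultimately show "((\<lambda>s. norm (f s - f t - (s - t) *\<^sub>R D) / norm (s - t)) \<longlongrightarrow> 0) (at t within S)"
    by (rule Lim_transform_eventually)
qed (rule bounded_linear_scaleR_left)

lemma lp_has_derivative_at_coord:
  fixes u :: "real \<Rightarrow> 'm::finite cseq"
  assumes p: "1 \<le> p" and d: "lp_has_derivative_at p u y t" and u: "\<And>s. 0 \<le> s \<Longrightarrow> u s \<in> lp_space p" and t: "0 \<le> t"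
  shows "((\<lambda>s. u s k) has_vector_derivative y k) (at t within {0..})"
proof (rule has_vector_derivative_quotient_limit)
  have y: "y \<in> lp_space p" and lim: "lp_tendsto p (\<lambda>s k. (u s k - u t k) /\<^sub>R (s - t)) y (at t within {0..})"
    using d by (auto simp: lp_has_derivative_at_def)
  have "\<forall>\<^sub>F s in at t within {0..}. (\<lambda>k. (u s k - u t k) /\<^sub>R (s - t)) \<in> lp_space p"
    unfolding eventually_at_filter
    by (rule always_eventually) (auto intro!: lp_space_scaleR[OF p] lp_space_diff[OF p] u t)
  then show "((\<lambda>s. (u s k - u t k) /\<^sub>R (s - t)) \<longlongrightarrow> y k) (at t within {0..})"
    by (rule lp_tendsto_coord[OF p lim _ y])
qed

lemma lp_le_sys_op:
  assumes p: "1 \<le> p" and x: "lp_le p x D"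
  shows "lp_le p (sys_op A0 A1 x) ((norm A0 + norm A1) * D)"
proof -
  have "lp_le p (\<lambda>k. A0 *v x k + A1 *v right_shift x k) (norm A0 * D + norm A1 * D)"
    by (intro lp_le_add p lp_le_dominated[OF x] lp_le_dominated[OF lp_le_right_shift[OF p x]] norm_matrix_vector_mult_le) auto
  then show ?thesis by (simp add: sys_op_apply[abs_def] distrib_right)
qed

lemma sys_op_lp_space: "1 \<le> p \<Longrightarrow> x \<in> lp_space p \<Longrightarrow> sys_op A0 A1 x \<in> lp_space p"
  using lp_le_sys_op lp_le_iff lp_space_iff_lp_le by metis

lemma sys_op_eq_disc_op:
  assumes "0 < c" "B = mat 1 + mat (of_real (1/c)) ** A0" "C = mat (of_real (1/c)) ** A1"
  shows "sys_op A0 A1 x k = c *\<^sub>R (disc_op B C x k - x k)"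
proof -
  have sc: "(mat (of_real (1/c)) ** A) *v v = (1/c) *\<^sub>R (A *v v)" for A :: "complex^'a^'a" and v
    by (simp add: matrix_vector_mul_assoc[symmetric] mat_vector_mult of_real_smult del: of_real_divide)
  show ?thesis
    unfolding assms(2,3) using assms(1) by (simp only: sys_op_apply disc_op_apply matrix_vector_mult_add_rdistrib sc matrix_vector_mul_lid)
      (simp add: scaleR_add_right)
qed

text \<open>A generated semigroup is the exponential series \<open>exp (c t (Q - I))\<close>, read coordinatewise.\<close>

lemma semigroup_eq_poisson:
  fixes A0 A1 B C :: "complex^'m^'m" and T :: "real \<Rightarrow> 'm cseq \<Rightarrow> 'm cseq"
  assumes BC: "B = mat 1 + mat (of_real (1/c)) ** A0" "C = mat (of_real (1/c)) ** A1"
    and p: "1 \<le> p" and gen: "lp_generates p (sys_op A0 A1) T" and c: "0 < c"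
    and pb: "\<And>n x D. lp_le p x D \<Longrightarrow> lp_le p ((disc_op B C ^^ n) x) (M * D)"
    and x: "x \<in> lp_space p" and t: "0 \<le> t"
  shows "(\<lambda>n. poi (c * t) n *\<^sub>R (disc_op B C ^^ n) x k) sums T t x k"
proof -
  have C0: "lp_C0_semigroup p T" using gen by (simp add: lp_generates_def)
  have cl: "T s z \<in> lp_space p" if "0 \<le> s" "z \<in> lp_space p" for s z
    using C0 that lp_bounded_linear_closed by (auto simp: lp_C0_semigroup_def)
  \<comment> \<open>Both sides solve the same lower triangular system with the same initial value.\<close>
  define v where "v k n = (disc_op B C ^^ n) x k" for k n
  define D where "D = M * lp_norm p x"
  have vD: "norm (v k n) \<le> D" for k n
    unfolding v_def D_def using lp_le_coord[OF p pb[of x "lp_norm p x" n]] x lp_space_iff_lp_le[OF p] by blast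
  define e where "e t k = (\<Sum>n. poi (c * t) n *\<^sub>R v k n)" for t k
  have esum: "(\<lambda>n. poi (c * t) n *\<^sub>R v k n) sums e t k" if "0 \<le> t" for t k
    unfolding e_def using c that by (intro summable_sums poi_summable_vec[OF _ vD]) auto
  have Qe: "(\<lambda>n. poi (c * t) n *\<^sub>R v k (Suc n)) sums disc_op B C (e t) k" if t: "0 \<le> t" for t k
  proof -
    have rs: "(\<lambda>n. poi (c * t) n *\<^sub>R right_shift ((disc_op B C ^^ n) x) k) sums right_shift (e t) k"
      using esum[OF t] by (cases k) (auto simp: v_def)
    have bl: "(\<lambda>n. poi (c * t) n *\<^sub>R (A *v w n)) sums (A *v s)" if "(\<lambda>n. poi (c * t) n *\<^sub>R w n) sums s"
      for A :: "complex^'m^'m" and w s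
      using bounded_linear.sums[OF matrix_vector_mult_bounded_linear that, of A]
      by (simp add: linear_simps(5)[OF matrix_vector_mult_bounded_linear])
    have "(\<lambda>n. poi (c * t) n *\<^sub>R (B *v v k n)
        + poi (c * t) n *\<^sub>R (C *v right_shift ((disc_op B C ^^ n) x) k)) sums disc_op B C (e t) k"
      unfolding disc_op_apply[of B C "e t"] by (intro sums_add bl esum[OF t] rs)
    moreover have "v k (Suc n) = B *v v k n + C *v right_shift ((disc_op B C ^^ n) x) k" for n
      unfolding v_def funpow.simps comp_apply by (rule disc_op_apply)
    ultimately show ?thesis by (simp add: scaleR_add_right)
  qed
  have "T t x k = e t k"
  proof (rule sys_op_ode_unique[of "\<lambda>t. T t x" A0 A1 e])
    show "((\<lambda>s. T s x k) has_vector_derivative sys_op A0 A1 (T t x) k) (at t within {0..})" if "0 \<le> t" for t k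
      by (rule lp_has_derivative_at_coord[OF p semigroup_derivative(2)[OF p gen sys_op_lp_space[OF p] x that] cl[OF _ x] that])
    show "((\<lambda>s. e s k) has_vector_derivative sys_op A0 A1 (e t) k) (at t within {0..})" if t: "0 \<le> t" for t k
    proof -
      have ct: "0 \<le> c * t" using c t by simp
      have S: "((\<lambda>\<tau>. \<Sum>n. poi \<tau> n *\<^sub>R v k n) has_vector_derivative (\<Sum>n. poi (c * t) n *\<^sub>R (v k (Suc n) - v k n))) (at (c * t) within {0..})"
        by (rule poi_vector_derivative[OF vD ct])
      have sub: "(\<lambda>s. c * s) ` {0..} \<subseteq> {0..}" using c by auto
      have "((\<lambda>s. c * s) has_vector_derivative c) (at t within {0..})"
        by (auto intro!: derivative_eq_intros simp: has_real_derivative_iff_has_vector_derivative[symmetric])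
      from vector_diff_chain_within[OF this has_vector_derivative_within_subset[OF S sub]]
      have "((\<lambda>s. e s k) has_vector_derivative c *\<^sub>R (\<Sum>n. poi (c * t) n *\<^sub>R (v k (Suc n) - v k n))) (at t within {0..})"
        by (simp add: e_def[abs_def] o_def)
      moreover have "(\<lambda>n. poi (c * t) n *\<^sub>R (v k (Suc n) - v k n)) sums (disc_op B C (e t) k - e t k)"
        unfolding scaleR_diff_right by (intro sums_diff Qe esum t)
      then have "c *\<^sub>R (\<Sum>n. poi (c * t) n *\<^sub>R (v k (Suc n) - v k n)) = sys_op A0 A1 (e t) k"
        by (simp add: sums_iff sys_op_eq_disc_op[OF c BC, of "e t" k])
      ultimately show ?thesis by simp
    qed
    show "T 0 x = e 0"
    proof
      fix k
      have "(\<lambda>n. poi 0 n *\<^sub>R v k n) sums (\<Sum>n\<in>{0}. poi 0 n *\<^sub>R v k n)"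
        by (rule sums_finite) (auto simp: poi_def)
      moreover have "(\<Sum>n\<in>{0}. poi 0 n *\<^sub>R v k n) = x k" by (simp add: poi_def v_def)
      ultimately have "e 0 k = x k" by (simp add: e_def sums_iff)
      moreover have "T 0 x = x" using C0 x by (simp add: lp_C0_semigroup_def)
      ultimately show "T 0 x k = e 0 k" by simp
    qed
  qed (rule t)
  then show ?thesis using esum[OF t, of k] by (simp add: v_def)
qed

text \<open>Since \<open>A T(t) = c (Q - I) T(t)\<close>, summation by parts replaces the Poisson weights by their differences,
  whose total variation is at most \<open>(c t)\<^bsup>-1/2\<^esup>\<close>.\<close>

lemma semigroup_bounds:
  fixes A0 A1 B C :: "complex^'m^'m" and T :: "real \<Rightarrow> 'm cseq \<Rightarrow> 'm cseq"
  assumes BC: "B = mat 1 + mat (of_real (1/c)) ** A0" "C = mat (of_real (1/c)) ** A1"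
    and p: "1 \<le> p" and gen: "lp_generates p (sys_op A0 A1) T" and c: "0 < c"
    and pb: "\<And>n x D. lp_le p x D \<Longrightarrow> lp_le p ((disc_op B C ^^ n) x) (M * D)" and M: "0 \<le> M"
    and x: "lp_le p x D"
  shows "0 \<le> t \<Longrightarrow> lp_le p (T t x) (M * D)"
    and "0 < t \<Longrightarrow> lp_le p (sys_op A0 A1 (T t x)) (sqrt c * M * D / sqrt t)"
proof -
  have xs: "x \<in> lp_space p" using x lp_le_iff[OF p] by blast
  have MD: "0 \<le> M * D" using M lp_le_nonneg[OF x] by simp
  have rep: "(\<lambda>n. poi (c * t) n *\<^sub>R (disc_op B C ^^ n) z k) sums T t z k"
    if "z \<in> lp_space p" "0 \<le> t" for z t k
    by (rule semigroup_eq_poisson[OF BC p gen c _ that]) (rule pb)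
  { assume t: "0 \<le> t"
    show "lp_le p (T t x) (M * D)"
    proof (rule lp_le_limit[OF p])
      show "((\<lambda>N. \<Sum>n<N. poi (c * t) n *\<^sub>R (disc_op B C ^^ n) x k) \<longlongrightarrow> T t x k) sequentially" for k
        using rep[OF xs t, of k] by (simp add: sums_def)
      have "lp_le p (\<lambda>k. \<Sum>n<N. poi (c * t) n *\<^sub>R (disc_op B C ^^ n) x k) (M * D)" for N
      proof (rule lp_le_mono[OF lp_le_sum[OF p _ lp_le_scaleR[OF p pb[OF x]]] _ p])
        have "(\<Sum>n<N. poi (c * t) n) \<le> 1"
          using sum_le_suminf[of "poi (c * t)" "{..<N}"] poi_sums[of "c * t"] poi_nonneg[of "c * t"] c t by (auto simp: sums_iff)
        then have "(\<Sum>n<N. poi (c * t) n) * (M * D) \<le> 1 * (M * D)" using MD by (intro mult_right_mono)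
        then show "(\<Sum>n<N. \<bar>poi (c * t) n\<bar> * (M * D)) \<le> M * D"
          using c t by (simp add: sum_distrib_right poi_nonneg)
      qed simp
      then show "\<forall>\<^sub>F N in sequentially. lp_le p (\<lambda>k. \<Sum>n<N. poi (c * t) n *\<^sub>R (disc_op B C ^^ n) x k) (M * D)" by simp
    qed simp }
  { assume t: "0 < t"
    define \<tau> where "\<tau> = c * t"
    have \<tau>: "0 < \<tau>" using c t by (simp add: \<tau>_def)
    let ?b = "\<lambda>n. c * (real n / \<tau> * poi \<tau> n - poi \<tau> n)"
    show "lp_le p (sys_op A0 A1 (T t x)) (sqrt c * M * D / sqrt t)"
    proof (rule lp_le_limit[OF p])
      fix k
      have comm: "sys_op A0 A1 (T t x) = T t (sys_op A0 A1 x)"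
        using semigroup_derivative(1)[OF p gen sys_op_lp_space[OF p] xs] t by simp
      have Qx: "disc_op B C x \<in> lp_space p" using pb[OF x, of 1] lp_le_iff[OF p] by auto
      have 1: "(\<lambda>n. poi \<tau> n *\<^sub>R (disc_op B C ^^ n) x k) sums T t x k"
        using rep[OF xs, of t k] t by (simp add: \<tau>_def)
      have 2: "(\<lambda>n. poi \<tau> n *\<^sub>R (disc_op B C ^^ Suc n) x k) sums T t (disc_op B C x) k"
        using rep[OF Qx, of t k] t
        unfolding \<tau>_def by (simp add: funpow_swap1)
      have 3: "(\<lambda>n. (real n / \<tau> * poi \<tau> n) *\<^sub>R (disc_op B C ^^ n) x k) sums T t (disc_op B C x) k"
      proof -
        have eq: "real (Suc n) / \<tau> * poi \<tau> (Suc n) = poi \<tau> n" for n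
          using poi_Suc[of n \<tau>] \<tau> by (simp add: field_simps del: of_nat_Suc)
        have "(\<lambda>n. (real (Suc n) / \<tau> * poi \<tau> (Suc n)) *\<^sub>R (disc_op B C ^^ Suc n) x k) sums T t (disc_op B C x) k"
          unfolding eq by (rule 2)
        then show ?thesis using sums_Suc_iff[of "\<lambda>n. (real n / \<tau> * poi \<tau> n) *\<^sub>R (disc_op B C ^^ n) x k"] by simp
      qed
      have "T t (sys_op A0 A1 x) k = c *\<^sub>R (T t (disc_op B C x) k - T t x k)"
      proof -
        have bl: "lp_bounded_linear p (T t)" using gen t by (simp add: lp_generates_def lp_C0_semigroup_def)
        have "sys_op A0 A1 x = (\<lambda>k. c *\<^sub>R (disc_op B C x k - x k))"
          using sys_op_eq_disc_op[OF c BC] by auto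
        then show ?thesis
          using lp_bounded_linear_scaleR[OF bl lp_space_diff[OF p Qx xs], of c] lp_bounded_linear_diff[OF p bl Qx xs]
          by simp
      qed
      moreover have "(\<lambda>n. c *\<^sub>R ((real n / \<tau> * poi \<tau> n) *\<^sub>R (disc_op B C ^^ n) x k - poi \<tau> n *\<^sub>R (disc_op B C ^^ n) x k)) sums (c *\<^sub>R (T t (disc_op B C x) k - T t x k))"
        by (intro sums_scaleR_right sums_diff 1 3)
      ultimately have "(\<lambda>n. ?b n *\<^sub>R (disc_op B C ^^ n) x k) sums sys_op A0 A1 (T t x) k"
        unfolding comm by (simp add: scaleR_diff_left[symmetric] right_diff_distrib)
      then show "((\<lambda>N. \<Sum>n<N. ?b n *\<^sub>R (disc_op B C ^^ n) x k) \<longlongrightarrow> sys_op A0 A1 (T t x) k) sequentially"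
        by (simp add: sums_def)
    next
      have "lp_le p (\<lambda>k. \<Sum>n<N. ?b n *\<^sub>R (disc_op B C ^^ n) x k) (sqrt c * M * D / sqrt t)" for N
      proof (rule lp_le_mono[OF lp_le_sum[OF p _ lp_le_scaleR[OF p pb[OF x]]] _ p])
        have "(\<Sum>n<N. \<bar>?b n\<bar> * (M * D)) = c * (\<Sum>n<N. \<bar>real n / \<tau> * poi \<tau> n - poi \<tau> n\<bar>) * (M * D)"
          using c by (simp add: abs_mult sum_distrib_left sum_distrib_right del: right_diff_distrib)
        also have "\<dots> \<le> c * (1 / sqrt \<tau>) * (M * D)"
          using c MD by (intro mult_right_mono mult_left_mono poi_variation_le \<tau>) auto
        also have "c * (1 / sqrt \<tau>) = sqrt c / sqrt t"
          unfolding \<tau>_def using c t by (simp add: real_sqrt_mult field_simps)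
        finally show "(\<Sum>n<N. \<bar>?b n\<bar> * (M * D)) \<le> sqrt c * M * D / sqrt t" by (simp add: mult.assoc)
      qed simp
      then show "\<forall>\<^sub>F N in sequentially. lp_le p (\<lambda>k. \<Sum>n<N. ?b n *\<^sub>R (disc_op B C ^^ n) x k) (sqrt c * M * D / sqrt t)" by simp
    qed simp }
qed

section \<open>Means of shifts and the range of the system operator\<close>

lemma shift_mean_one:
  "shift_mean 1 y n j = (1 / real n) *\<^sub>R (\<Sum>k=1..n. (right_shift ^^ k) y j)"
  by (simp add: shift_mean_def)

lemma lp_le_shift_mean:
  assumes p: "1 \<le> p" and y: "lp_le p y D" and n: "1 \<le> n"
  shows "lp_le p (shift_mean 1 y n) D"
proof -
  have "lp_le p (\<lambda>j. (1 / real n) *\<^sub>R (\<Sum>k=1..n. (right_shift ^^ k) y j)) (\<bar>1 / real n\<bar> * (\<Sum>k=1..n. D))"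
    by (intro lp_le_scaleR lp_le_sum p lp_le_shift_funpow y) auto
  then show ?thesis using n by (simp add: shift_mean_one[abs_def])
qed

lemma lp_le_M_op:
  assumes "1 \<le> p" "lp_le p x D"
  shows "lp_le p (M_op A0 A1 x) (norm (A1 ** matrix_inv A0) * D)"
  unfolding M_op_def by (rule lp_le_dominated[OF assms(2) norm_matrix_vector_mult_le _ assms(1)]) simp

lemma sum_telescope_Suc: "(\<Sum>k=1..n. f k - f (Suc k)) = f 1 - f (Suc n)"
  for f :: "nat \<Rightarrow> 'a::ab_group_add"
  by (induction n) auto

lemma right_shift_linear:
  "right_shift (\<lambda>j. a *\<^sub>R (\<Sum>k\<in>I. f k j)) j = a *\<^sub>R (\<Sum>k\<in>I. right_shift (f k) j)"
  by (cases j) auto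

lemma right_shift_mult: "right_shift (\<lambda>k. A *v x k) j = A *v right_shift x j"
  by (cases j) auto

lemma right_shift_funpow_Suc: "right_shift ((right_shift ^^ k) y) j = (right_shift ^^ Suc k) y j"
  by simp

lemma shift_mean_sum:
  "shift_mean 1 (M_op A0 A1 (\<lambda>k. \<Sum>i\<in>I. a i *\<^sub>R f i k)) n j = (\<Sum>i\<in>I. a i *\<^sub>R shift_mean 1 (M_op A0 A1 (f i)) n j)"
proof -
  have "(right_shift ^^ k) (M_op A0 A1 (\<lambda>k. \<Sum>i\<in>I. a i *\<^sub>R f i k)) j = (\<Sum>i\<in>I. a i *\<^sub>R (right_shift ^^ k) (M_op A0 A1 (f i)) j)" for k
    by (simp add: right_shift_funpow M_op_def matrix_vector_mult_sum_right
        linear_simps(5)[OF matrix_vector_mult_bounded_linear])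
  then have "shift_mean 1 (M_op A0 A1 (\<lambda>k. \<Sum>i\<in>I. a i *\<^sub>R f i k)) n j
      = (\<Sum>k=1..n. \<Sum>i\<in>I. (1 / real n) *\<^sub>R (a i *\<^sub>R (right_shift ^^ k) (M_op A0 A1 (f i)) j))"
    by (simp add: shift_mean_one scaleR_sum_right)
  also have "\<dots> = (\<Sum>i\<in>I. a i *\<^sub>R shift_mean 1 (M_op A0 A1 (f i)) n j)"
    by (subst sum.swap) (simp add: shift_mean_one scaleR_sum_right mult.commute)
  finally show ?thesis .
qed

lemma matrix_neg_mult: "(- A) ** B = - (A ** (B :: complex^'k^'n))"
  by (rule matrix_eqI) (simp add: matrix_mult_nth sum_negf)

lemma matrix_vector_neg_mult: "(- A) *v x = - (A *v (x :: complex^'n))"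
  by (simp add: vec_eq_iff matrix_vector_mult_def sum_negf)

text \<open>As \<open>R(0, A0) = - A0\<^sup>-\<^sup>1\<close>, the characteristic equation at \<open>0\<close> says that \<open>- A1 A0\<^sup>-\<^sup>1\<close> is a projection onto
  the range of \<open>A1\<close>.\<close>

lemma char_equation_at_zero:
  fixes A0 A1 :: "complex^'m^'m"
  assumes "0 \<in> resolvent_set A0" "A1 ** resolvent 0 A0 ** A1 = A1"
  shows "A0 ** matrix_inv A0 = mat 1" "matrix_inv A0 ** A0 = mat 1"
    and "A1 ** matrix_inv A0 ** A1 = - A1"
proof -
  have m: "mat 0 - A0 = mat (-1) ** A0" by (rule matrix_eqI) (simp add: mat_nth)
  have inv: "invertible (mat (-1) ** A0)" using assms(1) unfolding resolvent_set_def mem_Collect_eq m .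
  let ?R = "matrix_inv (mat (-1) ** A0)"
  have 1: "A0 ** (mat (-1) ** ?R) = mat 1"
    using mat_mult_mult[of 1 A0 "-1" ?R] mat_mult_mult[of "-1" A0 1 ?R] matrix_inv_works(1)[OF inv] by simp
  then have N: "matrix_inv A0 = mat (-1) ** ?R" by (rule matrix_inv_eqI)
  show "A0 ** matrix_inv A0 = mat 1" using 1 N by simp
  then show "matrix_inv A0 ** A0 = mat 1" by (simp add: matrix_left_right_inverse)
  have "A1 ** matrix_inv A0 ** A1 = mat (-1) ** (A1 ** ?R ** A1)"
    unfolding N using mat_mult_mult[of 1 A1 "-1" ?R] mat_mult_mult[of "-1" "A1 ** ?R" 1 A1] by simp
  also have "A1 ** ?R ** A1 = A1" using assms(2) unfolding resolvent_def m .
  finally show "A1 ** matrix_inv A0 ** A1 = - A1" by (simp add: vec_eq_iff)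
qed

text \<open>The operator \<open>M\<close> intertwines: \<open>M A = (I - S) A1\<close>.\<close>

lemma M_op_sys_op:
  assumes "matrix_inv A0 ** A0 = mat 1" "A1 ** matrix_inv A0 ** A1 = - A1"
  shows "M_op A0 A1 (sys_op A0 A1 w) k = A1 *v w k - right_shift (\<lambda>k. A1 *v w k) k"
proof -
  have "A1 ** matrix_inv A0 ** A0 = A1" using assms(1) by (simp add: matrix_mul_assoc[symmetric])
  then show ?thesis
    using assms(2) by (simp add: M_op_def sys_op_apply matrix_vector_right_distrib matrix_vector_mul_assoc right_shift_mult matrix_vector_neg_mult)
qed

text \<open>The converse of the intertwining relation: \<open>A A0\<^sup>-\<^sup>1 x = x + S y\<close> with \<open>y = M x\<close>, so \<open>x\<close> agrees with
  \<open>- S y\<close> up to the range of \<open>A\<close>. If \<open>S (y - z) = (I - S) v\<close>, where \<open>M\<close> acts on \<open>y\<close> and \<open>z\<close> as \<open>- I\<close>, then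
  \<open>S (y - z) = - (I - S) M v = - A (A0\<^sup>-\<^sup>1 A1 A0\<^sup>-\<^sup>1 v)\<close> lies in the range too.\<close>

lemma range_decomposition:
  fixes A0 A1 :: "complex^'m^'m" and x v z :: "'m cseq"
  defines "N \<equiv> matrix_inv A0" and "y \<equiv> M_op A0 A1 x"
  assumes inv: "A0 ** N = mat 1" and char: "A1 ** N ** A1 = - A1"
    and z: "\<And>k. (A1 ** N) *v z k = - z k"
    and v: "\<And>k. right_shift y k - right_shift z k = v k - right_shift v k"
  shows "x k = sys_op A0 A1 (\<lambda>k. N *v x k + (N ** A1 ** N) *v v k) k - right_shift z k"
proof -
  define P where "P = A1 ** N"
  have PP: "P *v (P *v w) = - (P *v w)" for w
  proof -
    have "P ** P = - P" unfolding P_def using char by (simp add: matrix_mul_assoc) (simp add: matrix_neg_mult)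
    then show ?thesis by (simp add: matrix_vector_mul_assoc matrix_vector_neg_mult)
  qed
  have Sy: "right_shift y k = P *v right_shift x k"
    unfolding y_def M_op_def N_def[symmetric] P_def[symmetric] by (rule right_shift_mult)
  have Pz: "P *v right_shift z k = - right_shift z k"
    using z by (cases k) (auto simp: P_def)
  have 1: "A0 *v (N *v x k + (N ** A1 ** N) *v v k) = x k + P *v v k"
    using inv by (simp add: matrix_vector_right_distrib matrix_vector_mul_assoc matrix_mul_assoc P_def)
  have 2: "A1 *v right_shift (\<lambda>k. N *v x k + (N ** A1 ** N) *v v k) k = right_shift y k - P *v right_shift v k"
  proof -
    have "right_shift (\<lambda>k. N *v x k + (N ** A1 ** N) *v v k) k = N *v right_shift x k + (N ** A1 ** N) *v right_shift v k"
      by (cases k) auto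
    moreover have "A1 *v ((N ** A1 ** N) *v w) = - (P *v w)" for w
      using PP[of w] by (simp add: P_def matrix_vector_mul_assoc matrix_mul_assoc)
    ultimately show ?thesis
      unfolding Sy by (simp add: matrix_vector_right_distrib) (simp add: P_def matrix_vector_mul_assoc)
  qed
  have "P *v (v k - right_shift v k) = P *v (right_shift y k - right_shift z k)" by (simp add: v)
  also have "\<dots> = - right_shift y k + right_shift z k"
    unfolding matrix_vector_mult_diff_distrib Pz Sy PP by simp
  finally have 3: "P *v v k - P *v right_shift v k = - right_shift y k + right_shift z k"
    by (simp add: matrix_vector_mult_diff_distrib)
  have "sys_op A0 A1 (\<lambda>k. N *v x k + (N ** A1 ** N) *v v k) k
      = x k + right_shift y k + (P *v v k - P *v right_shift v k)"
    unfolding sys_op_apply 1 2 by simp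
  also have "\<dots> = x k + right_shift z k" unfolding 3 by simp
  finally show ?thesis by simp
qed

text \<open>The difference of \<open>y = M x\<close> and its mean is \<open>(I - S)\<close> applied to a mean of partial sums; so \<open>x\<close> lies in the
  range of the system operator up to a shifted mean of \<open>y\<close>.\<close>

lemma mean_range_decomposition:
  fixes A0 A1 :: "complex^'m^'m" and x :: "'m cseq"
  assumes p: "1 \<le> p" and inv: "A0 ** matrix_inv A0 = mat 1" and char: "A1 ** matrix_inv A0 ** A1 = - A1"
    and x: "x \<in> lp_space p" and n: "1 \<le> n"
  shows "\<exists>g\<in>lp_space p. \<forall>k. x k = sys_op A0 A1 g k - right_shift (shift_mean 1 (M_op A0 A1 x) n) k"
proof -
  define y where "y = M_op A0 A1 x"
  define z where "z = shift_mean 1 y n"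
  define v where "v = (\<lambda>j. (1 / real n) *\<^sub>R (\<Sum>k=1..n. \<Sum>i<k. (right_shift ^^ Suc i) y j))"
  let ?N = "matrix_inv A0"
  have xl: "lp_le p x (lp_norm p x)" using x lp_space_iff_lp_le[OF p] by blast
  have yl: "lp_le p y (norm (A1 ** ?N) * lp_norm p x)" unfolding y_def by (rule lp_le_M_op[OF p xl])
  have "lp_le p v (\<bar>1 / real n\<bar> * (\<Sum>k=1..n. \<Sum>i<k. norm (A1 ** ?N) * lp_norm p x))"
    unfolding v_def by (intro lp_le_scaleR lp_le_sum p lp_le_shift_funpow yl) auto
  then obtain V where vl: "lp_le p v V" by blast
  have Py: "(A1 ** ?N) *v y k = - y k" for k
  proof -
    have "(A1 ** ?N) ** (A1 ** ?N) = - (A1 ** ?N)" using char by (simp add: matrix_mul_assoc) (simp add: matrix_neg_mult)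
    then show ?thesis unfolding y_def M_op_def matrix_vector_mul_assoc by (simp add: matrix_vector_neg_mult)
  qed
  have Pz: "(A1 ** ?N) *v z k = - z k" for k
  proof -
    have "(A1 ** ?N) *v (right_shift ^^ i) y k = - (right_shift ^^ i) y k" for i
      by (simp add: right_shift_funpow Py)
    then show ?thesis
      by (simp add: z_def shift_mean_one linear_simps(5)[OF matrix_vector_mult_bounded_linear] matrix_vector_mult_sum_right sum_negf)
  qed
  have "right_shift y k - right_shift z k = v k - right_shift v k" for k
  proof -
    have "right_shift v k = (1 / real n) *\<^sub>R (\<Sum>l=1..n. \<Sum>i<l. (right_shift ^^ Suc (Suc i)) y k)"
    proof -
      have "right_shift (\<lambda>j. \<Sum>i<l. (right_shift ^^ Suc i) y j) k = (\<Sum>i<l. (right_shift ^^ Suc (Suc i)) y k)" for l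
        using right_shift_linear[of 1 "\<lambda>i. (right_shift ^^ Suc i) y" "{..<l}" k] by simp
      then show ?thesis unfolding v_def right_shift_linear by simp
    qed
    then have "v k - right_shift v k = (1 / real n) *\<^sub>R (\<Sum>l=1..n. \<Sum>i<l. (right_shift ^^ Suc i) y k - (right_shift ^^ Suc (Suc i)) y k)"
      by (simp only: v_def scaleR_diff_right[symmetric] sum_subtractf[symmetric])
    also have "(\<Sum>l=1..n. \<Sum>i<l. (right_shift ^^ Suc i) y k - (right_shift ^^ Suc (Suc i)) y k)
        = (\<Sum>l=1..n. right_shift y k - (right_shift ^^ Suc l) y k)"
    proof (rule sum.cong[OF refl])
      fix l
      show "(\<Sum>i<l. (right_shift ^^ Suc i) y k - (right_shift ^^ Suc (Suc i)) y k) = right_shift y k - (right_shift ^^ Suc l) y k"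
        using sum_lessThan_telescope'[of "\<lambda>i. (right_shift ^^ Suc i) y k" l] by simp
    qed
    also have "(1 / real n) *\<^sub>R (\<Sum>l=1..n. right_shift y k - (right_shift ^^ Suc l) y k)
        = right_shift y k - (1 / real n) *\<^sub>R (\<Sum>l=1..n. (right_shift ^^ Suc l) y k)"
    proof -
      have "(\<Sum>l=1..n. right_shift y k) = real n *\<^sub>R right_shift y k"
        by (simp add: sum_constant_scaleR del: sum_constant)
      then show ?thesis using n by (simp add: sum_subtractf scaleR_diff_right)
    qed
    also have "(1 / real n) *\<^sub>R (\<Sum>l=1..n. (right_shift ^^ Suc l) y k) = right_shift z k"
      unfolding z_def shift_mean_one[abs_def] right_shift_linear right_shift_funpow_Suc ..
    finally show ?thesis by simp
  qed
  then have "x k = sys_op A0 A1 (\<lambda>k. ?N *v x k + (?N ** A1 ** ?N) *v v k) k - right_shift z k" for k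
    unfolding y_def by (intro range_decomposition inv char Pz) auto
  moreover have "(\<lambda>k. ?N *v x k + (?N ** A1 ** ?N) *v v k) \<in> lp_space p"
  proof -
    have "lp_le p (\<lambda>k. ?N *v x k) (norm ?N * lp_norm p x)" "lp_le p (\<lambda>k. (?N ** A1 ** ?N) *v v k) (norm (?N ** A1 ** ?N) * V)"
      by (intro lp_le_dominated[OF xl] lp_le_dominated[OF vl] norm_matrix_vector_mult_le norm_ge_zero p)+
    then show ?thesis using lp_le_add[OF p] lp_le_iff[OF p] by blast
  qed
  ultimately show ?thesis unfolding z_def y_def by blast
qed

text \<open>If the sums \<open>\<Sum>k=1..n. S\<^sup>k y\<close> are bounded, then their coordinatewise limit \<open>w\<close> lies in the space by lower
  semicontinuity of the norm, and \<open>S y = (I - S) w\<close>.\<close>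

lemma bounded_means_range:
  fixes A0 A1 :: "complex^'m^'m" and x :: "'m cseq"
  assumes p: "1 \<le> p" and inv: "A0 ** matrix_inv A0 = mat 1" and char: "A1 ** matrix_inv A0 ** A1 = - A1"
    and x: "x \<in> lp_space p"
    and bd: "\<forall>\<^sub>F n in sequentially. lp_le p (shift_mean 1 (M_op A0 A1 x) n) (K / real n)"
  shows "\<exists>g\<in>lp_space p. x = sys_op A0 A1 g"
proof -
  let ?N = "matrix_inv A0"
  define y where "y = M_op A0 A1 x"
  define w where "w j = (\<Sum>i<j. y i)" for j
  have wl: "lp_le p w K"
  proof (rule lp_le_limit[OF p])
    show "((\<lambda>n. real n *\<^sub>R shift_mean 1 y n j) \<longlongrightarrow> w j) sequentially" for j
    proof (rule tendsto_eventually)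
      show "\<forall>\<^sub>F n in sequentially. real n *\<^sub>R shift_mean 1 y n j = w j"
        using eventually_ge_at_top[of "Suc j"]
      proof eventually_elim
        case (elim n)
        then have "real n *\<^sub>R shift_mean 1 y n j = (\<Sum>k=1..n. (right_shift ^^ k) y j)"
          by (simp add: shift_mean_one)
        also have "\<dots> = (\<Sum>k=1..j. y (j - k))"
          using elim by (intro sum.mono_neutral_cong_right) (auto simp: right_shift_funpow)
        also have "\<dots> = (\<Sum>i<j. y i)"
          by (rule sum.reindex_bij_witness[of _ "\<lambda>i. j - i" "\<lambda>k. j - k"]) auto
        finally show ?case by (simp add: w_def)
      qed
    qed
    show "\<forall>\<^sub>F n in sequentially. lp_le p (\<lambda>j. real n *\<^sub>R shift_mean 1 y n j) K"
      using bd eventually_gt_at_top[of 0]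
    proof eventually_elim
      case (elim n)
      then show ?case using lp_le_scaleR[OF p elim(1), of "real n"] by (simp add: y_def)
    qed
  qed simp
  have xl: "lp_le p x (lp_norm p x)" using x lp_space_iff_lp_le[OF p] by blast
  have key: "x k = sys_op A0 A1 (\<lambda>k. ?N *v x k + (?N ** A1 ** ?N) *v w k) k - right_shift (\<lambda>k. 0) k" for k
  proof (rule range_decomposition[OF inv char])
    show "right_shift (M_op A0 A1 x) k - right_shift (\<lambda>k. 0) k = w k - right_shift w k" for k
      by (cases k) (auto simp: w_def y_def)
  qed simp
  have rs0: "right_shift (\<lambda>k. 0 :: complex^'m) k = 0" for k by (cases k) auto
  have "x = sys_op A0 A1 (\<lambda>k. ?N *v x k + (?N ** A1 ** ?N) *v w k)"
    by (rule ext, rule trans[OF key]) (simp only: rs0 diff_zero)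
  moreover have "(\<lambda>k. ?N *v x k + (?N ** A1 ** ?N) *v w k) \<in> lp_space p"
  proof -
    have "lp_le p (\<lambda>k. ?N *v x k) (norm ?N * lp_norm p x)" "lp_le p (\<lambda>k. (?N ** A1 ** ?N) *v w k) (norm (?N ** A1 ** ?N) * K)"
      by (intro lp_le_dominated[OF xl] lp_le_dominated[OF wl] norm_matrix_vector_mult_le norm_ge_zero p)+
    then show ?thesis using lp_le_add[OF p] lp_le_iff[OF p] by blast
  qed
  ultimately show ?thesis by blast
qed

text \<open>The orbit changes by an element of the range, whose means are of order \<open>1 / n\<close>: telescoping
  \<open>x - Q\<^sup>i x\<close> in the Poisson series costs a factor \<open>i\<close>, whose mean is \<open>c t\<close>.\<close>

lemma orbit_difference_mean:
  fixes A0 A1 B C :: "complex^'m^'m" and T :: "real \<Rightarrow> 'm cseq \<Rightarrow> 'm cseq"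
  assumes BC: "B = mat 1 + mat (of_real (1/c)) ** A0" "C = mat (of_real (1/c)) ** A1"
    and p: "1 \<le> p" and gen: "lp_generates p (sys_op A0 A1) T" and c: "0 < c"
    and pb: "\<And>n x D. lp_le p x D \<Longrightarrow> lp_le p ((disc_op B C ^^ n) x) (M * D)" and M: "0 \<le> M"
    and inv: "matrix_inv A0 ** A0 = mat 1" and char: "A1 ** matrix_inv A0 ** A1 = - A1"
    and x: "lp_le p x D" and t: "0 \<le> t" and n: "1 \<le> n"
  shows "lp_le p (shift_mean 1 (M_op A0 A1 (\<lambda>k. x k - T t x k)) n) (2 * norm A1 * M * D * t / real n)"
proof -
  let ?Q = "\<lambda>i. (disc_op B C ^^ i) x"
  let ?\<tau> = "c * t"
  have xs: "x \<in> lp_space p" using x lp_le_iff[OF p] by blast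
  have D: "0 \<le> M * D" using M lp_le_nonneg[OF x] by simp
  have rep: "(\<lambda>n. poi ?\<tau> n *\<^sub>R ?Q n k) sums T t x k" for k
    by (rule semigroup_eq_poisson[OF BC p gen c _ xs t]) (rule pb)
  have step: "lp_le p (shift_mean 1 (M_op A0 A1 (sys_op A0 A1 w)) n) (2 * norm A1 * E / real n)" if w: "lp_le p w E" for w E
  proof -
    define u where "u = (\<lambda>k. A1 *v w k)"
    have ul: "lp_le p u (norm A1 * E)" unfolding u_def
      by (rule lp_le_dominated[OF w norm_matrix_vector_mult_le _ p]) simp
    have eq: "M_op A0 A1 (sys_op A0 A1 w) = (\<lambda>k. u k - right_shift u k)"
      using M_op_sys_op[OF inv char] by (auto simp: u_def)
    have sh: "(right_shift ^^ k) (\<lambda>k. u k - right_shift u k) j = (right_shift ^^ k) u j - (right_shift ^^ Suc k) u j" for k j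
      unfolding funpow.simps(2)[of k right_shift] funpow_swap1 comp_apply
      by (simp add: right_shift_funpow)
    have mean: "shift_mean 1 (M_op A0 A1 (sys_op A0 A1 w)) n j = (1 / real n) *\<^sub>R ((right_shift ^^ 1) u j - (right_shift ^^ Suc n) u j)" for j
    proof -
      have "(\<Sum>k=1..n. (right_shift ^^ k) u j - (right_shift ^^ Suc k) u j) = (right_shift ^^ 1) u j - (right_shift ^^ Suc n) u j"
        by (rule sum_telescope_Suc)
      then show ?thesis unfolding shift_mean_one eq sh by simp
    qed
    have "lp_le p (\<lambda>j. (1 / real n) *\<^sub>R ((right_shift ^^ 1) u j - (right_shift ^^ Suc n) u j)) (\<bar>1 / real n\<bar> * (norm A1 * E + norm A1 * E))"
      by (intro lp_le_scaleR lp_le_diff p lp_le_shift_funpow ul)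
    then have "lp_le p (shift_mean 1 (M_op A0 A1 (sys_op A0 A1 w)) n) (\<bar>1 / real n\<bar> * (norm A1 * E + norm A1 * E))"
      unfolding mean[abs_def, symmetric] .
    then show ?thesis by (rule lp_le_mono[OF _ _ p]) (simp add: mult_ac)
  qed
  have one: "lp_le p (shift_mean 1 (M_op A0 A1 (\<lambda>k. x k - ?Q i k)) n) (real i * (2 * norm A1 * (M * D) / (c * real n)))" for i
  proof -
    have dQ: "x k - ?Q i k = (\<Sum>l<i. (- 1 / c) *\<^sub>R sys_op A0 A1 (?Q l) k)" for k
    proof -
      have "(- 1 / c) *\<^sub>R sys_op A0 A1 (?Q l) k = ?Q l k - ?Q (Suc l) k" for l
        using c by (simp add: sys_op_eq_disc_op[OF c BC] scaleR_diff_right)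
      then show ?thesis using sum_lessThan_telescope'[of "\<lambda>l. ?Q l k" i] by simp
    qed
    have eq: "shift_mean 1 (M_op A0 A1 (\<lambda>k. x k - ?Q i k)) n
       = (\<lambda>j. \<Sum>l<i. (- 1 / c) *\<^sub>R shift_mean 1 (M_op A0 A1 (sys_op A0 A1 (?Q l))) n j)"
      by (intro ext) (simp only: dQ shift_mean_sum)
    have "lp_le p (\<lambda>j. \<Sum>l<i. (- 1 / c) *\<^sub>R shift_mean 1 (M_op A0 A1 (sys_op A0 A1 (?Q l))) n j)
        (\<Sum>l<i. \<bar>- 1 / c\<bar> * (2 * norm A1 * (M * D) / real n))"
      by (intro lp_le_sum lp_le_scaleR p step pb x) auto
    then show ?thesis unfolding eq using c by simp
  qed
  show ?thesis
  proof (rule lp_le_limit[OF p])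
    let ?X = "\<lambda>N j. \<Sum>i<N. poi ?\<tau> i *\<^sub>R shift_mean 1 (M_op A0 A1 (\<lambda>k. x k - ?Q i k)) n j"
    show "((\<lambda>N. ?X N j) \<longlongrightarrow> shift_mean 1 (M_op A0 A1 (\<lambda>k. x k - T t x k)) n j) sequentially" for j
    proof -
      have "(\<lambda>i. poi ?\<tau> i *\<^sub>R x k - poi ?\<tau> i *\<^sub>R ?Q i k) sums (1 *\<^sub>R x k - T t x k)" for k
        by (intro sums_diff rep bounded_linear.sums[OF bounded_linear_scaleR_left poi_sums])
      then have lim: "(\<lambda>N. \<Sum>i<N. poi ?\<tau> i *\<^sub>R (x k - ?Q i k)) \<longlonglongrightarrow> x k - T t x k" for k
        by (simp add: sums_def scaleR_diff_right)
      have "(\<lambda>N. (right_shift ^^ k) (M_op A0 A1 (\<lambda>k. \<Sum>i<N. poi ?\<tau> i *\<^sub>R (x k - ?Q i k))) j)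
          \<longlonglongrightarrow> (right_shift ^^ k) (M_op A0 A1 (\<lambda>k. x k - T t x k)) j" for k
        by (cases "k \<le> j") (auto simp: right_shift_funpow M_op_def
          intro!: bounded_linear.tendsto[OF matrix_vector_mult_bounded_linear] lim)
      then have "(\<lambda>N. shift_mean 1 (M_op A0 A1 (\<lambda>k. \<Sum>i<N. poi ?\<tau> i *\<^sub>R (x k - ?Q i k))) n j)
          \<longlonglongrightarrow> shift_mean 1 (M_op A0 A1 (\<lambda>k. x k - T t x k)) n j"
        unfolding shift_mean_one by (intro tendsto_intros)
      then show ?thesis unfolding shift_mean_sum .
    qed
    have weights: "(\<Sum>i<N. \<bar>poi ?\<tau> i\<bar> * (real i * W)) = (\<Sum>i<N. real i * poi ?\<tau> i) * W" for N W
      using c t by (simp add: sum_distrib_left poi_nonneg mult_ac)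
    have "lp_le p (?X N) (2 * norm A1 * M * D * t / real n)" for N
    proof (rule lp_le_mono[OF lp_le_sum[OF p _ lp_le_scaleR[OF p one]] _ p])
      have "(\<Sum>i<N. real i * poi ?\<tau> i) \<le> ?\<tau>"
        using sum_le_suminf[of "\<lambda>i. real i * poi ?\<tau> i" "{..<N}"] poi_mean_sums[of ?\<tau>] poi_nonneg[of ?\<tau>] c t by (auto simp: sums_iff)
      then have "(\<Sum>i<N. real i * poi ?\<tau> i) * (2 * norm A1 * (M * D) / (c * real n)) \<le> ?\<tau> * (2 * norm A1 * (M * D) / (c * real n))"
        using D c by (intro mult_right_mono) auto
      also have "\<dots> = 2 * norm A1 * M * D * t / real n" using c by simp
      finally show "(\<Sum>i<N. \<bar>poi ?\<tau> i\<bar> * (real i * (2 * norm A1 * (M * D) / (c * real n)))) \<le> 2 * norm A1 * M * D * t / real n"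
        unfolding weights .
    qed simp
    then show "\<forall>\<^sub>F N in sequentially. lp_le p (?X N) (2 * norm A1 * M * D * t / real n)" by simp
  qed simp
qed

section \<open>Dependence on the exponent\<close>

lemma lp_norm_tendsto_zeroI:
  assumes "1 \<le> p" "\<And>\<epsilon>. 0 < \<epsilon> \<Longrightarrow> eventually (\<lambda>b. lp_le p (f b) \<epsilon>) F"
  shows "((\<lambda>b. lp_norm p (f b)) \<longlongrightarrow> 0) F"
proof (rule tendstoI)
  fix e :: real assume "0 < e"
  then have "eventually (\<lambda>b. lp_le p (f b) (e / 2)) F" by (intro assms) simp
  then show "eventually (\<lambda>b. dist (lp_norm p (f b)) 0 < e) F"
  proof eventually_elim
    case (elim b)
    then have "f b \<in> lp_space p" "lp_norm p (f b) \<le> e / 2" using assms(1) by (auto simp: lp_le_iff)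
    then show ?case using \<open>0 < e\<close> lp_norm_nonneg[OF assms(1), of "f b"] by simp
  qed
qed

lemma lp_norm_tendsto_zeroD:
  assumes "1 \<le> p" "((\<lambda>b. lp_norm p (f b)) \<longlongrightarrow> 0) F" "eventually (\<lambda>b. f b \<in> lp_space p) F" "0 < \<epsilon>"
  shows "eventually (\<lambda>b. lp_le p (f b) \<epsilon>) F"
  using order_tendstoD(2)[OF assms(2,4)] assms(3)
  by eventually_elim (use assms(1) in \<open>auto simp: lp_le_iff\<close>)

text \<open>For \<open>1 < p < \<infinity>\<close> a finitely supported sequence has means with \<open>n + L\<close> entries of size \<open>1 / n\<close>,
  and \<open>n\<^bsup>1/p - 1\<^esup> \<rightarrow> 0\<close>; such sequences are dense.\<close>

lemma shift_means_tendsto_zero: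
  fixes y :: "'m::finite cseq"
  assumes p: "1 < p" "p < \<infinity>" and y: "y \<in> lp_space p"
  shows "(\<lambda>n. lp_norm p (shift_mean 1 y n)) \<longlonglongrightarrow> 0"
proof -
  have p1: "1 \<le> p" and pinf: "p \<noteq> \<infinity>" using p by auto
  define r where "r = enn2real p"
  have r: "1 < r"
  proof -
    have "enn2real 1 < enn2real p" using p by (subst enn2real_less_iff) (auto simp: top.not_eq_extremum)
    then show ?thesis by (simp add: r_def)
  qed
  show ?thesis
  proof (rule lp_norm_tendsto_zeroI[OF p1])
    fix \<epsilon> :: real assume \<epsilon>: "0 < \<epsilon>"
    have summ: "summable (\<lambda>k. norm (y k) powr r)" using y pinf by (simp add: lp_space_def r_def)
    obtain L where L: "\<And>n. L \<le> n \<Longrightarrow> norm (\<Sum>i. norm (y (i + n)) powr r) < (\<epsilon> / 2) powr r"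
      using suminf_exist_split[OF _ summ, of "(\<epsilon> / 2) powr r"] \<epsilon> by auto
    define y1 where "y1 k = (if k < L then y k else 0)" for k
    define y2 where "y2 k = (if k < L then 0 else y k)" for k
    have y2: "lp_le p y2 (\<epsilon> / 2)"
    proof -
      have sL: "summable (\<lambda>i. norm (y (i + L)) powr r)" using summ by (rule summable_ignore_initial_segment)
      have "(\<Sum>k<N. norm (y2 k) powr r) \<le> (\<epsilon> / 2) powr r" for N
      proof -
        have "(\<Sum>k<N. norm (y2 k) powr r) \<le> (\<Sum>k<L + N. norm (y2 k) powr r)"
          by (intro sum_mono2) auto
        also have "\<dots> = (\<Sum>k\<in>{L..<L + N}. norm (y k) powr r)"
          by (rule sum.mono_neutral_cong_right) (auto simp: y2_def)
        also have "\<dots> = (\<Sum>i<N. norm (y (i + L)) powr r)"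
          by (rule sum.reindex_bij_witness[of _ "\<lambda>i. i + L" "\<lambda>k. k - L"]) auto
        also have "\<dots> \<le> (\<Sum>i. norm (y (i + L)) powr r)" by (rule sum_le_suminf[OF sL]) auto
        also have "\<dots> \<le> (\<epsilon> / 2) powr r" using L[of L] by (auto simp: abs_less_iff)
        finally show ?thesis .
      qed
      then show ?thesis using \<epsilon> pinf by (simp add: lp_le_def r_def)
    qed
    define Y where "Y = (\<Sum>i<L. norm (y i))"
    have Y: "0 \<le> Y" by (simp add: Y_def sum_nonneg)
    have y1: "lp_le p (shift_mean 1 y1 n) (real (n + L) powr (1 / r) * (Y / real n))" if n: "1 \<le> n" for n
    proof -
      have bound: "norm (shift_mean 1 y1 n j) \<le> Y / real n" for j
      proof -
        have "norm (\<Sum>k=1..n. (right_shift ^^ k) y1 j) \<le> (\<Sum>k=1..n. norm ((right_shift ^^ k) y1 j))"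
          by (rule norm_sum)
        also have "\<dots> = (\<Sum>k\<in>{k. 1 \<le> k \<and> k \<le> n \<and> k \<le> j \<and> j - k < L}. norm (y (j - k)))"
          by (rule sum.mono_neutral_cong_right) (auto simp: right_shift_funpow y1_def)
        also have "\<dots> = (\<Sum>i\<in>(\<lambda>k. j - k) ` {k. 1 \<le> k \<and> k \<le> n \<and> k \<le> j \<and> j - k < L}. norm (y i))"
          by (subst sum.reindex) (auto simp: inj_on_def)
        also have "\<dots> \<le> Y" unfolding Y_def by (rule sum_mono2) auto
        finally show ?thesis using n by (simp add: shift_mean_one divide_right_mono)
      qed
      have zero: "shift_mean 1 y1 n j = 0" if "n + L \<le> j" for j
      proof -
        have "(right_shift ^^ k) y1 j = 0" if "k \<in> {1..n}" for k
          using that \<open>n + L \<le> j\<close> by (auto simp: right_shift_funpow y1_def)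
        then show ?thesis by (simp add: shift_mean_one)
      qed
      have "(\<Sum>j<N. norm (shift_mean 1 y1 n j) powr r) \<le> (real (n + L) powr (1 / r) * (Y / real n)) powr r" for N
      proof -
        have "(\<Sum>j<N. norm (shift_mean 1 y1 n j) powr r) \<le> (\<Sum>j<N + (n + L). norm (shift_mean 1 y1 n j) powr r)"
          by (intro sum_mono2) auto
        also have "\<dots> = (\<Sum>j<n + L. norm (shift_mean 1 y1 n j) powr r)"
          by (rule sum.mono_neutral_right) (auto simp: zero)
        also have "\<dots> \<le> (\<Sum>j<n + L. (Y / real n) powr r)"
          using r by (intro sum_mono powr_mono2 bound) auto
        also have "\<dots> = (real (n + L) powr (1 / r) * (Y / real n)) powr r"
          by (subst powr_mult) (use r Y in \<open>auto simp: powr_powr simp del: of_nat_add\<close>)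
        finally show ?thesis .
      qed
      then show ?thesis using Y pinf by (simp add: lp_le_def r_def)
    qed
    have lim: "(\<lambda>n. real (n + L) powr (1 / r) * (Y / real n)) \<longlonglongrightarrow> 0"
    proof (rule Lim_null_comparison)
      have "1 / r - 1 < 0" using r by simp
      then have "((\<lambda>x. x powr (1 / r - 1)) \<longlongrightarrow> 0) at_top" by (intro tendsto_neg_powr filterlim_ident)
      then have "(\<lambda>n. real n powr (1 / r - 1)) \<longlonglongrightarrow> 0"
        by (rule filterlim_compose[OF _ filterlim_real_sequentially])
      then show "(\<lambda>n. 2 powr (1 / r) * Y * real n powr (1 / r - 1)) \<longlonglongrightarrow> 0"
        by (rule tendsto_mult_right_zero)
      show "\<forall>\<^sub>F n in sequentially. norm (real (n + L) powr (1 / r) * (Y / real n)) \<le> 2 powr (1 / r) * Y * real n powr (1 / r - 1)"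
        using eventually_ge_at_top[of "max 1 L"]
      proof eventually_elim
        case (elim n)
        have "real (n + L) powr (1 / r) \<le> (2 * real n) powr (1 / r)"
          using elim r by (intro powr_mono2) auto
        then have "real (n + L) powr (1 / r) * (Y / real n) \<le> (2 * real n) powr (1 / r) * (Y / real n)"
          using Y by (intro mult_right_mono) auto
        also have "\<dots> = 2 powr (1 / r) * Y * real n powr (1 / r - 1)"
          using elim by (simp add: powr_mult powr_diff)
        finally show ?case using Y by simp
      qed
    qed
    have add: "shift_mean 1 y n = (\<lambda>j. shift_mean 1 y1 n j + shift_mean 1 y2 n j)" for n
    proof
      fix j
      have "(right_shift ^^ k) y j = (right_shift ^^ k) y1 j + (right_shift ^^ k) y2 j" for k
        by (auto simp: right_shift_funpow y1_def y2_def)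
      then show "shift_mean 1 y n j = shift_mean 1 y1 n j + shift_mean 1 y2 n j"
        by (simp add: shift_mean_one sum.distrib scaleR_add_right)
    qed
    have "\<forall>\<^sub>F n in sequentially. real (n + L) powr (1 / r) * (Y / real n) < \<epsilon> / 2"
      by (rule order_tendstoD(2)[OF lim]) (use \<epsilon> in simp)
    then show "\<forall>\<^sub>F n in sequentially. lp_le p (shift_mean 1 y n) \<epsilon>"
      using eventually_ge_at_top[of 1]
    proof eventually_elim
      case (elim n)
      have "lp_le p (shift_mean 1 y n) (real (n + L) powr (1 / r) * (Y / real n) + \<epsilon> / 2)"
        unfolding add by (intro lp_le_add p1 y1 lp_le_shift_mean y2 elim)
      then show ?case by (rule lp_le_mono[OF _ _ p1]) (use elim(1) in linarith)
    qed
  qed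
qed

text \<open>At \<open>p = 1\<close> the shifts of a sequence concentrated at \<open>0\<close> have disjoint supports and their norms add up; at
  \<open>p = \<infinity>\<close> a constant sequence is reproduced by its mean from coordinate \<open>n\<close> on.\<close>

lemma shift_means_not_tendsto_zero:
  fixes w :: "complex^'m"
  assumes p: "1 \<le> p" "\<not> (1 < p \<and> p < \<infinity>)"
  defines "x \<equiv> \<lambda>k. if p = \<infinity> \<or> k = 0 then w else 0"
  shows "x \<in> lp_space p" and "1 \<le> n \<Longrightarrow> norm w \<le> lp_norm p (shift_mean 1 x n)"
proof -
  consider "p = \<infinity>" | "p = 1" using p by (metis infinity_ennreal_def order_le_less top.not_eq_extremum)
  then have "x \<in> lp_space p \<and> (1 \<le> n \<longrightarrow> norm w \<le> lp_norm p (shift_mean 1 x n))"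
  proof cases
    case 1
    have xl: "lp_le p x (norm w)" by (simp add: lp_le_def 1 x_def)
    have "norm w \<le> lp_norm p (shift_mean 1 x n)" if n: "1 \<le> n"
    proof -
      have "(\<Sum>k=1..n. (right_shift ^^ k) x n) = (\<Sum>k=1..n. w)"
        by (intro sum.cong) (auto simp: right_shift_funpow x_def 1)
      then have "shift_mean 1 x n n = w" using n by (simp add: shift_mean_one sum_constant_scaleR del: sum_constant)
      moreover have "lp_le p (shift_mean 1 x n) (lp_norm p (shift_mean 1 x n))"
        using lp_le_shift_mean[OF p(1) xl n] lp_le_iff[OF p(1)] by blast
      ultimately show ?thesis using lp_le_coord[OF p(1), of "shift_mean 1 x n" _ n] by metis
    qed
    then show ?thesis using xl lp_le_iff[OF p(1)] by blast
  next
    case 2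
    have sum1: "(\<Sum>k<N. norm (x k) powr 1) \<le> norm w powr 1" for N
    proof -
      have "(\<Sum>k<N. norm (x k) powr 1) \<le> (\<Sum>k\<in>insert 0 {..<N}. norm (x k) powr 1)"
        by (intro sum_mono2) auto
      also have "\<dots> = (\<Sum>k\<in>{0}. norm (x k) powr 1)"
        by (rule sum.mono_neutral_right) (auto simp: x_def 2)
      finally show ?thesis by (simp add: x_def)
    qed
    then have xl: "lp_le p x (norm w)" by (simp add: lp_le_def 2)
    have "norm w \<le> lp_norm p (shift_mean 1 x n)" if n: "1 \<le> n"
    proof -
      have mean: "shift_mean 1 x n j = (1 / real n) *\<^sub>R w" if "j \<in> {1..n}" for j
      proof -
        have "(\<Sum>k=1..n. (right_shift ^^ k) x j) = (\<Sum>k\<in>{j}. (right_shift ^^ k) x j)"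
          using that by (intro sum.mono_neutral_right) (auto simp: right_shift_funpow x_def 2)
        then show ?thesis by (simp add: shift_mean_one right_shift_funpow x_def)
      qed
      have "lp_le p (shift_mean 1 x n) (lp_norm p (shift_mean 1 x n))"
        using lp_le_shift_mean[OF p(1) xl n] lp_le_iff[OF p(1)] by blast
      then have le: "(\<Sum>j<Suc n. norm (shift_mean 1 x n j) powr 1) \<le> lp_norm p (shift_mean 1 x n) powr 1"
        and nn: "0 \<le> lp_norm p (shift_mean 1 x n)"
        by (auto simp: lp_le_def 2 simp del: sum.lessThan_Suc)
      have "norm w = (\<Sum>j\<in>{1..n}. norm ((1 / real n) *\<^sub>R w))" using n by simp
      also have "\<dots> = (\<Sum>j\<in>{1..n}. norm (shift_mean 1 x n j) powr 1)"
        by (intro sum.cong refl) (simp add: mean)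
      also have "\<dots> \<le> (\<Sum>j<Suc n. norm (shift_mean 1 x n j) powr 1)"
        by (intro sum_mono2) auto
      finally show ?thesis using le nn by simp
    qed
    then show ?thesis using xl lp_le_iff[OF p(1)] by blast
  qed
  then show "x \<in> lp_space p" "1 \<le> n \<Longrightarrow> norm w \<le> lp_norm p (shift_mean 1 x n)" by auto
qed

section \<open>Convergence of orbits\<close>

text \<open>For \<open>t \<ge> e\<close> the logarithmic factor of the rate is at least \<open>1\<close>.\<close>

lemma bigo_log_rateI:
  assumes "\<And>t. 0 < t \<Longrightarrow> 0 \<le> f t" "\<And>t. 0 < t \<Longrightarrow> f t \<le> K / sqrt t"
  shows "f \<in> O(log_rate p)"
proof (rule bigoI[of _ "\<bar>K\<bar>"])
  show "\<forall>\<^sub>F t in at_top. norm (f t) \<le> \<bar>K\<bar> * norm (log_rate p t)"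
    using eventually_ge_at_top[of "exp 1"]
  proof eventually_elim
    case (elim t)
    have t: "0 < t" using elim exp_gt_zero[of 1] by linarith
    have "1 \<le> ln t" using elim t by (simp add: ln_ge_iff)
    then have "1 \<le> ln t powr \<bar>1/2 - enn2real (1 / p)\<bar>" by (intro ge_one_powr_ge_zero) auto
    then have "1 / sqrt t \<le> log_rate p t"
      using t by (simp add: log_rate_def powr_half_sqrt divide_right_mono)
    then have "\<bar>K\<bar> * (1 / sqrt t) \<le> \<bar>K\<bar> * \<bar>log_rate p t\<bar>" by (intro mult_left_mono) auto
    moreover have "K / sqrt t \<le> \<bar>K\<bar> * (1 / sqrt t)" using t by (simp add: divide_right_mono)
    ultimately show ?case using assms[OF t] by simp
  qed
qed

lemma inverse_sqrt_small:
  assumes "0 < (\<epsilon> :: real)"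
  shows "\<forall>\<^sub>F t in at_top. 0 < t \<and> K / sqrt t < \<epsilon>"
proof -
  have "((\<lambda>t. K / sqrt t) \<longlongrightarrow> 0) at_top"
    by (intro tendsto_divide_0[OF tendsto_const] filterlim_at_top_imp_at_infinity sqrt_at_top)
  then show ?thesis using order_tendstoD(2)[OF _ assms] eventually_gt_at_top[of 0] by (intro eventually_conj) auto
qed

lemma sys_op_injective:
  fixes A0 A1 :: "complex^'m^'m" and y :: "'m cseq"
  assumes inv: "matrix_inv A0 ** A0 = mat 1" and zero: "\<And>k. sys_op A0 A1 y k = 0"
  shows "y k = 0"
proof (induction k rule: less_induct)
  case (less k)
  have "right_shift y k = 0" using less by (cases k) auto
  then have "A0 *v y k = 0" using zero[of k] by (simp add: sys_op_apply)
  then have "matrix_inv A0 *v (A0 *v y k) = 0" by simp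
  then show ?case by (simp add: matrix_vector_mul_assoc inv)
qed

text \<open>A limit \<open>y\<close> of an orbit satisfies \<open>A y = 0\<close>, as \<open>A T(t) x \<rightarrow> 0\<close>; and \<open>A\<close> is injective.\<close>

lemma limit_of_orbit_zero:
  fixes A0 A1 :: "complex^'m^'m" and T :: "real \<Rightarrow> 'm cseq \<Rightarrow> 'm cseq"
  assumes p: "1 \<le> p" and inv: "matrix_inv A0 ** A0 = mat 1"
    and decay: "\<And>t. 0 < t \<Longrightarrow> lp_le p (sys_op A0 A1 (T t x)) (K / sqrt t)"
    and Tx: "\<And>t. 0 \<le> t \<Longrightarrow> T t x \<in> lp_space p"
    and y: "y \<in> lp_space p" and lim: "lp_tendsto p (\<lambda>t. T t x) y at_top"
  shows "y = (\<lambda>k. 0)"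
proof
  fix k
  have ev: "\<forall>\<^sub>F t in at_top. T t x \<in> lp_space p" using eventually_ge_at_top[of 0] by eventually_elim (rule Tx)
  have c: "((\<lambda>t. T t x j) \<longlongrightarrow> y j) at_top" for j by (rule lp_tendsto_coord[OF p lim ev y])
  have "sys_op A0 A1 y j = 0" for j
  proof -
    have "((\<lambda>t. right_shift (T t x) j) \<longlongrightarrow> right_shift y j) at_top" by (cases j) (auto intro: c)
    then have "((\<lambda>t. sys_op A0 A1 (T t x) j) \<longlongrightarrow> sys_op A0 A1 y j) at_top"
      unfolding sys_op_apply by (intro tendsto_add bounded_linear.tendsto[OF matrix_vector_mult_bounded_linear] c)
    moreover have "((\<lambda>t. sys_op A0 A1 (T t x) j) \<longlongrightarrow> 0) at_top"
    proof (rule tendstoI)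
      fix e :: real assume "0 < e"
      show "\<forall>\<^sub>F t in at_top. dist (sys_op A0 A1 (T t x) j) 0 < e"
        using inverse_sqrt_small[OF \<open>0 < e\<close>, of K]
      proof eventually_elim
        case (elim t)
        have "norm (sys_op A0 A1 (T t x) j) \<le> K / sqrt t" by (rule lp_le_coord[OF p decay]) (use elim in simp)
        then show ?case using elim by simp
      qed
    qed
    ultimately show ?thesis by (rule tendsto_unique[rotated]) simp
  qed
  then show "y k = 0" by (rule sys_op_injective[OF inv])
qed

text \<open>Write \<open>x = A g - S z\<close> with a small mean \<open>z\<close>: the orbit of \<open>A g\<close> tends to \<open>0\<close>, and that of \<open>S z\<close> stays small.\<close>

lemma small_means_imp_small_orbit:
  fixes A0 A1 :: "complex^'m^'m" and T :: "real \<Rightarrow> 'm cseq \<Rightarrow> 'm cseq"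
  assumes p: "1 \<le> p" and gen: "lp_generates p (sys_op A0 A1) T"
    and inv: "A0 ** matrix_inv A0 = mat 1" and char: "A1 ** matrix_inv A0 ** A1 = - A1" and M: "0 \<le> M"
    and bd: "\<And>x D t. lp_le p x D \<Longrightarrow> 0 \<le> t \<Longrightarrow> lp_le p (T t x) (M * D)"
    and dc: "\<And>x D t. lp_le p x D \<Longrightarrow> 0 < t \<Longrightarrow> lp_le p (sys_op A0 A1 (T t x)) (R * D / sqrt t)"
    and x: "x \<in> lp_space p"
    and means: "(\<lambda>n. lp_norm p (shift_mean 1 (M_op A0 A1 x) n)) \<longlonglongrightarrow> 0"
  shows "((\<lambda>t. lp_norm p (T t x)) \<longlongrightarrow> 0) at_top"
proof (rule lp_norm_tendsto_zeroI[OF p])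
  fix \<epsilon> :: real assume \<epsilon>: "0 < \<epsilon>"
  let ?z = "shift_mean 1 (M_op A0 A1 x)"
  define e where "e = \<epsilon> / (2 * (M + 1))"
  have e: "0 < e" "M * e \<le> \<epsilon> / 2"
  proof -
    show "0 < e" using \<epsilon> M by (simp add: e_def)
    have "M * e = \<epsilon> / 2 * (M / (M + 1))" using M by (simp add: e_def field_simps)
    also have "\<dots> \<le> \<epsilon> / 2 * 1" using M \<epsilon> by (intro mult_left_mono) auto
    finally show "M * e \<le> \<epsilon> / 2" by simp
  qed
  have xl: "lp_le p x (lp_norm p x)" using x lp_space_iff_lp_le[OF p] by blast
  have "\<forall>\<^sub>F n in sequentially. ?z n \<in> lp_space p"
    using eventually_ge_at_top[of 1]
  proof eventually_elim
    case (elim n)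
    show ?case using lp_le_shift_mean[OF p lp_le_M_op[OF p xl] elim] lp_le_iff[OF p] by blast
  qed
  then have "\<forall>\<^sub>F n in sequentially. lp_le p (?z n) e"
    by (rule lp_norm_tendsto_zeroD[OF p means _ e(1)])
  then have "\<forall>\<^sub>F n in sequentially. 1 \<le> n \<and> lp_le p (?z n) e"
    by (intro eventually_conj eventually_ge_at_top)
  then obtain n where n: "1 \<le> n" "lp_le p (?z n) e"
    using eventually_happens'[OF sequentially_bot] by blast
  obtain g where g: "g \<in> lp_space p" "\<And>k. x k = sys_op A0 A1 g k - right_shift (?z n) k"
    using mean_range_decomposition[OF p inv char x n(1)] by blast
  have gl: "lp_le p g (lp_norm p g)" using g lp_space_iff_lp_le[OF p] by blast
  have zl: "lp_le p (right_shift (?z n)) e" by (rule lp_le_right_shift[OF p n(2)])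
  have eq: "x = (\<lambda>k. sys_op A0 A1 g k - right_shift (?z n) k)" by (rule ext, rule g(2))
  show "\<forall>\<^sub>F t in at_top. lp_le p (T t x) \<epsilon>"
    using inverse_sqrt_small[of "\<epsilon> / 2" "R * lp_norm p g"]
  proof (rule eventually_mono)
    fix t assume t: "0 < t \<and> R * lp_norm p g / sqrt t < \<epsilon> / 2"
    have bl: "lp_bounded_linear p (T t)" using gen t by (simp add: lp_generates_def lp_C0_semigroup_def)
    have zs: "right_shift (?z n) \<in> lp_space p" using zl lp_le_iff[OF p] by blast
    have "T t (\<lambda>k. sys_op A0 A1 g k - right_shift (?z n) k) = (\<lambda>k. T t (sys_op A0 A1 g) k - T t (right_shift (?z n)) k)"
      by (rule lp_bounded_linear_diff[OF p bl sys_op_lp_space[OF p g(1)] zs])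
    then have "T t x = (\<lambda>k. sys_op A0 A1 (T t g) k - T t (right_shift (?z n)) k)"
      unfolding eq[symmetric] using semigroup_derivative(1)[OF p gen sys_op_lp_space[OF p] g(1), of t] t by simp
    moreover have "lp_le p (\<lambda>k. sys_op A0 A1 (T t g) k - T t (right_shift (?z n)) k) (R * lp_norm p g / sqrt t + M * e)"
      using t by (intro lp_le_diff p dc gl bd zl) auto
    ultimately have "lp_le p (T t x) (R * lp_norm p g / sqrt t + M * e)" by simp
    then show "lp_le p (T t x) \<epsilon>" by (rule lp_le_mono[OF _ _ p]) (use conjunct2[OF t] e(2) in linarith)
  qed (use \<epsilon> in simp)
qed

text \<open>Compare \<open>x\<close> with a late point of its orbit: the means of the difference are \<open>O(1 / n)\<close>, and the late point is
  itself small.\<close>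

lemma small_orbit_imp_small_means:
  fixes A0 A1 :: "complex^'m^'m" and T :: "real \<Rightarrow> 'm cseq \<Rightarrow> 'm cseq"
  assumes p: "1 \<le> p" and x: "x \<in> lp_space p" and Tx: "\<And>t. 0 \<le> t \<Longrightarrow> T t x \<in> lp_space p"
    and diff: "\<And>t n. 0 \<le> t \<Longrightarrow> 1 \<le> n \<Longrightarrow> lp_le p (shift_mean 1 (M_op A0 A1 (\<lambda>k. x k - T t x k)) n) (W * t / real n)"
    and orbit: "((\<lambda>t. lp_norm p (T t x)) \<longlongrightarrow> 0) at_top"
  shows "(\<lambda>n. lp_norm p (shift_mean 1 (M_op A0 A1 x) n)) \<longlonglongrightarrow> 0"
proof (rule lp_norm_tendsto_zeroI[OF p])
  fix \<epsilon> :: real assume \<epsilon>: "0 < \<epsilon>"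
  let ?P = "norm (A1 ** matrix_inv A0)"
  define e where "e = \<epsilon> / (2 * (?P + 1))"
  have P1: "0 < ?P + 1" by (simp add: add_nonneg_pos)
  have e: "0 < e" "?P * e \<le> \<epsilon> / 2"
  proof -
    show "0 < e" using \<epsilon> P1 by (simp add: e_def)
    have "?P * e = \<epsilon> / 2 * (?P / (?P + 1))" using P1 by (simp add: e_def field_simps)
    also have "\<dots> \<le> \<epsilon> / 2 * 1" using P1 \<epsilon> by (intro mult_left_mono) auto
    finally show "?P * e \<le> \<epsilon> / 2" by simp
  qed
  have "\<forall>\<^sub>F t in at_top. T t x \<in> lp_space p" using eventually_ge_at_top[of 0] by eventually_elim (rule Tx)
  then have "\<forall>\<^sub>F t in at_top. lp_le p (T t x) e" by (rule lp_norm_tendsto_zeroD[OF p orbit _ e(1)])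
  then have "\<forall>\<^sub>F t in at_top. (0::real) \<le> t \<and> lp_le p (T t x) e"
    by (intro eventually_conj eventually_ge_at_top)
  then obtain t where t: "0 \<le> t" "lp_le p (T t x) e"
    using eventually_happens'[OF trivial_limit_at_top_linorder] by blast
  have "(\<lambda>n. W * t * (1 / real n)) \<longlonglongrightarrow> 0" by (intro tendsto_mult_right_zero lim_1_over_n)
  then have "\<forall>\<^sub>F n in sequentially. W * t * (1 / real n) < \<epsilon> / 2"
    by (rule order_tendstoD(2)) (use \<epsilon> in simp)
  then show "\<forall>\<^sub>F n in sequentially. lp_le p (shift_mean 1 (M_op A0 A1 x) n) \<epsilon>"
    using eventually_ge_at_top[of 1]
  proof eventually_elim
    case (elim n)
    have "shift_mean 1 (M_op A0 A1 x) n = (\<lambda>j. shift_mean 1 (M_op A0 A1 (\<lambda>k. x k - T t x k)) n j + shift_mean 1 (M_op A0 A1 (T t x)) n j)"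
    proof
      fix j
      have "(right_shift ^^ k) (M_op A0 A1 x) j = (right_shift ^^ k) (M_op A0 A1 (\<lambda>k. x k - T t x k)) j + (right_shift ^^ k) (M_op A0 A1 (T t x)) j" for k
        by (auto simp: right_shift_funpow M_op_def matrix_vector_mult_diff_distrib)
      then show "shift_mean 1 (M_op A0 A1 x) n j = shift_mean 1 (M_op A0 A1 (\<lambda>k. x k - T t x k)) n j + shift_mean 1 (M_op A0 A1 (T t x)) n j"
        by (simp add: shift_mean_one sum.distrib scaleR_add_right)
    qed
    moreover have "lp_le p (\<lambda>j. shift_mean 1 (M_op A0 A1 (\<lambda>k. x k - T t x k)) n j + shift_mean 1 (M_op A0 A1 (T t x)) n j) (W * t / real n + ?P * e)"
      by (intro lp_le_add p diff t lp_le_shift_mean lp_le_M_op elim)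
    ultimately have "lp_le p (shift_mean 1 (M_op A0 A1 x) n) (W * t / real n + ?P * e)" by simp
    moreover have "W * t / real n < \<epsilon> / 2" using elim(1) by (simp only: times_divide_eq_right mult_1_right)
    then have "W * t / real n + ?P * e \<le> \<epsilon>" using e(2) by linarith
    ultimately show ?case using lp_le_mono p by blast
  qed
qed

theorem theorem2p11:
  fixes p :: ennreal
    and A0 A1 :: "complex^'m^'m"
    and \<phi> :: "complex \<Rightarrow> complex"
    and T :: "real \<Rightarrow> 'm cseq \<Rightarrow> 'm cseq"
  assumes "1 \<le> p"
    and "A1 \<noteq> 0"
    and "rational_function \<phi>"
    and "\<forall>z\<in>resolvent_set A0. A1 ** resolvent z A0 ** A1 = mat (\<phi> z) ** A1"
    and "lp_generates p (sys_op A0 A1) T"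
    and "spectrum A0 \<subseteq> {z. Re z < 0}"
    and "0 \<in> Omega_plus A0 \<phi>"
    and "Omega_plus A0 \<phi> \<subseteq> {z. Re z < 0} \<union> {0}"
    and "char_completely_monotonic A0 \<phi>"
  shows "convergence_set p T =
           {x0 \<in> lp_space p.
              (\<lambda>n. lp_norm p (shift_mean (\<phi> 0) (M_op A0 A1 x0) n)) \<longlonglongrightarrow> 0} \<and>
         (convergence_set p T = lp_space p \<longleftrightarrow> 1 < p \<and> p < \<infinity>) \<and>
         (\<forall>x0\<in>convergence_set p T. ((\<lambda>t. lp_norm p (T t x0)) \<longlongrightarrow> 0) at_top) \<and>
         (\<forall>x0\<in>convergence_set p T.
            (\<lambda>n. lp_norm p (shift_mean (\<phi> 0) (M_op A0 A1 x0) n)) \<in> O(\<lambda>n. 1 / real n) \<longrightarrow>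
            (\<lambda>t. lp_norm p (T t x0)) \<in> O(log_rate p)) \<and>
         (\<forall>x0\<in>lp_space p. \<exists>x'.
            (\<forall>t\<ge>0. lp_has_derivative_at p (\<lambda>s. T s x0) (x' t) t) \<and>
            (\<lambda>t. lp_norm p (x' t)) \<in> O(log_rate p))"
proof -
  note p = assms(1) and gen = assms(5)
  have f0: "\<phi> 0 = 1" by (rule discretisation_exists(1)[OF assms(2,3,4,6,7,8,9)])
  obtain c F K L q where c: "0 < c" and q: "0 < q" "q < 1" and F0: "fps_nth F 0 = 0"
    and F: "\<And>n. (mat (of_real (1/c)) ** A1) ** mat_pow (mat 1 + mat (of_real (1/c)) ** A0) n ** (mat (of_real (1/c)) ** A1)
           = mat (fps_nth F (Suc n)) ** (mat (of_real (1/c)) ** A1)"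
    and L: "\<And>n. norm (mat_pow (mat 1 + mat (of_real (1/c)) ** A0) n) \<le> L * q ^ n"
    and K: "\<And>n J. (\<Sum>j<J. cmod (fps_nth (F ^ j) n)) \<le> K"
    using discretisation_exists(2)[OF assms(2,3,4,6,7,8,9)] by metis
  define B where "B = mat 1 + mat (of_real (1/c)) ** A0"
  define C where "C = mat (of_real (1/c)) ** A1"
  obtain M where M: "\<And>n J. (\<Sum>j<J. norm (disc_ker B C n j)) \<le> M"
    using disc_ker_summable[OF q F0 F L K] unfolding B_def C_def by blast
  have M0: "0 \<le> M" using M[of 0 0] by simp
  have pb: "lp_le p ((disc_op B C ^^ n) x) (M * D)" if "lp_le p x D" for n x D
    by (rule disc_op_power_bounded[OF p M that])
  define R where "R = sqrt c * M"
  have bd: "lp_le p (T t x) (M * D)" if "lp_le p x D" "0 \<le> t" for x D t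
    by (rule semigroup_bounds(1)[OF B_def C_def p gen c _ M0 that]) (rule pb)
  have dc: "lp_le p (sys_op A0 A1 (T t x)) (R * D / sqrt t)" if "lp_le p x D" "0 < t" for x D t
    unfolding R_def by (rule semigroup_bounds(2)[OF B_def C_def p gen c _ M0 that]) (rule pb)
  have zero: "0 \<in> resolvent_set A0" using assms(7) by (simp add: Omega_plus_def)
  have "A1 ** resolvent 0 A0 ** A1 = A1" using assms(4) zero f0 by simp
  note inv = char_equation_at_zero[OF zero this]
  have xl: "lp_le p x (lp_norm p x)" if "x \<in> lp_space p" for x :: "'m cseq"
    using that lp_space_iff_lp_le[OF p] by blast
  have Tl: "T t x \<in> lp_space p" if "x \<in> lp_space p" "0 \<le> t" for x t
    using bd[OF xl[OF that(1)] that(2)] lp_le_iff[OF p] by blast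
  have to_zero: "((\<lambda>t. lp_norm p (T t x)) \<longlongrightarrow> 0) at_top" if cx: "x \<in> convergence_set p T" for x
  proof -
    obtain y where x: "x \<in> lp_space p" and y: "y \<in> lp_space p" "lp_tendsto p (\<lambda>t. T t x) y at_top"
      using cx by (auto simp: convergence_set_def)
    have "y = (\<lambda>k. 0)"
      by (rule limit_of_orbit_zero[where T = T and x = x and K = "R * lp_norm p x", OF p inv(2) dc[OF xl[OF x]] Tl[OF x] y])
    then show ?thesis using y(2) by (simp add: lp_tendsto_def)
  qed
  have conv_iff: "x \<in> convergence_set p T \<longleftrightarrow> x \<in> lp_space p \<and> ((\<lambda>t. lp_norm p (T t x)) \<longlongrightarrow> 0) at_top" for x
  proof
    assume "x \<in> lp_space p \<and> ((\<lambda>t. lp_norm p (T t x)) \<longlongrightarrow> 0) at_top"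
    moreover have "(\<lambda>k. 0) \<in> lp_space p" using lp_le_zero lp_le_iff[OF p] by blast
    ultimately show "x \<in> convergence_set p T"
      unfolding convergence_set_def lp_tendsto_def by (auto intro!: bexI[of _ "\<lambda>k. 0"])
  qed (use to_zero in \<open>auto simp: convergence_set_def\<close>)
  have means_iff: "((\<lambda>t. lp_norm p (T t x)) \<longlongrightarrow> 0) at_top \<longleftrightarrow> (\<lambda>n. lp_norm p (shift_mean 1 (M_op A0 A1 x) n)) \<longlonglongrightarrow> 0"
    if x: "x \<in> lp_space p" for x
  proof
    assume "((\<lambda>t. lp_norm p (T t x)) \<longlongrightarrow> 0) at_top"
    then show "(\<lambda>n. lp_norm p (shift_mean 1 (M_op A0 A1 x) n)) \<longlonglongrightarrow> 0"
    proof (rule small_orbit_imp_small_means[where T = T, OF p x Tl[OF x], rotated -1])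
      show "lp_le p (shift_mean 1 (M_op A0 A1 (\<lambda>k. x k - T t x k)) n) (2 * norm A1 * M * lp_norm p x * t / real n)"
        if "0 \<le> t" "1 \<le> n" for t n
        by (rule orbit_difference_mean[OF B_def C_def p gen c _ M0 inv(2,3) xl[OF x] that]) (rule pb)
    qed
  next
    assume means: "(\<lambda>n. lp_norm p (shift_mean 1 (M_op A0 A1 x) n)) \<longlonglongrightarrow> 0"
    show "((\<lambda>t. lp_norm p (T t x)) \<longlongrightarrow> 0) at_top"
    proof (rule small_means_imp_small_orbit[OF p gen inv(1,3) M0 _ _ x means])
      show "lp_le p (T t z) (M * D)" if "lp_le p z D" "0 \<le> t" for z D t by (rule bd[OF that])
      show "lp_le p (sys_op A0 A1 (T t z)) (R * D / sqrt t)" if "lp_le p z D" "0 < t" for z D t by (rule dc[OF that])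
    qed
  qed
  have set_eq: "convergence_set p T = {x0 \<in> lp_space p. (\<lambda>n. lp_norm p (shift_mean 1 (M_op A0 A1 x0) n)) \<longlonglongrightarrow> 0}"
    using conv_iff means_iff by blast
  have all_iff: "convergence_set p T = lp_space p \<longleftrightarrow> 1 < p \<and> p < \<infinity>"
  proof
    assume "1 < p \<and> p < \<infinity>"
    then have "(\<lambda>n. lp_norm p (shift_mean 1 (M_op A0 A1 x) n)) \<longlonglongrightarrow> 0" if "x \<in> lp_space p" for x
      using shift_means_tendsto_zero[of p "M_op A0 A1 x"] lp_le_M_op[OF p xl[OF that], of A0 A1] lp_le_iff[OF p] by blast
    then show "convergence_set p T = lp_space p" using set_eq by blast
  next
    assume all: "convergence_set p T = lp_space p"
    show "1 < p \<and> p < \<infinity>"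
    proof (rule ccontr)
      assume end_point: "\<not> (1 < p \<and> p < \<infinity>)"
      have "A1 ** matrix_inv A0 \<noteq> 0"
      proof
        assume "A1 ** matrix_inv A0 = 0"
        then have "A1 ** matrix_inv A0 ** A1 = 0" by (simp add: vec_eq_iff matrix_mult_nth)
        then show False using inv(3) assms(2) by simp
      qed
      then obtain v where v: "(A1 ** matrix_inv A0) *v v \<noteq> 0"
        using matrix_eq[of "A1 ** matrix_inv A0" 0] by auto
      define x where "x k = (if p = \<infinity> \<or> k = 0 then v else 0)" for k :: nat
      have x: "x \<in> lp_space p"
        unfolding x_def[abs_def] by (rule shift_means_not_tendsto_zero(1)[OF p end_point])
      let ?w = "(A1 ** matrix_inv A0) *v v"
      have Mx: "M_op A0 A1 x = (\<lambda>k. if p = \<infinity> \<or> k = 0 then ?w else 0)"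
        by (auto simp: M_op_def x_def)
      have "(\<lambda>n. lp_norm p (shift_mean 1 (M_op A0 A1 x) n)) \<longlonglongrightarrow> 0" using all set_eq x by blast
      then have "norm ?w \<le> 0"
      proof (rule tendsto_lowerbound)
        show "\<forall>\<^sub>F n in sequentially. norm ?w \<le> lp_norm p (shift_mean 1 (M_op A0 A1 x) n)"
          using eventually_ge_at_top[of 1]
          by eventually_elim (unfold Mx, rule shift_means_not_tendsto_zero(2)[OF p end_point])
      qed simp
      then show False using v by simp
    qed
  qed
  have rate: "(\<lambda>t. lp_norm p (T t x)) \<in> O(log_rate p)"
    if x: "x \<in> lp_space p" and O: "(\<lambda>n. lp_norm p (shift_mean 1 (M_op A0 A1 x) n)) \<in> O(\<lambda>n. 1 / real n)" for x
  proof -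
    obtain k where "\<forall>\<^sub>F n in sequentially. norm (lp_norm p (shift_mean 1 (M_op A0 A1 x) n)) \<le> k * norm (1 / real n)"
      using O by (elim landau_o.bigE)
    then have "\<forall>\<^sub>F n in sequentially. lp_le p (shift_mean 1 (M_op A0 A1 x) n) (k / real n)"
      using eventually_ge_at_top[of 1]
    proof eventually_elim
      case (elim n)
      have "shift_mean 1 (M_op A0 A1 x) n \<in> lp_space p"
        using lp_le_shift_mean[OF p lp_le_M_op[OF p xl[OF x]] elim(2)] lp_le_iff[OF p] by blast
      then show ?case using elim by (simp add: lp_le_iff[OF p])
    qed
    then obtain g where g: "g \<in> lp_space p" "x = sys_op A0 A1 g"
      using bounded_means_range[OF p inv(1,3) x] by blast
    show ?thesis
    proof (rule bigo_log_rateI)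
      fix t :: real assume t: "0 < t"
      show "0 \<le> lp_norm p (T t x)" using Tl[OF x] t by (intro lp_norm_nonneg p) auto
      have "T t x = sys_op A0 A1 (T t g)"
        unfolding g(2) using t by (intro semigroup_derivative(1)[OF p gen sys_op_lp_space[OF p] g(1)]) auto
      then show "lp_norm p (T t x) \<le> (R * lp_norm p g) / sqrt t"
        using dc[OF xl[OF g(1)] t] by (simp add: lp_le_iff[OF p])
    qed
  qed
  have deriv: "\<exists>x'. (\<forall>t\<ge>0. lp_has_derivative_at p (\<lambda>s. T s x) (x' t) t) \<and> (\<lambda>t. lp_norm p (x' t)) \<in> O(log_rate p)"
    if x: "x \<in> lp_space p" for x
  proof (intro exI conjI allI impI)
    show "lp_has_derivative_at p (\<lambda>s. T s x) (sys_op A0 A1 (T t x)) t" if "0 \<le> t" for t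
      by (rule semigroup_derivative(2)[OF p gen sys_op_lp_space[OF p] x that])
    show "(\<lambda>t. lp_norm p (sys_op A0 A1 (T t x))) \<in> O(log_rate p)"
    proof (rule bigo_log_rateI)
      fix t :: real assume t: "0 < t"
      show "0 \<le> lp_norm p (sys_op A0 A1 (T t x))"
        using Tl[OF x] t by (intro lp_norm_nonneg p sys_op_lp_space) auto
      show "lp_norm p (sys_op A0 A1 (T t x)) \<le> (R * lp_norm p x) / sqrt t"
        using dc[OF xl[OF x] t] by (simp add: lp_le_iff[OF p])
    qed
  qed
  have "x \<in> lp_space p" if "x \<in> convergence_set p T" for x using that conv_iff by blast
  then show ?thesis
    unfolding f0 using set_eq all_iff to_zero rate deriv by blast
qed

end
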